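(* Fix an integer $d\ge 2$. There are constants $\varepsilon_0,K_0>0$, not depending on $\beta,\gamma,N$, such that for all $\beta>0$ and $\gamma>0$ the following hold. (i) If $d=2$, then $$\lim_{N\to\infty} Q_{N}\Big[\varepsilon_0 \Big(\frac{\gamma}{\beta+\gamma}\Big)^{1/2} N(\log N)^{-1/2}\le R_N\le K_{0}\Big(\frac{\beta+\gamma}{\beta}\Big)^{1/2} N(\log N)^{3/2}\Big]=1.$$ (ii) If $d\ge 3$, then $$\lim_{N\to\infty} Q_{N}\Big[\varepsilon_0\Big(\frac{\gamma}{\beta+\gamma}\Big)^{1/d}N\le R_N\le K_{0}\Big(\frac{\beta+\gamma}{\beta}\Big)^{1/2}N^{d/2}\Big]=1.$$
   Context: Let $d\ge2$ and $N\ge1$ be integers and $S_N^d=[-N,N]^d\cap\mathbb{Z}^d$. Let $\mathcal N$ be the set of unordered nearest neighbor pairs in $S_N^d$. For $f,g:S_N^d\to\mathbb{R}$ put $H(f,g)=\sum_{(\mathbf x,\mathbf y)\in\mathcal N}(f(\mathbf x)-f(\mathbf y))(g(\mathbf x)-g(\mathbf y))$ and $(f,g)=\sum_{\mathbf x\in S_N^d}f(\mathbf x)g(\mathbf x)$, and define the (Neumann) Laplacian $\Delta$ on functions on $S_N^d$ by $H(f,g)=-(f,\Delta g)$ for all $f,g$. The operator $-\Delta$ is self-adjoint and nonnegative definite; let $(\varphi_{\mathbf k})_{\mathbf k\in\mathbb I}$ be an orthonormal basis (for $(\cdot,\cdot)$) of eigenfunctions of $-\Delta$ with eigenvalues $(\lambda_{\mathbf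 k})_{\mathbf k\in\mathbb I}$, where the index $\mathbf 0\in\mathbb I$ corresponds to the constant eigenfunction, with $\lambda_{\mathbf 0}=0$ (all other eigenvalues are positive). The discrete Gaussian free field (DGFF) with values in $\mathbb{R}^d$ at inverse temperature $\beta>0$ is $\mathbf u=(u^{(1)},\dots,u^{(d)})$ with $u^{(i)}=\sum_{\mathbf k\in\mathbb I\setminus\{\mathbf 0\}}X^{(i)}_{\mathbf k}\varphi_{\mathbf k}$, where the $X^{(i)}_{\mathbf k}$ ($\mathbf k\in\mathbb I\setminus\{\mathbf 0\}$, $1\le i\le d$) are independent centered Gaussian random variables with variance $(2\beta\lambda_{\mathbf k})^{-1}$. Equivalently, $\mathbf u$ has density proportional to $\exp\big(-\beta\sum_{(\mathbf x,\mathbf y)\in\mathcal N}\|\mathbf u(\mathbf x)-\mathbf u(\mathbf y)\|^2\big)$ on the space of $\mathbf u:S_N^d\to\mathbb{R}^d$ with $\sum_{\mathbf x\in S_N^d}\mathbf u(\mathbf x)=0$. Let $P_N$ be the law of $\mathbf u$ and $E$ the corresponding expectation. For $\mathbf z\in\mathbb{R}^d$ the local time is $\ell_N(\mathbf z,\mathbf u)=\#\{\mathbf x\in S_N^d:\mathbf u(\mathbf x)\in[\mathbf z-\mathbf{1/2},\mathbf z+\mathbf{1/2}]\}$, where $\mathbf{1/2}=(1/2,\dots,1/2)\in\mathbb{R}^d$ and $[\mathbf z-\mathbf{1/2},\mathbf z+\mathbf{1/2}]=\prod_{i=1}^d[z_i-1/2,z_i+1/2]$. For $\gamma>0$ let $\mathcal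 E_N=\exp\big(-\gamma\int_{\mathbb{R}^d}\ell_N(\mathbf y,\mathbf u)^2\,d\mathbf y\big)$ and $Z_N=E[\mathcal E_N]$. The weakly self-avoiding DGFF is $\mathbf u$ under the probability measure $Q_N$ given by $Q_N(A)=Z_N^{-1}E[\mathcal E_N\mathbf 1_A]$ for events $A$. The effective radius is $R_N=\max_{\mathbf w,\mathbf z\in S_N^d}\|\mathbf u(\mathbf z)-\mathbf u(\mathbf w)\|$, with $\|\cdot\|$ the Euclidean norm. *)

theory Defs
  imports "HOL-Probability.Probability"
begin

definition lattice_box :: "nat \<Rightarrow> (int ^ 'd) set" where
  "lattice_box N = {x. \<forall>i. \<bar>x $ i\<bar> \<le> int N}"

definition nn_pairs :: "nat \<Rightarrow> (int ^ 'd) set set" where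
  "nn_pairs N =
     {{x, y} | x y. x \<in> lattice_box N \<and> y \<in> lattice_box N \<and> (\<Sum>i\<in>UNIV. \<bar>x $ i - y $ i\<bar>) = 1}"

text \<open>The summand belonging to an unordered pair \<open>e = {x, y}\<close> is \<open>(f x - f y) * (g x - g y)\<close>:
  the double sum over \<open>e\<close> counts it once for each ordering, see \<open>dirichlet_summand\<close> below.\<close>

definition dirichlet_form ::
  "nat \<Rightarrow> (int ^ 'd \<Rightarrow> real) \<Rightarrow> (int ^ 'd \<Rightarrow> real) \<Rightarrow> real" where
  "dirichlet_form N f g =
     (\<Sum>e\<in>nn_pairs N. (\<Sum>x\<in>e. \<Sum>y\<in>e. (f x - f y) * (g x - g y)) / 2)"

definition box_inner :: "nat \<Rightarrow> (int ^ 'd \<Rightarrow> real) \<Rightarrow> (int ^ 'd \<Rightarrow> real) \<Rightarrow> real" where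
  "box_inner N f g = (\<Sum>x\<in>lattice_box N. f x * g x)"

text \<open>Functions on the box are represented by functions on the whole lattice, of which only the
  values on the box matter; \<open>extensional\<close> normalises the values outside.  The description is
  well defined by \<open>neumann_laplacian_ex1\<close> below.\<close>

definition neumann_laplacian :: "nat \<Rightarrow> (int ^ 'd \<Rightarrow> real) \<Rightarrow> (int ^ 'd \<Rightarrow> real)" where
  "neumann_laplacian N g =
     (THE h. h \<in> extensional (lattice_box N) \<and> (\<forall>f. dirichlet_form N f g = - box_inner N f h))"

text \<open>Positivity of the eigenvalues with nonzero index is a consequence (the box is connected) and
  is therefore not required.\<close>

definition neumann_eigenbasis ::
  "nat \<Rightarrow> 'k::zero set \<Rightarrow> ('k \<Rightarrow> int ^ 'd \<Rightarrow> real) \<Rightarrow> ('k \<Rightarrow> real) \<Rightarrow> bool" where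
  "neumann_eigenbasis N I \<phi> lam \<longleftrightarrow>
     finite I \<and> 0 \<in> I \<and>
     (\<forall>k\<in>I. \<forall>l\<in>I. box_inner N (\<phi> k) (\<phi> l) = (if k = l then 1 else 0)) \<and>
     (\<forall>f. \<exists>c. \<forall>x\<in>lattice_box N. f x = (\<Sum>k\<in>I. c k * \<phi> k x)) \<and>
     (\<forall>k\<in>I. \<forall>x\<in>lattice_box N. - neumann_laplacian N (\<phi> k) x = lam k * \<phi> k x) \<and>
     (\<exists>c. \<forall>x\<in>lattice_box N. \<phi> 0 x = c) \<and> lam 0 = 0"

text \<open>The joint law of the coefficients \<open>X (k, i)\<close>; the second parameter of
  \<open>normal_density\<close> is the standard deviation.\<close>

definition dgff_coeff_law ::
  "real \<Rightarrow> 'k::zero set \<Rightarrow> ('k \<Rightarrow> real) \<Rightarrow> ('k \<times> 'd \<Rightarrow> real) measure" where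
  "dgff_coeff_law \<beta> I lam =
     (\<Pi>\<^sub>M (k, i) \<in> (I - {0}) \<times> UNIV. density lborel (normal_density 0 (sqrt (1 / (2 * \<beta> * lam k)))))"

definition dgff_field ::
  "nat \<Rightarrow> 'k::zero set \<Rightarrow> ('k \<Rightarrow> int ^ 'd \<Rightarrow> real) \<Rightarrow> ('k \<times> 'd \<Rightarrow> real) \<Rightarrow> (int ^ 'd \<Rightarrow> real ^ 'd)" where
  "dgff_field N I \<phi> X = (\<lambda>x\<in>lattice_box N. \<chi> i. \<Sum>k\<in>I - {0}. X (k, i) * \<phi> k x)"

definition dgff_law ::
  "real \<Rightarrow> nat \<Rightarrow> 'k::zero set \<Rightarrow> ('k \<Rightarrow> int ^ 'd \<Rightarrow> real) \<Rightarrow> ('k \<Rightarrow> real) \<Rightarrow> (int ^ 'd \<Rightarrow> real ^ 'd) measure"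
  where
  "dgff_law \<beta> N I \<phi> lam =
     distr (dgff_coeff_law \<beta> I lam) (\<Pi>\<^sub>M x \<in> lattice_box N. borel) (dgff_field N I \<phi>)"

definition local_time :: "nat \<Rightarrow> real ^ 'd \<Rightarrow> (int ^ 'd \<Rightarrow> real ^ 'd) \<Rightarrow> nat" where
  "local_time N z u =
     card {x \<in> lattice_box N. u x \<in> cbox (z - (\<chi> i. 1 / 2)) (z + (\<chi> i. 1 / 2))}"

definition avoidance_weight :: "real \<Rightarrow> nat \<Rightarrow> (int ^ 'd \<Rightarrow> real ^ 'd) \<Rightarrow> real" where
  "avoidance_weight \<gamma> N u = exp (- \<gamma> * (LINT y|lborel. (real (local_time N y u))\<^sup>2))"

definition partition_fn ::
  "real \<Rightarrow> real \<Rightarrow> nat \<Rightarrow> 'k::zero set \<Rightarrow> ('k \<Rightarrow> int ^ 'd \<Rightarrow> real) \<Rightarrow> ('k \<Rightarrow> real) \<Rightarrow> real" where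
  "partition_fn \<beta> \<gamma> N I \<phi> lam = (LINT u|dgff_law \<beta> N I \<phi> lam. avoidance_weight \<gamma> N u)"

definition wsa_prob ::
  "real \<Rightarrow> real \<Rightarrow> nat \<Rightarrow> 'k::zero set \<Rightarrow> ('k \<Rightarrow> int ^ 'd \<Rightarrow> real) \<Rightarrow> ('k \<Rightarrow> real) \<Rightarrow>
    (int ^ 'd \<Rightarrow> real ^ 'd) set \<Rightarrow> real" where
  "wsa_prob \<beta> \<gamma> N I \<phi> lam A =
     inverse (partition_fn \<beta> \<gamma> N I \<phi> lam) *
     (LINT u|dgff_law \<beta> N I \<phi> lam. avoidance_weight \<gamma> N u * indicator A u)"

definition effective_radius :: "nat \<Rightarrow> (int ^ 'd \<Rightarrow> real ^ 'd) \<Rightarrow> real" where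
  "effective_radius N u =
     Max {norm (u z - u w) | w z. w \<in> lattice_box N \<and> z \<in> lattice_box N}"

lemma dirichlet_summand:
  fixes f g :: "int ^ 'd \<Rightarrow> real"
  shows "(\<Sum>a\<in>{x, y}. \<Sum>b\<in>{x, y}. (f a - f b) * (g a - g b)) / 2 = (f x - f y) * (g x - g y)"
  by (cases "x = y") (auto simp: field_simps)

lemma finite_lattice_box: "finite (lattice_box N :: (int ^ 'd) set)"
proof -
  have "lattice_box N \<subseteq> vec_lambda ` (UNIV \<rightarrow>\<^sub>E {- int N..int N} :: ('d \<Rightarrow> int) set)"
  proof
    fix x :: "int ^ 'd"
    assume "x \<in> lattice_box N"
    then have "vec_nth x \<in> UNIV \<rightarrow>\<^sub>E {- int N..int N}"
      by (auto simp: lattice_box_def abs_le_iff minus_le_iff)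
    then show "x \<in> vec_lambda ` (UNIV \<rightarrow>\<^sub>E {- int N..int N})"
      by (metis imageI vec_nth_inverse)
  qed
  then show ?thesis
    by (rule finite_subset) (intro finite_imageI finite_PiE, auto)
qed

lemma neumann_laplacian_ex1:
  fixes g :: "int ^ 'd \<Rightarrow> real"
  shows "\<exists>!h. h \<in> extensional (lattice_box N) \<and> (\<forall>f. dirichlet_form N f g = - box_inner N f h)"
proof -
  let ?S = "lattice_box N :: (int ^ 'd) set"
  let ?\<delta> = "\<lambda>x y :: int ^ 'd. if x = y then 1 else 0 :: real"
  let ?h = "restrict (\<lambda>x. - dirichlet_form N (?\<delta> x) g) ?S"
  have lam: "box_inner N (?\<delta> x) h = h x" if "x \<in> ?S" for x and h :: "int ^ 'd \<Rightarrow> real"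
  proof -
    have "box_inner N (?\<delta> x) h = (\<Sum>y\<in>?S. if x = y then h y else 0)"
      unfolding box_inner_def by (rule sum.cong) auto
    then show ?thesis using that by (simp add: finite_lattice_box)
  qed
  have lin: "dirichlet_form N f g = (\<Sum>x\<in>?S. f x * dirichlet_form N (?\<delta> x) g)" for f
  proof -
    have ex: "f y = (\<Sum>x\<in>?S. f x * ?\<delta> x y)" if "y \<in> ?S" for y
    proof -
      have "(\<Sum>x\<in>?S. f x * ?\<delta> x y) = (\<Sum>x\<in>?S. if x = y then f x else 0)"
        by (rule sum.cong) auto
      then show ?thesis using that by (simp add: finite_lattice_box)
    qed
    have "(\<Sum>x\<in>e. \<Sum>y\<in>e. (f x - f y) * (g x - g y)) =
        (\<Sum>z\<in>?S. f z * (\<Sum>x\<in>e. \<Sum>y\<in>e. (?\<delta> z x - ?\<delta> z y) * (g x - g y)))"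
      if "e \<in> nn_pairs N" for e
    proof -
      have sub: "e \<subseteq> ?S" using that by (auto simp: nn_pairs_def)
      have "(\<Sum>x\<in>e. \<Sum>y\<in>e. (f x - f y) * (g x - g y)) =
          (\<Sum>x\<in>e. \<Sum>y\<in>e. \<Sum>z\<in>?S. f z * ((?\<delta> z x - ?\<delta> z y) * (g x - g y)))"
      proof (intro sum.cong refl)
        fix x y assume "x \<in> e" "y \<in> e"
        then have "f x - f y = (\<Sum>z\<in>?S. f z * (?\<delta> z x - ?\<delta> z y))"
          using sub ex[of x] ex[of y]
            by (simp only: sum_subtractf right_diff_distrib subset_iff)
        then show "(f x - f y) * (g x - g y) =
            (\<Sum>z\<in>?S. f z * ((?\<delta> z x - ?\<delta> z y) * (g x - g y)))"
          by (simp add: sum_distrib_right mult.assoc)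
      qed
      also have "\<dots> = (\<Sum>x\<in>e. \<Sum>z\<in>?S. \<Sum>y\<in>e. f z * ((?\<delta> z x - ?\<delta> z y) * (g x - g y)))"
        by (intro sum.cong refl sum.swap)
      also have "\<dots> = (\<Sum>z\<in>?S. \<Sum>x\<in>e. \<Sum>y\<in>e. f z * ((?\<delta> z x - ?\<delta> z y) * (g x - g y)))"
        by (rule sum.swap)
      finally show ?thesis by (simp only: sum_distrib_left)
    qed
    then have "dirichlet_form N f g = (\<Sum>e\<in>nn_pairs N. \<Sum>z\<in>?S.
        f z * ((\<Sum>x\<in>e. \<Sum>y\<in>e. (?\<delta> z x - ?\<delta> z y) * (g x - g y)) / 2))"
      unfolding dirichlet_form_def
      by (intro sum.cong refl) (simp only: sum_divide_distrib[of _ ?S] times_divide_eq_right)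
    also have "\<dots> = (\<Sum>z\<in>?S. \<Sum>e\<in>nn_pairs N.
        f z * ((\<Sum>x\<in>e. \<Sum>y\<in>e. (?\<delta> z x - ?\<delta> z y) * (g x - g y)) / 2))"
      by (rule sum.swap)
    finally show ?thesis by (simp only: sum_distrib_left dirichlet_form_def)
  qed
  show ?thesis
  proof (rule ex1I[of _ ?h], intro conjI allI)
    show "?h \<in> extensional ?S" by simp
    show "dirichlet_form N f g = - box_inner N f ?h" for f
      unfolding lin[of f] by (simp add: box_inner_def sum_negf)
  next
    fix h
    assume h: "h \<in> extensional ?S \<and> (\<forall>f. dirichlet_form N f g = - box_inner N f h)"
    show "h = ?h"
    proof (rule extensionalityI[of _ ?S])
      fix x assume "x \<in> ?S"
      then show "h x = ?h x" using h lam[of x h] by simp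
    qed (use h in auto)
  qed
qed

end

theory Submission
  imports Defs "HOL-Real_Asymp.Real_Asymp"
begin

text \<open>
  Write \<open>n = (2N+1)^d\<close> for the number of sites and \<open>\<Lambda> = log_factor d N\<close>, which is \<open>ln N\<close> for \<open>d = 2\<close> and large
  \<open>N\<close>, and \<open>1\<close> for \<open>d \<ge> 3\<close>.  The proof compares the partition function with the weight carried by fields of
  too small or too large radius.

  The partition function satisfies \<open>Z \<ge> exp (- C n \<Lambda> (\<beta> + \<gamma>))\<close> with \<open>C\<close> depending on \<open>d\<close> only
  (\<open>partition_fn_lower\<close>).  Translating the Gaussian field by the linear profile \<open>x \<mapsto> a x\<close> with
  \<open>a = 2 sqrt \<Lambda>\<close> costs at most a constant times \<open>\<beta> n \<Lambda>\<close>, and Jensen's inequality bounds \<open>- ln Z\<close> by this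
  cost plus \<open>\<gamma>\<close> times the expected integral of the squared local time of the translated field
  (\<open>exp_integral_lower_bound\<close>).  This integral is at most the number of pairs of sites whose values differ by
  at most \<open>1\<close> in every component.  The components of the increment \<open>u(x) - u(y)\<close>, \<open>x \<noteq> y\<close>, are independent
  Gaussians whose variance lies between \<open>c / \<beta>\<close> and \<open>C \<Lambda>^2 / \<beta>\<close>; summing the resulting probabilities over \<open>y\<close> gives a
  factor \<open>1 + C sd_max / (a sd_min)\<close>, of order \<open>sqrt \<Lambda>\<close> and free of \<open>\<beta>\<close>, for each of the \<open>d\<close> coordinates, hence
  \<open>C n \<Lambda>\<close> in total.

  The variance of an increment is an effective resistance, divided by \<open>2 \<beta>\<close>.  Its upper bound is dual to the
  inequality \<open>(f x - f y)^2 \<le> C \<Lambda>^2 H(f, f)\<close> (\<open>oscillation_le\<close>), which is proved by comparing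
  \<open>f x\<close> with the mean of \<open>f\<close> over the box along dyadic contractions towards \<open>x\<close>: the scale \<open>2^j\<close> contributes
  \<open>(2^j / N)^((d-2)/2)\<close>, and there are about \<open>log N\<close> scales.  This argument uses no explicit eigenfunctions.

  If the radius is less than \<open>r\<close>, then by Cauchy--Schwarz the integral of the squared local time is at least
  \<open>n^2 / (2r+1)^d\<close> (\<open>self_overlap_lower\<close>); multiplied by \<open>\<gamma>\<close>, this exceeds the exponent of \<open>Z\<close> for the claimed lower rate.  If
  the radius is greater than \<open>r\<close>, some increment is large, and the Gaussian tail with variance at most
  \<open>C \<Lambda>^2 / \<beta>\<close> yields an exponent of order \<open>\<beta> r^2 / \<Lambda>^2\<close> (\<open>radius_tail\<close>), which for the claimed upper rate
  again exceeds the exponent of \<open>Z\<close>.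
\<close>

section \<open>The Dirichlet form on the box\<close>

lemma card_vec_box:
  fixes A :: "'d::finite \<Rightarrow> 'a set"
  assumes "\<And>i. finite (A i)"
  shows "finite {z :: 'a ^ 'd. \<forall>i. z $ i \<in> A i}"
    and "card {z :: 'a ^ 'd. \<forall>i. z $ i \<in> A i} = (\<Prod>i\<in>UNIV. card (A i))"
proof -
  have bij: "bij_betw vec_lambda (PiE UNIV A) {z :: 'a ^ 'd. \<forall>i. z $ i \<in> A i}"
    by (rule bij_betw_byWitness[of _ vec_nth]) (auto simp: PiE_UNIV_domain)
  have fin: "finite (PiE UNIV A)"
    using assms by (intro finite_PiE) auto
  show "finite {z :: 'a ^ 'd. \<forall>i. z $ i \<in> A i}"
    using bij_betw_finite[OF bij] fin by simp
  show "card {z :: 'a ^ 'd. \<forall>i. z $ i \<in> A i} = (\<Prod>i\<in>UNIV. card (A i))"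
    using bij_betw_same_card[OF bij] by (simp add: card_PiE)
qed

lemma lattice_box_conv: "lattice_box N = {x :: int ^ 'd::finite. \<forall>i. x $ i \<in> {- int N..int N}}"
  unfolding lattice_box_def by (auto simp: abs_le_iff minus_le_iff)

lemma card_lattice_box: "card (lattice_box N :: (int ^ 'd::finite) set) = (2 * N + 1) ^ CARD('d)"
proof -
  have "card (lattice_box N :: (int ^ 'd) set) = (\<Prod>i\<in>(UNIV::'d set). card {- int N..int N})"
    unfolding lattice_box_conv by (rule card_vec_box) auto
  also have "\<dots> = (2 * N + 1) ^ CARD('d)"
    by (simp add: nat_add_distrib nat_mult_distrib)
  finally show ?thesis .
qed

lemma zero_in_lattice_box: "0 \<in> lattice_box N"
  by (simp add: lattice_box_def)

text \<open>The summand of the Dirichlet form \<open>H(f, f)\<close> that belongs to the unordered pair \<open>e\<close>; halving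
  the double sum compensates for the two orderings of the pair.\<close>
definition edge_energy :: "(int ^ 'd::finite \<Rightarrow> real) \<Rightarrow> (int ^ 'd) set \<Rightarrow> real" where
  "edge_energy f e = (\<Sum>x\<in>e. \<Sum>y\<in>e. (f x - f y)\<^sup>2) / 2"

lemma edge_energy_pair: "edge_energy f {x, y} = (f x - f y)\<^sup>2"
  using dirichlet_summand[where f=f and g=f and x=x and y=y] by (simp add: edge_energy_def power2_eq_square)

lemma edge_energy_nonneg: "edge_energy f e \<ge> 0"
  unfolding edge_energy_def by (intro divide_nonneg_nonneg sum_nonneg) auto

lemma dirichlet_form_self: "dirichlet_form N f f = (\<Sum>e\<in>nn_pairs N. edge_energy f e)"
  by (simp add: dirichlet_form_def edge_energy_def power2_eq_square)

lemma dirichlet_form_nonneg: "dirichlet_form N f f \<ge> 0"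
  unfolding dirichlet_form_self by (intro sum_nonneg edge_energy_nonneg)

lemma nn_pairs_cover:
  "nn_pairs N \<subseteq> (\<lambda>(x, v). {x, x + v}) ` (lattice_box N \<times> (lattice_box 1 :: (int ^ 'd::finite) set))"
proof
  fix e :: "(int ^ 'd) set" assume "e \<in> nn_pairs N"
  then obtain x y where e: "e = {x, y}" "x \<in> lattice_box N" "y \<in> lattice_box N"
    "(\<Sum>i\<in>UNIV. \<bar>x $ i - y $ i\<bar>) = 1"
    by (auto simp: nn_pairs_def)
  have "\<bar>x $ i - y $ i\<bar> \<le> 1" for i
    using member_le_sum[of i UNIV "\<lambda>i. \<bar>x $ i - y $ i\<bar>"] e(4) by simp
  then have "y - x \<in> lattice_box 1"
    by (simp add: lattice_box_def abs_minus_commute)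
  moreover have "e = {x, x + (y - x)}" using e by simp
  ultimately show "e \<in> (\<lambda>(x, v). {x, x + v}) ` (lattice_box N \<times> (lattice_box 1 :: (int ^ 'd) set))"
    using e(2) by (intro image_eqI[of _ _ "(x, y - x)"]) simp_all
qed

lemma finite_nn_pairs: "finite (nn_pairs N :: (int ^ 'd::finite) set set)"
  using finite_subset[OF nn_pairs_cover] by (simp add: finite_lattice_box)

lemma card_nn_pairs_le:
  "card (nn_pairs N :: (int ^ 'd::finite) set set) \<le> (2 * N + 1) ^ CARD('d) * 3 ^ CARD('d)"
proof -
  have "card (nn_pairs N :: (int ^ 'd) set set)
      \<le> card ((lattice_box N :: (int ^ 'd) set) \<times> (lattice_box 1 :: (int ^ 'd) set))"
    by (rule surj_card_le[OF _ nn_pairs_cover]) (simp add: finite_lattice_box)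
  then show ?thesis by (simp add: card_cartesian_product card_lattice_box)
qed

lemma dirichlet_form_delta_le:
  fixes x :: "int ^ 'd::finite"
  shows "dirichlet_form N (\<lambda>z. if z = x then 1 else 0) (\<lambda>z. if z = x then 1 else 0) \<le> 3 ^ CARD('d)"
proof -
  let ?f = "\<lambda>z. if z = x then 1 else 0 :: real"
  let ?E = "{e \<in> nn_pairs N. x \<in> e}"
  have sub: "?E \<subseteq> (\<lambda>v. {x, x + v}) ` lattice_box 1"
  proof
    fix e assume e: "e \<in> ?E"
    then have "e \<in> (\<lambda>(x, v). {x, x + v}) ` (lattice_box N \<times> (lattice_box 1 :: (int ^ 'd) set))"
      by (intro subsetD[OF nn_pairs_cover]) simp
    then obtain p v where pv: "e = {p, p + v}" "v \<in> lattice_box 1"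
      by auto
    have "- v \<in> lattice_box 1" using pv(2) by (simp add: lattice_box_def)
    moreover have "e = {x, x + v} \<or> e = {x, x + (- v)}" using pv(1) e by auto
    ultimately show "e \<in> (\<lambda>v. {x, x + v}) ` lattice_box 1" using pv(2) by blast
  qed
  have "card ?E \<le> card (lattice_box 1 :: (int ^ 'd) set)"
    by (rule surj_card_le[OF _ sub]) (simp add: finite_lattice_box)
  then have card: "card ?E \<le> 3 ^ CARD('d)" by (simp add: card_lattice_box)
  have "dirichlet_form N ?f ?f = (\<Sum>e\<in>?E. edge_energy ?f e)"
    unfolding dirichlet_form_self
    by (rule sum.mono_neutral_right) (auto simp: finite_nn_pairs edge_energy_def intro!: sum.neutral split: if_splits)
  also have "\<dots> \<le> (\<Sum>e\<in>?E. 1)"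
    by (rule sum_mono) (auto simp: nn_pairs_def edge_energy_pair)
  also have "\<dots> = real (card ?E)" by simp
  also have "\<dots> \<le> real (3 ^ CARD('d))"
    using card by (simp only: of_nat_le_iff)
  also have "\<dots> = 3 ^ CARD('d)" by simp
  finally show ?thesis .
qed

lemma dirichlet_form_coordinate_le:
  fixes i :: "'d::finite"
  shows "dirichlet_form N (\<lambda>x. a * real_of_int (x $ i)) (\<lambda>x. a * real_of_int (x $ i))
    \<le> a\<^sup>2 * (real (2 * N + 1) ^ CARD('d) * 3 ^ CARD('d))"
proof -
  let ?f = "\<lambda>x::int ^ 'd. a * real_of_int (x $ i)"
  have "dirichlet_form N ?f ?f \<le> (\<Sum>e\<in>(nn_pairs N :: (int ^ 'd) set set). a\<^sup>2)"
    unfolding dirichlet_form_self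
  proof (rule sum_mono)
    fix e :: "(int ^ 'd) set" assume "e \<in> nn_pairs N"
    then obtain x y where e: "e = {x, y}" "(\<Sum>i\<in>UNIV. \<bar>x $ i - y $ i\<bar>) = 1"
      by (auto simp: nn_pairs_def)
    have "\<bar>x $ i - y $ i\<bar> \<le> 1"
      using member_le_sum[of i UNIV "\<lambda>i. \<bar>x $ i - y $ i\<bar>"] e by simp
    then have "\<bar>real_of_int (x $ i - y $ i)\<bar> \<le> 1" by linarith
    then have "(real_of_int (x $ i - y $ i))\<^sup>2 \<le> 1"
      by (simp only: abs_square_le_1)
    then have "a\<^sup>2 * (real_of_int (x $ i - y $ i))\<^sup>2 \<le> a\<^sup>2 * 1"
      by (intro mult_left_mono) auto
    then show "edge_energy ?f e \<le> a\<^sup>2"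
      by (simp add: e edge_energy_pair power_mult_distrib flip: right_diff_distrib)
  qed
  also have "\<dots> = a\<^sup>2 * real (card (nn_pairs N :: (int ^ 'd) set set))" by simp
  also have "\<dots> \<le> a\<^sup>2 * real ((2 * N + 1) ^ CARD('d) * 3 ^ CARD('d))"
    using card_nn_pairs_le[of N, where 'd='d] by (intro mult_left_mono) (simp_all only: of_nat_le_iff zero_le_power2)
  finally show ?thesis by simp
qed

text \<open>The point \<open>x\<close> with its \<open>i\<close>-th coordinate replaced by \<open>w\<close>.\<close>
definition set_coord :: "int ^ 'd::finite \<Rightarrow> 'd \<Rightarrow> int \<Rightarrow> int ^ 'd" where
  "set_coord x i w = (\<chi> l. if l = i then w else x $ l)"

lemma set_coord_nth [simp]: "set_coord x i w $ l = (if l = i then w else x $ l)"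
  by (simp add: set_coord_def)

text \<open>The edges in direction \<open>i\<close> are indexed by their lower endpoint \<open>q\<close>, so \<open>q $ i < N\<close> ensures that
  the upper endpoint lies in the box.\<close>
lemma directional_energy_le:
  fixes f :: "int ^ 'd::finite \<Rightarrow> real"
  shows "(\<Sum>q\<in>{q \<in> lattice_box N. q $ i < int N}. (f (set_coord q i (q $ i + 1)) - f q)\<^sup>2)
    \<le> dirichlet_form N f f"
proof -
  let ?B = "{q \<in> lattice_box N. q $ i < int N} :: (int ^ 'd) set"
  let ?s = "\<lambda>q::int ^ 'd. set_coord q i (q $ i + 1)"
  have inj: "inj_on (\<lambda>q. {q, ?s q}) ?B"
  proof (rule inj_onI)
    fix p q assume "{p, ?s p} = {q, ?s q}"
    then consider "p = q" | "p = ?s q" "q = ?s p" by (auto simp only: doubleton_eq_iff)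
    then show "p = q"
    proof cases
      case 2
      have "p $ i = q $ i + 1" using 2(1) by (metis set_coord_nth)
      moreover have "q $ i = p $ i + 1" using 2(2) by (metis set_coord_nth)
      ultimately show ?thesis by simp
    qed
  qed
  have sub: "(\<lambda>q. {q, ?s q}) ` ?B \<subseteq> nn_pairs N"
  proof
    fix e assume "e \<in> (\<lambda>q. {q, ?s q}) ` ?B"
    then obtain q where q: "e = {q, ?s q}" "q \<in> lattice_box N" "q $ i < int N" by auto
    have *: "\<bar>q $ l\<bar> \<le> int N" for l using q(2) by (simp add: lattice_box_def)
    have "\<bar>q $ i + 1\<bar> \<le> int N" using *[of i] q(3) by arith
    then have "?s q \<in> lattice_box N"
      using * by (auto simp: lattice_box_def)
    moreover have "(\<Sum>l\<in>UNIV. \<bar>q $ l - ?s q $ l\<bar>) = (\<Sum>l\<in>UNIV. if l = i then 1 else 0)"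
      by (rule sum.cong) auto
    then have "(\<Sum>l\<in>UNIV. \<bar>q $ l - ?s q $ l\<bar>) = 1" by simp
    ultimately show "e \<in> nn_pairs N" using q unfolding nn_pairs_def by blast
  qed
  have "(\<Sum>q\<in>?B. (f (?s q) - f q)\<^sup>2) = (\<Sum>q\<in>?B. edge_energy f {q, ?s q})"
    by (simp add: edge_energy_pair power2_commute)
  also have "\<dots> = (\<Sum>e\<in>(\<lambda>q. {q, ?s q}) ` ?B. edge_energy f e)"
    using inj by (simp add: sum.reindex)
  also have "\<dots> \<le> (\<Sum>e\<in>nn_pairs N. edge_energy f e)"
    by (rule sum_mono2[OF finite_nn_pairs sub]) (simp add: edge_energy_nonneg)
  finally show ?thesis by (simp add: dirichlet_form_self)
qed

lemma line_difference_le: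
  fixes F :: "int \<Rightarrow> real"
  assumes a: "a \<in> {lo..hi}" and b: "b \<in> {lo..hi}"
  shows "(F a - F b)\<^sup>2 \<le> real_of_int (hi - lo) * (\<Sum>w\<in>{lo..<hi}. (F (w + 1) - F w)\<^sup>2)"
proof -
  have main: "(F c - F a)\<^sup>2 \<le> real_of_int (hi - lo) * (\<Sum>w\<in>{lo..<hi}. (F (w + 1) - F w)\<^sup>2)"
    if "a \<le> c" "a \<in> {lo..hi}" "c \<in> {lo..hi}" for a c
  proof -
    have tel: "F c - F a = (\<Sum>w\<in>{a..<c}. F (w + 1) - F w)"
      using that(1)
    proof (induction c rule: int_ge_induct)
      case (step c)
      have "{a..<c + 1} = insert c {a..<c}" using step.hyps by auto
      then show ?case using step.IH by simp
    qed simp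
    have "(F c - F a)\<^sup>2 \<le> (\<Sum>w\<in>{a..<c}. (F (w + 1) - F w)\<^sup>2) * (\<Sum>w\<in>{a..<c}. 1\<^sup>2)"
      unfolding tel using Cauchy_Schwarz_ineq_sum[of "\<lambda>w. F (w + 1) - F w" "\<lambda>_. 1" "{a..<c}"]
      by simp
    also have "\<dots> \<le> (\<Sum>w\<in>{lo..<hi}. (F (w + 1) - F w)\<^sup>2) * real_of_int (hi - lo)"
      using that by (intro mult_mono sum_mono2 sum_nonneg) auto
    finally show ?thesis by (simp add: mult.commute)
  qed
  show ?thesis
    using main[of a b] main[of b a] a b by (cases "a \<le> b") (auto simp: power2_commute)
qed

section \<open>The oscillation inequality\<close>

text \<open>Transport of the uniform measure on the box along a coordinate direction.  A point \<open>z\<close> is sent to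
  \<open>p(z)\<close> by applying \<open>m l\<close> to each coordinate \<open>l\<close>, and afterwards the \<open>i\<close>-th coordinate of \<open>p(z)\<close> is
  moved to \<open>m' (z $ i)\<close>.  The square of the resulting difference of \<open>f\<close> is at most the length of the
  window \<open>{lo..hi}\<close> times the energy on the line segment in that window.  Every edge is met by at most
  \<open>(2N+1) K^(d-1)\<close> pairs \<open>(z, w)\<close>, because the coordinate maps are at most \<open>K\<close>-to-one and the old
  \<open>i\<close>-th coordinate of \<open>z\<close> is free.\<close>
lemma coordinate_move_le:
  fixes f :: "int ^ 'd::finite \<Rightarrow> real" and m :: "'d \<Rightarrow> int \<Rightarrow> int"
  assumes range: "\<And>l w. w \<in> {- int N..int N} \<Longrightarrow> m l w \<in> {- int N..int N}"
    and lohi: "- int N \<le> lo" "lo \<le> hi" "hi \<le> int N"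
    and window: "\<And>w. w \<in> {- int N..int N} \<Longrightarrow> m i w \<in> {lo..hi} \<and> m' w \<in> {lo..hi}"
    and mult: "\<And>l v. card {w \<in> {- int N..int N}. m l w = v} \<le> K"
  shows "(\<Sum>z\<in>lattice_box N. (f (\<chi> l. m l (z $ l)) - f (set_coord (\<chi> l. m l (z $ l)) i (m' (z $ i))))\<^sup>2)
    \<le> real_of_int (hi - lo) * real ((2 * N + 1) * K ^ (CARD('d) - 1)) * dirichlet_form N f f"
proof -
  let ?S = "lattice_box N :: (int ^ 'd) set"
  let ?B = "{q \<in> lattice_box N. q $ i < int N} :: (int ^ 'd) set"
  define p where "p z = (\<chi> l. m l (z $ l))" for z :: "int ^ 'd"
  define G where "G q = (f (set_coord q i (q $ i + 1)) - f q)\<^sup>2" for q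
  define \<Psi> where "\<Psi> = (\<lambda>(z, w). set_coord (p z) i w)"
  let ?A = "?S \<times> {lo..<hi}"
  let ?M = "(2 * N + 1) * K ^ (CARD('d) - 1)"
  have finA: "finite ?A" by (simp add: finite_lattice_box)
  have Gnn: "G q \<ge> 0" for q by (simp add: G_def)
  have sub: "\<Psi> ` ?A \<subseteq> ?B"
    using range lohi by (force simp: \<Psi>_def lattice_box_conv p_def)
  have fiber: "card {a \<in> ?A. \<Psi> a = q} \<le> ?M" for q
  proof -
    define A where "A l = (if l = i then {- int N..int N} else {w \<in> {- int N..int N}. m l w = q $ l})" for l
    have finA: "finite (A l)" for l by (rule finite_subset[of _ "{- int N..int N}"]) (auto simp: A_def split: if_splits)
    have "card {a \<in> ?A. \<Psi> a = q} \<le> card {z :: int ^ 'd. \<forall>l. z $ l \<in> A l}"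
    proof (rule card_inj_on_le[of fst])
      show "inj_on fst {a \<in> ?A. \<Psi> a = q}"
      proof (rule inj_onI)
        fix a b assume ab: "a \<in> {a \<in> ?A. \<Psi> a = q}" "b \<in> {a \<in> ?A. \<Psi> a = q}" "fst a = fst b"
        have "snd a = \<Psi> a $ i" "snd b = \<Psi> b $ i" by (auto simp: \<Psi>_def split_beta)
        then have "snd a = snd b" using ab by simp
        then show "a = b" using ab by (simp add: prod_eq_iff)
      qed
      show "fst ` {a \<in> ?A. \<Psi> a = q} \<subseteq> {z. \<forall>l. z $ l \<in> A l}"
      proof safe
        fix z w l assume "z \<in> ?S" "q = \<Psi> (z, w)"
        then show "fst (z, w) $ l \<in> A l" by (auto simp: A_def \<Psi>_def p_def lattice_box_conv)
      qed
      show "finite {z :: int ^ 'd. \<forall>l. z $ l \<in> A l}" by (rule card_vec_box) (rule finA)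
    qed
    also have "\<dots> = (\<Prod>l\<in>UNIV. card (A l))" by (rule card_vec_box) (rule finA)
    also have "\<dots> = card (A i) * (\<Prod>l\<in>UNIV - {i}. card (A l))" by (simp add: prod.remove)
    also have "\<dots> \<le> (2 * N + 1) * (\<Prod>l\<in>UNIV - {i}. K)"
    proof (rule mult_mono)
      show "card (A i) \<le> 2 * N + 1" by (simp add: A_def)
      show "(\<Prod>l\<in>UNIV - {i}. card (A l)) \<le> (\<Prod>l\<in>UNIV - {i}. K)"
        using mult by (intro prod_mono) (simp add: A_def)
    qed simp_all
    finally show ?thesis by (simp add: card_Diff_singleton)
  qed
  have single: "(f (p z) - f (set_coord (p z) i (m' (z $ i))))\<^sup>2
      \<le> real_of_int (hi - lo) * (\<Sum>w\<in>{lo..<hi}. G (\<Psi> (z, w)))" if "z \<in> ?S" for z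
  proof -
    let ?F = "\<lambda>w. f (set_coord (p z) i w)"
    have zi: "z $ i \<in> {- int N..int N}" using that by (simp add: lattice_box_conv)
    have "set_coord (p z) i (m i (z $ i)) = p z" by (simp add: vec_eq_iff p_def)
    moreover have "set_coord (set_coord (p z) i w) i (w + 1) = set_coord (p z) i (w + 1)" for w
      by (simp add: vec_eq_iff)
    ultimately show ?thesis
      using line_difference_le[of "m i (z $ i)" lo hi "m' (z $ i)" ?F] window[OF zi]
      by (simp add: G_def \<Psi>_def)
  qed
  have "(\<Sum>z\<in>?S. (f (p z) - f (set_coord (p z) i (m' (z $ i))))\<^sup>2)
      \<le> (\<Sum>z\<in>?S. real_of_int (hi - lo) * (\<Sum>w\<in>{lo..<hi}. G (\<Psi> (z, w))))"
    by (rule sum_mono) (rule single)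
  also have "\<dots> = real_of_int (hi - lo) * (\<Sum>a\<in>?A. G (\<Psi> a))"
    by (simp add: sum.cartesian_product sum_distrib_left split_beta)
  also have "(\<Sum>a\<in>?A. G (\<Psi> a)) = (\<Sum>q\<in>\<Psi> ` ?A. real (card {a \<in> ?A. \<Psi> a = q}) * G q)"
    using sum_fun_comp[OF finA, of "\<Psi> ` ?A" \<Psi> G] finA by simp
  also have "\<dots> \<le> (\<Sum>q\<in>\<Psi> ` ?A. real ?M * G q)"
    by (rule sum_mono, rule mult_right_mono, subst of_nat_le_iff, rule fiber, rule Gnn)
  also have "\<dots> \<le> (\<Sum>q\<in>?B. real ?M * G q)"
    by (rule sum_mono2[OF _ sub])
      (auto intro: finite_subset[OF _ finite_lattice_box] mult_nonneg_nonneg Gnn simp del: of_nat_mult of_nat_power)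
  also have "\<dots> = real ?M * (\<Sum>q\<in>?B. G q)" by (simp only: sum_distrib_left)
  also have "\<dots> \<le> real ?M * dirichlet_form N f f"
    using directional_energy_le[where N=N and i=i and f=f] unfolding G_def by (intro mult_left_mono) simp_all
  finally have "(\<Sum>z\<in>?S. (f (p z) - f (set_coord (p z) i (m' (z $ i))))\<^sup>2)
      \<le> real_of_int (hi - lo) * (real ?M * dirichlet_form N f f)"
    using lohi by (simp add: mult_left_mono)
  then show ?thesis unfolding p_def by (simp only: mult.assoc)
qed

text \<open>Contraction of the line towards \<open>c\<close> by the factor \<open>2^j\<close>, rounded towards \<open>c\<close>.  The rounding makes
  every point of a bounded set arrive exactly at \<open>c\<close> after finitely many scales, and keeps any interval
  that contains \<open>c\<close> invariant.\<close>
definition contract :: "nat \<Rightarrow> int \<Rightarrow> int \<Rightarrow> int" where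
  "contract j c w = c + sgn (w - c) * (\<bar>w - c\<bar> div 2 ^ j)"

lemma contract_0 [simp]: "contract 0 c w = w"
  by (simp add: contract_def sgn_mult_abs)

lemma contract_dist: "\<bar>contract j c w - c\<bar> \<le> \<bar>w - c\<bar> div 2 ^ j"
  by (auto simp: contract_def abs_mult sgn_if pos_imp_zdiv_nonneg_iff)

lemma contract_dist_mono:
  assumes "i \<le> j" "\<bar>w - c\<bar> \<le> b" shows "\<bar>contract j c w - c\<bar> \<le> b div 2 ^ i"
proof -
  have "\<bar>w - c\<bar> div 2 ^ j \<le> b div 2 ^ j" using assms by (simp add: zdiv_mono1)
  also have "\<dots> \<le> b div 2 ^ i" using assms by (intro zdiv_mono2) (auto intro: power_increasing)
  finally show ?thesis using contract_dist[of j c w] by linarith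
qed

lemma contract_final:
  assumes "\<bar>w - c\<bar> < 2 ^ J" shows "contract J c w = c"
  using assms by (simp add: contract_def)

lemma contract_in_box:
  assumes "c \<in> {- n..n}" "w \<in> {- n..n}" shows "contract j c w \<in> {- n..n}"
proof -
  have "\<bar>w - c\<bar> div 2 ^ j \<le> \<bar>w - c\<bar> div 1" by (rule zdiv_mono2) auto
  then have q: "0 \<le> \<bar>w - c\<bar> div 2 ^ j" "\<bar>w - c\<bar> div 2 ^ j \<le> \<bar>w - c\<bar>"
    by (auto simp: pos_imp_zdiv_nonneg_iff)
  show ?thesis
  proof (cases w c rule: linorder_cases)
    case less
    then show ?thesis using assms q by (simp add: contract_def)
  next
    case equal
    then show ?thesis using assms by (simp add: contract_def)
  next
    case greater
    then show ?thesis using assms q by (simp add: contract_def)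
  qed
qed

lemma card_contract_fiber_le: "card {w \<in> X. contract j c w = v} \<le> 2 * 2 ^ j"
proof -
  let ?q = "\<bar>v - c\<bar>"
  have eq: "?q = \<bar>w - c\<bar> div 2 ^ j" if "contract j c w = v" for w
    using that by (cases "w = c") (auto simp: contract_def abs_mult sgn_if pos_imp_zdiv_nonneg_iff)
  have "{w \<in> X. contract j c w = v}
      \<subseteq> {c + ?q * 2 ^ j..<c + ?q * 2 ^ j + 2 ^ j} \<union> {c - ?q * 2 ^ j - 2 ^ j<..c - ?q * 2 ^ j}"
  proof
    fix w assume "w \<in> {w \<in> X. contract j c w = v}"
    then have "?q = \<bar>w - c\<bar> div 2 ^ j" using eq by blast
    then have "?q * 2 ^ j \<le> \<bar>w - c\<bar>" "\<bar>w - c\<bar> < ?q * 2 ^ j + 2 ^ j"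
      using minus_mod_eq_div_mult[of "\<bar>w - c\<bar>" "2 ^ j", symmetric]
        pos_mod_bound[of "2 ^ j" "\<bar>w - c\<bar>"] pos_mod_sign[of "2 ^ j" "\<bar>w - c\<bar>"] by simp_all
    then show "w \<in> {c + ?q * 2 ^ j..<c + ?q * 2 ^ j + 2 ^ j} \<union> {c - ?q * 2 ^ j - 2 ^ j<..c - ?q * 2 ^ j}"
      by (cases "w \<ge> c") auto
  qed
  then have "card {w \<in> X. contract j c w = v}
      \<le> card ({c + ?q * 2 ^ j..<c + ?q * 2 ^ j + 2 ^ j} \<union> {c - ?q * 2 ^ j - 2 ^ j<..c - ?q * 2 ^ j})"
    by (intro card_mono) auto
  also have "\<dots> \<le> card {c + ?q * 2 ^ j..<c + ?q * 2 ^ j + 2 ^ j} + card {c - ?q * 2 ^ j - 2 ^ j<..c - ?q * 2 ^ j}"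
    by (rule card_Un_le)
  also have "\<dots> = 2 * 2 ^ j" by (simp add: nat_power_eq)
  finally show ?thesis .
qed

lemma sum_abs_le_sqrt:
  fixes g :: "'a \<Rightarrow> real"
  assumes "(\<Sum>z\<in>S. (g z)\<^sup>2) \<le> B"
  shows "(\<Sum>z\<in>S. \<bar>g z\<bar>) \<le> sqrt (real (card S) * B)"
proof (rule real_le_rsqrt)
  have "(\<Sum>z\<in>S. \<bar>g z\<bar>)\<^sup>2 \<le> (\<Sum>z\<in>S. \<bar>g z\<bar>\<^sup>2) * (\<Sum>z\<in>S. 1\<^sup>2)"
    using Cauchy_Schwarz_ineq_sum[of "\<lambda>z. \<bar>g z\<bar>" "\<lambda>_. 1" S] by simp
  also have "\<dots> = real (card S) * (\<Sum>z\<in>S. (g z)\<^sup>2)" by simp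
  also have "\<dots> \<le> real (card S) * B" using assms by (intro mult_left_mono) auto
  finally show "(\<Sum>z\<in>S. \<bar>g z\<bar>)\<^sup>2 \<le> real (card S) * B" .
qed

lemma sqrt_square_mult: "a \<ge> 0 \<Longrightarrow> sqrt (a\<^sup>2 * (k * h)) = a * (sqrt k * sqrt h)"
  by (simp add: real_sqrt_mult)

text \<open>The coordinatewise contraction of the lattice towards \<open>x\<close>.\<close>
definition contract_vec :: "nat \<Rightarrow> int ^ 'd::finite \<Rightarrow> int ^ 'd \<Rightarrow> int ^ 'd" where
  "contract_vec j x z = (\<chi> l. contract j (x $ l) (z $ l))"

text \<open>The contribution of the \<open>j\<close>-th dyadic scale to the oscillation inequality, up to a dimensional factor:
  of order \<open>(2^j / N)^((d-2)/2)\<close>, hence constant in \<open>j\<close> for \<open>d = 2\<close> and geometrically growing for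
  \<open>d \<ge> 3\<close>.\<close>
definition scale_bound :: "nat \<Rightarrow> nat \<Rightarrow> nat \<Rightarrow> real" where
  "scale_bound d N j = sqrt (2 * 4 ^ (d - 1) * (2 ^ j / real (2 * N + 1)) ^ (d - 2))"

text \<open>One dyadic step, averaged over all starting points \<open>z\<close>.  The coordinates are contracted one at a time;
  at scale \<open>j\<close> the window has length of order \<open>N / 2^j\<close> and the coordinate maps are at most
  \<open>4 * 2^j\<close>-to-one.\<close>
lemma contraction_step_le:
  fixes f :: "int ^ 'd::finite \<Rightarrow> real"
  assumes x: "x \<in> lattice_box N" and d: "CARD('d) \<ge> 2"
  shows "(\<Sum>z\<in>lattice_box N. \<bar>f (contract_vec j x z) - f (contract_vec (Suc j) x z)\<bar>)
    \<le> real CARD('d) * (real (2 * N + 1) ^ CARD('d) * (scale_bound CARD('d) N j * sqrt (dirichlet_form N f f)))"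
proof -
  let ?S = "lattice_box N :: (int ^ 'd) set" and ?d = "CARD('d)"
  \<comment> \<open>The coordinates in \<open>T\<close> are already contracted to scale \<open>Suc j\<close>, the others are still at scale \<open>j\<close>.\<close>
  define m where "m T l = contract (if l \<in> T then Suc j else j) (x $ l)" for T :: "'d set" and l
  let ?p = "\<lambda>T z. (\<chi> l. m T l (z $ l)) :: int ^ 'd"
  define r where "r = (2 * int N) div 2 ^ j"
  let ?B = "real (2 * N + 1) ^ ?d * (scale_bound ?d N j * sqrt (dirichlet_form N f f))"
  have xl: "x $ l \<in> {- int N..int N}" for l using x by (simp add: lattice_box_conv)
  have r0: "r \<ge> 0" by (simp add: r_def pos_imp_zdiv_nonneg_iff)
  have move: "(\<Sum>z\<in>?S. \<bar>f (?p T z) - f (?p (insert i T) z)\<bar>) \<le> ?B" if iT: "i \<notin> T" for i T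
  proof -
    let ?lo = "max (- int N) (x $ i - r)" and ?hi = "min (int N) (x $ i + r)"
    have eq: "?p (insert i T) z = set_coord (?p T z) i (contract (Suc j) (x $ i) (z $ i))" for z
      by (auto simp: vec_eq_iff m_def)
    have win: "contract j' (x $ i) w \<in> {?lo..?hi}" if "w \<in> {- int N..int N}" "j \<le> j'" for w j'
    proof -
      have "\<bar>w - x $ i\<bar> \<le> 2 * int N" using that(1) xl[of i] by auto
      then have "\<bar>contract j' (x $ i) w - x $ i\<bar> \<le> r"
        unfolding r_def using that(2) by (rule contract_dist_mono[rotated])
      then show ?thesis using contract_in_box[OF xl that(1), of j' i] by auto
    qed
    have "(\<Sum>z\<in>?S. (f (?p T z) - f (?p (insert i T) z))\<^sup>2)
      \<le> real_of_int (?hi - ?lo) * real ((2 * N + 1) * (4 * 2 ^ j) ^ (?d - 1)) * dirichlet_form N f f"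
      unfolding eq
    proof (rule coordinate_move_le)
      show "m T l w \<in> {- int N..int N}" if "w \<in> {- int N..int N}" for l w
        unfolding m_def using that xl by (intro contract_in_box)
      show "- int N \<le> ?lo" "?hi \<le> int N" by auto
      show "?lo \<le> ?hi" using xl[of i] r0 by auto
      show "m T i w \<in> {?lo..?hi} \<and> contract (Suc j) (x $ i) w \<in> {?lo..?hi}"
        if "w \<in> {- int N..int N}" for w
        using win[OF that] iT unfolding m_def by simp
      show "card {w \<in> {- int N..int N}. m T l w = v} \<le> 4 * 2 ^ j" for l v
        using card_contract_fiber_le[of "{- int N..int N}" j "x $ l" v]
          card_contract_fiber_le[of "{- int N..int N}" "Suc j" "x $ l" v]
        by (simp add: m_def)
    qed
    also have "\<dots> \<le> (2 * real (2 * N + 1) / 2 ^ j) * real ((2 * N + 1) * (4 * 2 ^ j) ^ (?d - 1)) * dirichlet_form N f f"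
    proof (intro mult_right_mono dirichlet_form_nonneg)
      have "real_of_int (?hi - ?lo) \<le> 2 * real_of_int r" by simp
      also have "real_of_int r \<le> real_of_int (2 * int N) / real_of_int (2 ^ j)"
        unfolding r_def by (rule real_of_int_div4)
      also have "2 * (real_of_int (2 * int N) / real_of_int (2 ^ j)) \<le> 2 * real (2 * N + 1) / 2 ^ j"
        by (simp add: field_simps)
      finally show "real_of_int (?hi - ?lo) \<le> 2 * real (2 * N + 1) / 2 ^ j" by simp
    qed simp
    finally have "(\<Sum>z\<in>?S. \<bar>f (?p T z) - f (?p (insert i T) z)\<bar>)
      \<le> sqrt (real (card ?S) * ((2 * real (2 * N + 1) / 2 ^ j) * real ((2 * N + 1) * (4 * 2 ^ j) ^ (?d - 1)) * dirichlet_form N f f))"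
      by (rule sum_abs_le_sqrt)
    also have "real (card ?S) * ((2 * real (2 * N + 1) / 2 ^ j) * real ((2 * N + 1) * (4 * 2 ^ j) ^ (?d - 1)) * dirichlet_form N f f)
       = (real (2 * N + 1) ^ ?d)\<^sup>2 * ((2 * 4 ^ (?d - 1) * (2 ^ j / real (2 * N + 1)) ^ (?d - 2)) * dirichlet_form N f f)"
    proof -
      obtain e where e: "?d = Suc (Suc e)" using d by (metis add_2_eq_Suc le_Suc_ex)
      show ?thesis
        unfolding card_lattice_box e
        by (simp add: field_simps power_divide power_mult_distrib power2_eq_square)
    qed
    also have "sqrt \<dots> = ?B"
      unfolding scale_bound_def by (rule sqrt_square_mult) simp
    finally show ?thesis .
  qed
  have "(\<Sum>z\<in>?S. \<bar>f (?p {} z) - f (?p T z)\<bar>) \<le> real (card T) * ?B" for T :: "'d set"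
    using finite[of T]
  proof (induction T rule: finite_induct)
    case (insert i T)
    have "(\<Sum>z\<in>?S. \<bar>f (?p {} z) - f (?p (insert i T) z)\<bar>)
      \<le> (\<Sum>z\<in>?S. \<bar>f (?p {} z) - f (?p T z)\<bar> + \<bar>f (?p T z) - f (?p (insert i T) z)\<bar>)"
      by (rule sum_mono) linarith
    also have "\<dots> \<le> real (card T) * ?B + ?B"
      unfolding sum.distrib using insert.IH move[OF insert.hyps(2)] by (rule add_mono)
    also have "\<dots> = real (card (insert i T)) * ?B" using insert.hyps by (simp add: algebra_simps)
    finally show ?case .
  qed simp
  from this[of UNIV] show ?thesis
    by (simp add: m_def contract_vec_def)
qed


text \<open>The only trace of the dimension in the growth rates: logarithmic in the critical dimension \<open>2\<close>,
  constant above.  The maximum with \<open>1\<close> matters only for \<open>N \<le> 2\<close>.\<close>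
definition log_factor :: "nat \<Rightarrow> nat \<Rightarrow> real" where
  "log_factor d N = (if d = 2 then max 1 (ln (real N)) else 1)"

lemma log_factor_ge_1: "log_factor d N \<ge> 1"
  by (simp add: log_factor_def)

lemma sum_sqrt_powers_le: "(\<Sum>j<J. sqrt (2 ^ j)) \<le> 3 * sqrt (2 ^ J)"
proof (induction J)
  case (Suc J)
  have "4 / 3 \<le> sqrt 2" by (rule real_le_rsqrt) (simp add: power2_eq_square)
  then have "4 * sqrt (2 ^ J) \<le> 3 * sqrt 2 * sqrt (2 ^ J)" by (intro mult_right_mono) auto
  moreover have "sqrt (2 ^ Suc J) = sqrt 2 * sqrt (2 ^ J)" by (simp add: real_sqrt_mult)
  ultimately show ?case using Suc by (simp only: sum.lessThan_Suc)
qed simp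

lemma sum_scale_bound_le:
  assumes N: "N \<ge> 1" and d: "d \<ge> 2" and J: "2 ^ J \<le> 4 * N"
    and small: "\<And>j. j < J \<Longrightarrow> 2 ^ j \<le> 2 * N"
  shows "(\<Sum>j<J. scale_bound d N j) \<le> 12 * 2 ^ d * log_factor d N"
proof (cases "d = 2")
  case True
  have "scale_bound d N j \<le> 3" for j
    by (simp add: scale_bound_def True real_le_lsqrt)
  then have "(\<Sum>j<J. scale_bound d N j) \<le> (\<Sum>j<J. 3)" by (intro sum_mono)
  then have 1: "(\<Sum>j<J. scale_bound d N j) \<le> 3 * real J" by simp
  have "real (2 ^ J) \<le> real (4 * N)" using J by (simp only: of_nat_le_iff)
  then have "ln (2 ^ J :: real) \<le> ln (2 ^ 2 * real N)" using N by (subst ln_le_cancel_iff) auto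
  then have "real J * ln 2 \<le> 2 * ln 2 + ln (real N)"
    using N by (simp only: ln_mult ln_realpow) (simp add: ln_mult ln_realpow)
  moreover have "ln (2::real) \<ge> 1 / 2" using ln2_ge_two_thirds by simp
  moreover have "(real J - 2) * (1 / 2) \<le> (real J - 2) * ln 2" if "real J \<ge> 2"
    using calculation(2) that by (intro mult_left_mono) auto
  ultimately have "real J \<le> 4 * log_factor d N"
    unfolding log_factor_def using True
    by (cases "real J \<ge> 2") (auto simp: algebra_simps)
  then have "(\<Sum>j<J. scale_bound d N j) \<le> 12 * 1 * log_factor d N" using 1 by simp
  also have "\<dots> \<le> 12 * 2 ^ d * log_factor d N"
    using log_factor_ge_1[of d N] by (intro mult_right_mono mult_left_mono) auto
  finally show ?thesis .
next
  case False
  have "scale_bound d N j \<le> 2 ^ d * (sqrt (2 ^ j) / sqrt (real (2 * N + 1)))" if "j < J" for j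
  proof -
    let ?b = "2 ^ j / real (2 * N + 1)"
    have "real (2 ^ j) \<le> real (2 * N)" using small[OF that] by (simp only: of_nat_le_iff)
    then have "?b \<le> 1" by simp
    then have b: "?b ^ (d - 2) \<le> ?b ^ 1" using False d by (intro power_decreasing) auto
    obtain e where e: "d = Suc e" using d by (cases d) auto
    have "scale_bound d N j \<le> sqrt ((2 ^ d)\<^sup>2 * ?b)"
      unfolding scale_bound_def
    proof (rule real_sqrt_le_mono)
      have "(2 * 4 ^ (d - 1) :: real) \<le> 4 ^ d" by (simp add: e)
      also have "(4::real) ^ d = (2 ^ d)\<^sup>2" by (simp add: power2_eq_square flip: power_mult_distrib)
      finally have "(2 * 4 ^ (d - 1) :: real) \<le> (2 ^ d)\<^sup>2" .
      then show "2 * 4 ^ (d - 1) * ?b ^ (d - 2) \<le> (2 ^ d)\<^sup>2 * ?b"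
        using b by (intro mult_mono) auto
    qed
    then show ?thesis by (simp add: real_sqrt_mult real_sqrt_divide)
  qed
  then have "(\<Sum>j<J. scale_bound d N j) \<le> (\<Sum>j<J. 2 ^ d * (sqrt (2 ^ j) / sqrt (real (2 * N + 1))))"
    by (intro sum_mono) simp
  also have "\<dots> = 2 ^ d * ((\<Sum>j<J. sqrt (2 ^ j)) / sqrt (real (2 * N + 1)))"
    by (simp only: sum_distrib_left sum_divide_distrib)
  also have "\<dots> \<le> 2 ^ d * (3 * sqrt (2 ^ J) / sqrt (real (2 * N + 1)))"
    by (intro mult_left_mono divide_right_mono sum_sqrt_powers_le) auto
  also have "\<dots> \<le> 2 ^ d * 12"
  proof (rule mult_left_mono)
    have "real (2 ^ J) \<le> real (4 * N)" using J by (simp only: of_nat_le_iff)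
    then have "sqrt (2 ^ J) \<le> sqrt (4 * real (2 * N + 1))" by (intro real_sqrt_le_mono) simp
    also have "\<dots> = 2 * sqrt (real (2 * N + 1))" by (simp only: real_sqrt_mult real_sqrt_four)
    finally have "sqrt (2 ^ J) \<le> 2 * sqrt (real (2 * N + 1))" .
    moreover have "sqrt (real (2 * N + 1)) > 0" by simp
    ultimately have "3 * sqrt (2 ^ J) \<le> 12 * sqrt (real (2 * N + 1))" by linarith
    then show "3 * sqrt (2 ^ J) / sqrt (real (2 * N + 1)) \<le> 12"
      by (subst pos_divide_le_eq) auto
  qed simp
  finally show ?thesis by (simp add: log_factor_def False)
qed

text \<open>The dimensional constant of the oscillation inequality.\<close>
definition osc_const :: "nat \<Rightarrow> real" where
  "osc_const d = (24 * real d * 2 ^ d)\<^sup>2"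

lemma osc_const_pos: "d > 0 \<Longrightarrow> osc_const d > 0"
  by (simp add: osc_const_def)

text \<open>The key analytic estimate, a discrete Sobolev inequality: the oscillation of \<open>f\<close> on the box is
  controlled by its Dirichlet energy.  It is obtained by comparing \<open>f x\<close> with the average of \<open>f\<close> over the
  box along the contractions towards \<open>x\<close>.\<close>
theorem oscillation_le:
  fixes f :: "int ^ 'd::finite \<Rightarrow> real"
  assumes d: "CARD('d) \<ge> 2" and N: "N \<ge> 1" and x: "x \<in> lattice_box N" and y: "y \<in> lattice_box N"
  shows "(f x - f y)\<^sup>2 \<le> osc_const CARD('d) * (log_factor CARD('d) N)\<^sup>2 * dirichlet_form N f f"
proof -
  let ?S = "lattice_box N :: (int ^ 'd) set" and ?d = "CARD('d)"
  let ?L = "log_factor ?d N" and ?h = "sqrt (dirichlet_form N f f)"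
  let ?n = "real (2 * N + 1) ^ ?d"
  define J where "J = (LEAST J. 2 * N < 2 ^ J)"
  have ex: "\<exists>J. 2 * N < 2 ^ J" by (rule exI[of _ "2 * N"]) (rule less_exp)
  have J1: "2 * N < 2 ^ J" unfolding J_def by (rule LeastI_ex[OF ex])
  have small: "2 ^ j \<le> 2 * N" if "j < J" for j
    using not_less_Least[of j "\<lambda>J. 2 * N < 2 ^ J"] that by (simp add: J_def)
  have "J \<noteq> 0" using J1 N by (cases "J = 0") auto
  then have J2: "2 ^ J \<le> 4 * N" using small[of "J - 1"] by (cases J) auto
  let ?B = "real ?d * (?n * (12 * 2 ^ ?d * ?L * ?h))"
  \<comment> \<open>The contractions lead from \<open>z\<close> at scale \<open>0\<close> to \<open>x\<close> at scale \<open>J\<close>, since the box has diameter \<open>2N < 2^J\<close>.\<close>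
  have avg: "(\<Sum>z\<in>?S. \<bar>f z - f x\<bar>) \<le> ?B" if x: "x \<in> ?S" for x
  proof -
    have "contract_vec 0 x z = z" for z by (simp add: contract_vec_def vec_eq_iff)
    moreover have "contract_vec J x z = x" if z: "z \<in> ?S" for z
    proof -
      have "contract J (x $ l) (z $ l) = x $ l" for l
      proof (rule contract_final)
        have "\<bar>x $ l\<bar> \<le> int N" "\<bar>z $ l\<bar> \<le> int N" using x z by (auto simp: lattice_box_def)
        then have "\<bar>z $ l - x $ l\<bar> \<le> int (2 * N)" by simp
        also have "int (2 * N) < int (2 ^ J)" using J1 by (simp only: of_nat_less_iff)
        finally show "\<bar>z $ l - x $ l\<bar> < 2 ^ J" by simp
      qed
      then show ?thesis by (simp add: contract_vec_def vec_eq_iff)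
    qed
    ultimately have "(\<Sum>z\<in>?S. \<bar>f z - f x\<bar>) = (\<Sum>z\<in>?S. \<bar>f (contract_vec 0 x z) - f (contract_vec J x z)\<bar>)"
      by simp
    also have "\<dots> \<le> (\<Sum>z\<in>?S. \<Sum>j<J. \<bar>f (contract_vec j x z) - f (contract_vec (Suc j) x z)\<bar>)"
    proof (rule sum_mono)
      fix z
      have "f (contract_vec 0 x z) - f (contract_vec J x z)
          = (\<Sum>j<J. f (contract_vec j x z) - f (contract_vec (Suc j) x z))"
        by (rule sum_lessThan_telescope'[symmetric])
      then show "\<bar>f (contract_vec 0 x z) - f (contract_vec J x z)\<bar>
          \<le> (\<Sum>j<J. \<bar>f (contract_vec j x z) - f (contract_vec (Suc j) x z)\<bar>)"
        by (simp only: sum_abs)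
    qed
    also have "\<dots> = (\<Sum>j<J. \<Sum>z\<in>?S. \<bar>f (contract_vec j x z) - f (contract_vec (Suc j) x z)\<bar>)"
      by (rule sum.swap)
    also have "\<dots> \<le> (\<Sum>j<J. real ?d * (?n * (scale_bound ?d N j * ?h)))"
      by (intro sum_mono contraction_step_le x d)
    also have "\<dots> = real ?d * (?n * ((\<Sum>j<J. scale_bound ?d N j) * ?h))"
      by (simp only: sum_distrib_left sum_distrib_right)
    also have "\<dots> \<le> ?B"
      using sum_scale_bound_le[OF N d J2 small] dirichlet_form_nonneg[of N f]
      by (intro mult_left_mono mult_right_mono) auto
    finally show ?thesis .
  qed
  have "?n * \<bar>f x - f y\<bar> = (\<Sum>z\<in>?S. \<bar>f x - f y\<bar>)" by (simp add: card_lattice_box)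
  also have "\<dots> \<le> (\<Sum>z\<in>?S. \<bar>f z - f x\<bar> + \<bar>f z - f y\<bar>)" by (rule sum_mono) linarith
  also have "\<dots> \<le> ?B + ?B" unfolding sum.distrib using avg[OF x] avg[OF y] by (rule add_mono)
  also have "\<dots> = ?n * (24 * real ?d * 2 ^ ?d * ?L * ?h)" by simp
  finally have "\<bar>f x - f y\<bar> \<le> 24 * real ?d * 2 ^ ?d * ?L * ?h"
    by (rule mult_left_le_imp_le) simp
  then have "\<bar>f x - f y\<bar>\<^sup>2 \<le> (24 * real ?d * 2 ^ ?d * ?L * ?h)\<^sup>2" by (rule power_mono) simp
  then show ?thesis
    using dirichlet_form_nonneg[of N f] by (simp add: osc_const_def power_mult_distrib)
qed

section \<open>Spectral representation of the Green function\<close>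

lemma dirichlet_form_laplacian:
  "dirichlet_form N f g = - box_inner N f (neumann_laplacian N g)"
  using theI'[OF neumann_laplacian_ex1[of N g]] unfolding neumann_laplacian_def by blast

lemma dirichlet_form_commute: "dirichlet_form N f g = dirichlet_form N g f"
  by (simp add: dirichlet_form_def mult.commute)

lemma box_inner_sum_left:
  assumes "\<And>x. x \<in> lattice_box N \<Longrightarrow> f x = (\<Sum>k\<in>A. c k * \<psi> k x)"
  shows "box_inner N f g = (\<Sum>k\<in>A. c k * box_inner N (\<psi> k) g)"
proof -
  have "box_inner N f g = (\<Sum>x\<in>lattice_box N. \<Sum>k\<in>A. c k * (\<psi> k x * g x))"
    unfolding box_inner_def by (intro sum.cong refl) (simp add: assms sum_distrib_right mult.assoc)
  also have "\<dots> = (\<Sum>k\<in>A. \<Sum>x\<in>lattice_box N. c k * (\<psi> k x * g x))" by (rule sum.swap)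
  finally show ?thesis by (simp add: box_inner_def sum_distrib_left)
qed

lemma dirichlet_form_sum_left:
  assumes "\<And>x. x \<in> lattice_box N \<Longrightarrow> f x = (\<Sum>k\<in>A. c k * \<psi> k x)"
  shows "dirichlet_form N f g = (\<Sum>k\<in>A. c k * dirichlet_form N (\<psi> k) g)"
  by (simp add: dirichlet_form_laplacian box_inner_sum_left[OF assms] sum_negf)

text \<open>An orthonormal eigenbasis of the Neumann Laplacian.  Below, \<open>S\<close> is the box and \<open>K\<close> the index set
  without the constant mode.\<close>
locale neumann_basis =
  fixes N :: nat and I :: "'k::zero set" and \<phi> :: "'k \<Rightarrow> int ^ 'd::finite \<Rightarrow> real" and lam :: "'k \<Rightarrow> real"
  assumes dim: "CARD('d) \<ge> 2" and N: "N \<ge> 1" and basis: "neumann_eigenbasis N I \<phi> lam"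
begin

abbreviation "S \<equiv> lattice_box N :: (int ^ 'd) set"
abbreviation "K \<equiv> I - {0}"

lemma finite_I: "finite I" and zero_in_I: "0 \<in> I" and lam_0: "lam 0 = 0"
  using basis by (auto simp: neumann_eigenbasis_def)

lemma orthonormal: "k \<in> I \<Longrightarrow> l \<in> I \<Longrightarrow> box_inner N (\<phi> k) (\<phi> l) = (if k = l then 1 else 0)"
  using basis by (auto simp: neumann_eigenbasis_def)

lemma phi_0_const: "x \<in> S \<Longrightarrow> y \<in> S \<Longrightarrow> \<phi> 0 x = \<phi> 0 y"
  using basis by (force simp: neumann_eigenbasis_def)

lemma dirichlet_form_phi:
  assumes "k \<in> I" shows "dirichlet_form N f (\<phi> k) = lam k * box_inner N f (\<phi> k)"
proof -
  have "- neumann_laplacian N (\<phi> k) x = lam k * \<phi> k x" if "x \<in> S" for x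
    using basis assms that by (auto simp: neumann_eigenbasis_def)
  then have "f x * neumann_laplacian N (\<phi> k) x = - (lam k * (f x * \<phi> k x))" if "x \<in> S" for x
    using that by (metis add.inverse_inverse mult.left_commute mult_minus_right)
  then show ?thesis
    by (simp add: dirichlet_form_laplacian box_inner_def sum_negf sum_distrib_left)
qed

lemma box_inner_phi_sum:
  assumes "\<And>x. x \<in> S \<Longrightarrow> f x = (\<Sum>k\<in>I. c k * \<phi> k x)" and "l \<in> I"
  shows "box_inner N f (\<phi> l) = c l"
proof -
  have "box_inner N f (\<phi> l) = (\<Sum>k\<in>I. c k * box_inner N (\<phi> k) (\<phi> l))"
    by (rule box_inner_sum_left) (rule assms(1))
  also have "\<dots> = (\<Sum>k\<in>I. if k = l then c k else 0)"
    using assms(2) by (intro sum.cong refl) (simp add: orthonormal)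
  finally show ?thesis using assms(2) finite_I by simp
qed

lemma dirichlet_form_sum:
  assumes "\<And>x. x \<in> S \<Longrightarrow> f x = (\<Sum>k\<in>I. c k * \<phi> k x)"
  shows "dirichlet_form N f f = (\<Sum>k\<in>K. lam k * (c k)\<^sup>2)"
proof -
  have "dirichlet_form N f f = (\<Sum>k\<in>I. c k * dirichlet_form N (\<phi> k) f)"
    by (rule dirichlet_form_sum_left) (rule assms)
  also have "\<dots> = (\<Sum>k\<in>I. lam k * (c k)\<^sup>2)"
    by (intro sum.cong refl)
      (simp add: dirichlet_form_commute[of N _ f] dirichlet_form_phi box_inner_phi_sum[OF assms] power2_eq_square)
  also have "\<dots> = (\<Sum>k\<in>K. lam k * (c k)\<^sup>2)"
    using finite_I zero_in_I by (simp add: sum.remove lam_0)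
  finally show ?thesis .
qed

lemma expansion:
  obtains c where "\<And>x. x \<in> S \<Longrightarrow> f x = (\<Sum>k\<in>I. c k * \<phi> k x)"
  using basis unfolding neumann_eigenbasis_def by metis

lemma expansion_diff:
  assumes "\<And>x. x \<in> S \<Longrightarrow> f x = (\<Sum>k\<in>I. c k * \<phi> k x)" "x \<in> S" "y \<in> S"
  shows "f x - f y = (\<Sum>k\<in>K. c k * (\<phi> k x - \<phi> k y))"
proof -
  have "f x - f y = (\<Sum>k\<in>I. c k * (\<phi> k x - \<phi> k y))"
    using assms by (simp add: sum_subtractf right_diff_distrib)
  also have "\<dots> = (\<Sum>k\<in>K. c k * (\<phi> k x - \<phi> k y))"
    using finite_I zero_in_I phi_0_const[OF assms(2,3)] by (simp add: sum.remove)
  finally show ?thesis .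
qed

text \<open>An eigenfunction of eigenvalue \<open>0\<close> is constant by the oscillation inequality, hence proportional to
  \<open>\<phi> 0\<close>, and orthogonality excludes this for nonzero indices.\<close>
lemma lam_pos:
  assumes k: "k \<in> K" shows "lam k > 0"
proof -
  have kI: "k \<in> I" "k \<noteq> 0" using k by auto
  have H: "dirichlet_form N (\<phi> k) (\<phi> k) = lam k"
    using kI by (simp add: dirichlet_form_phi orthonormal)
  have "lam k \<noteq> 0"
  proof
    assume 0: "lam k = 0"
    have "\<phi> k x = \<phi> k 0" if "x \<in> S" for x
      using oscillation_le[OF dim N that zero_in_lattice_box, of "\<phi> k"] H 0 by simp
    then have "box_inner N (\<phi> k) g = \<phi> k 0 * (\<Sum>x\<in>S. g x)" for g
      by (simp add: box_inner_def sum_distrib_left)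
    moreover have "box_inner N (\<phi> 0) g = \<phi> 0 0 * (\<Sum>x\<in>S. g x)" for g
      using phi_0_const[OF _ zero_in_lattice_box] by (simp add: box_inner_def sum_distrib_left)
    ultimately have "box_inner N (\<phi> k) (\<phi> k) * box_inner N (\<phi> 0) (\<phi> 0)
        = box_inner N (\<phi> k) (\<phi> 0) * box_inner N (\<phi> 0) (\<phi> k)"
      by simp
    then show False using kI zero_in_I by (simp add: orthonormal)
  qed
  then show ?thesis using H dirichlet_form_nonneg[of N "\<phi> k"] by simp
qed

text \<open>The effective resistance between \<open>x\<close> and \<open>y\<close>.  The increment of each field component between \<open>x\<close> and
  \<open>y\<close> has variance \<open>green x y / (2 \<beta>)\<close>.\<close>
definition green :: "int ^ 'd \<Rightarrow> int ^ 'd \<Rightarrow> real" where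
  "green x y = (\<Sum>k\<in>K. (\<phi> k x - \<phi> k y)\<^sup>2 / lam k)"

lemma green_nonneg: "green x y \<ge> 0"
  unfolding green_def using lam_pos by (intro sum_nonneg divide_nonneg_pos) auto

text \<open>By duality: the function \<open>f = \<Sum>k\<in>K. (\<phi> k x - \<phi> k y) / lam k * \<phi> k\<close> has both increment and energy equal to
  \<open>green x y\<close>.\<close>
lemma green_upper:
  assumes x: "x \<in> S" and y: "y \<in> S"
  shows "green x y \<le> osc_const CARD('d) * (log_factor CARD('d) N)\<^sup>2"
proof (cases "green x y = 0")
  case False
  define c where "c k = (if k = 0 then 0 else (\<phi> k x - \<phi> k y) / lam k)" for k
  define f where "f z = (\<Sum>k\<in>I. c k * \<phi> k z)" for z
  have "f x - f y = (\<Sum>k\<in>K. c k * (\<phi> k x - \<phi> k y))"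
    by (rule expansion_diff) (simp_all add: f_def x y)
  then have diff: "f x - f y = green x y"
    by (simp add: green_def c_def power2_eq_square)
  have "dirichlet_form N f f = (\<Sum>k\<in>K. lam k * (c k)\<^sup>2)"
    by (rule dirichlet_form_sum) (simp add: f_def)
  also have "\<dots> = green x y"
    unfolding green_def
  proof (rule sum.cong[OF refl])
    fix k assume "k \<in> K"
    then have "lam k > 0" "c k = (\<phi> k x - \<phi> k y) / lam k" using lam_pos by (auto simp: c_def)
    then show "lam k * (c k)\<^sup>2 = (\<phi> k x - \<phi> k y)\<^sup>2 / lam k"
      by (simp add: power2_eq_square)
  qed
  finally have "(green x y)\<^sup>2 \<le> osc_const CARD('d) * (log_factor CARD('d) N)\<^sup>2 * green x y"
    using oscillation_le[OF dim N x y, of f] diff by simp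
  then show ?thesis
    using False green_nonneg[of x y] by (simp add: power2_eq_square)
qed (simp add: osc_const_def)

text \<open>The dual bound, with the indicator of \<open>x\<close> as a test function.\<close>
lemma green_lower:
  assumes x: "x \<in> S" and y: "y \<in> S" and xy: "x \<noteq> y"
  shows "green x y \<ge> 1 / 3 ^ CARD('d)"
proof -
  let ?f = "\<lambda>z. if z = x then 1 else 0 :: real"
  obtain c where c: "\<And>z. z \<in> S \<Longrightarrow> ?f z = (\<Sum>k\<in>I. c k * \<phi> k z)"
    using expansion[of ?f] by blast
  have "1 = ?f x - ?f y" using xy by simp
  also have "\<dots> = (\<Sum>k\<in>K. c k * (\<phi> k x - \<phi> k y))"
    by (rule expansion_diff[OF c x y])
  also have "\<dots> = (\<Sum>k\<in>K. (sqrt (lam k) * c k) * ((\<phi> k x - \<phi> k y) / sqrt (lam k)))"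
    by (intro sum.cong refl) (use lam_pos in force)
  finally have "1 \<le> (\<Sum>k\<in>K. (sqrt (lam k) * c k)\<^sup>2) * (\<Sum>k\<in>K. ((\<phi> k x - \<phi> k y) / sqrt (lam k))\<^sup>2)"
    using Cauchy_Schwarz_ineq_sum[of "\<lambda>k. sqrt (lam k) * c k" "\<lambda>k. (\<phi> k x - \<phi> k y) / sqrt (lam k)" K]
    by simp
  also have "(\<Sum>k\<in>K. (sqrt (lam k) * c k)\<^sup>2) = (\<Sum>k\<in>K. lam k * (c k)\<^sup>2)"
    using lam_pos by (intro sum.cong refl) (simp add: power_mult_distrib less_imp_le)
  also have "\<dots> = dirichlet_form N ?f ?f"
    by (rule dirichlet_form_sum[symmetric, OF c])
  also have "(\<Sum>k\<in>K. ((\<phi> k x - \<phi> k y) / sqrt (lam k))\<^sup>2) = green x y"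
    unfolding green_def using lam_pos by (intro sum.cong refl) (simp add: power_divide less_imp_le)
  also have "dirichlet_form N ?f ?f * green x y \<le> 3 ^ CARD('d) * green x y"
    by (intro mult_right_mono dirichlet_form_delta_le green_nonneg)
  finally show ?thesis by (simp add: divide_le_eq mult.commute)
qed

end

section \<open>Products of centred Gaussians\<close>

lemma normal_density_shift:
  assumes "\<sigma> > 0"
  shows "normal_density 0 \<sigma> (x + c) = exp (- (2 * c * x + c\<^sup>2) / (2 * \<sigma>\<^sup>2)) * normal_density 0 \<sigma> x"
proof -
  have "- (x + c)\<^sup>2 / (2 * \<sigma>\<^sup>2) = - (2 * c * x + c\<^sup>2) / (2 * \<sigma>\<^sup>2) + - x\<^sup>2 / (2 * \<sigma>\<^sup>2)"
    by (simp add: power2_sum add_divide_distrib diff_divide_distrib)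
  then have "exp (- (x + c)\<^sup>2 / (2 * \<sigma>\<^sup>2)) = exp (- (2 * c * x + c\<^sup>2) / (2 * \<sigma>\<^sup>2)) * exp (- x\<^sup>2 / (2 * \<sigma>\<^sup>2))"
    by (simp only: exp_add)
  then show ?thesis by (simp add: normal_density_def)
qed

context prob_space
begin

lemma normal_upper_tail:
  assumes X: "distributed M lborel X (normal_density 0 \<sigma>)" and \<sigma>: "\<sigma> > 0" and r: "r \<ge> 0"
  shows "prob {\<omega> \<in> space M. X \<omega> \<ge> r} \<le> exp (- r\<^sup>2 / (2 * \<sigma>\<^sup>2))"
proof -
  have "emeasure M {\<omega> \<in> space M. X \<omega> \<ge> r} = emeasure M (X -` {r..} \<inter> space M)"
    by (rule arg_cong[where f="emeasure M"]) auto
  also have "\<dots> = (\<integral>\<^sup>+x. ennreal (normal_density 0 \<sigma> x) * indicator {r..} x \<partial>lborel)"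
    by (rule distributed_emeasure[OF X]) simp
  also have "\<dots> = (\<integral>\<^sup>+x. ennreal (normal_density 0 \<sigma> (r + 1 * x)) * indicator {r..} (r + 1 * x) \<partial>lborel)"
    by (subst nn_integral_real_affine[where c=1 and t=r]) auto
  also have "\<dots> \<le> (\<integral>\<^sup>+x. ennreal (exp (- r\<^sup>2 / (2 * \<sigma>\<^sup>2))) * ennreal (normal_density 0 \<sigma> x) \<partial>lborel)"
  proof (rule nn_integral_mono)
    fix x :: real
    have "normal_density 0 \<sigma> (r + x) \<le> exp (- r\<^sup>2 / (2 * \<sigma>\<^sup>2)) * normal_density 0 \<sigma> x" if "x \<ge> 0"
    proof -
      have "- (2 * r * x + r\<^sup>2) / (2 * \<sigma>\<^sup>2) \<le> - r\<^sup>2 / (2 * \<sigma>\<^sup>2)"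
        using that r by (intro divide_right_mono) auto
      then show ?thesis
        using normal_density_shift[OF \<sigma>, of x r] by (simp add: add.commute mult_right_mono)
    qed
    then show "ennreal (normal_density 0 \<sigma> (r + 1 * x)) * indicator {r..} (r + 1 * x)
        \<le> ennreal (exp (- r\<^sup>2 / (2 * \<sigma>\<^sup>2))) * ennreal (normal_density 0 \<sigma> x)"
      by (auto simp: indicator_def ennreal_mult[symmetric] intro!: ennreal_leI)
  qed
  also have "\<dots> = ennreal (exp (- r\<^sup>2 / (2 * \<sigma>\<^sup>2)))"
    using prob_space.emeasure_space_1[OF prob_space_normal_density[OF \<sigma>, of 0]]
    by (simp add: nn_integral_cmult emeasure_density)
  finally show ?thesis by (simp add: emeasure_eq_measure)
qed

lemma normal_abs_tail:
  assumes X: "distributed M lborel X (normal_density 0 \<sigma>)" and \<sigma>: "\<sigma> > 0" and r: "r \<ge> 0"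
  shows "prob {\<omega> \<in> space M. \<bar>X \<omega>\<bar> \<ge> r} \<le> 2 * exp (- r\<^sup>2 / (2 * \<sigma>\<^sup>2))"
proof -
  have [measurable]: "X \<in> borel_measurable M" using X by (simp add: distributed_def)
  have X': "distributed M lborel (\<lambda>\<omega>. - X \<omega>) (normal_density 0 \<sigma>)"
    using normal_density_affine[OF X \<sigma>, of "-1" 0] by simp
  have "{\<omega> \<in> space M. \<bar>X \<omega>\<bar> \<ge> r} = {\<omega> \<in> space M. X \<omega> \<ge> r} \<union> {\<omega> \<in> space M. - X \<omega> \<ge> r}"
    by auto
  then have "prob {\<omega> \<in> space M. \<bar>X \<omega>\<bar> \<ge> r}
      \<le> prob {\<omega> \<in> space M. X \<omega> \<ge> r} + prob {\<omega> \<in> space M. - X \<omega> \<ge> r}"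
    by (simp add: measure_Un_le)
  then show ?thesis
    using normal_upper_tail[OF X \<sigma> r] normal_upper_tail[OF X' \<sigma> r] by linarith
qed

text \<open>The density is at most \<open>1 / (2 \<sigma>)\<close> times the Gaussian factor at the point of the window of length \<open>2\<close>
  that is closest to the origin.\<close>
lemma normal_unit_window:
  assumes X: "distributed M lborel X (normal_density 0 \<sigma>)" and \<sigma>: "\<sigma> > 0" and b: "\<bar>b\<bar> \<ge> 1"
  shows "prob {\<omega> \<in> space M. \<bar>X \<omega> + b\<bar> \<le> 1} \<le> (1 / \<sigma>) * exp (- (\<bar>b\<bar> - 1)\<^sup>2 / (2 * \<sigma>\<^sup>2))"
proof -
  let ?B = "(1 / (2 * \<sigma>)) * exp (- (\<bar>b\<bar> - 1)\<^sup>2 / (2 * \<sigma>\<^sup>2))"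
  have bound: "normal_density 0 \<sigma> x \<le> ?B" if "x \<in> {- 1 - b..1 - b}" for x
  proof -
    have "(\<bar>b\<bar> - 1)\<^sup>2 \<le> x\<^sup>2"
      using that b by (intro abs_le_square_iff[THEN iffD1]) auto
    then have e: "exp (- x\<^sup>2 / (2 * \<sigma>\<^sup>2)) \<le> exp (- (\<bar>b\<bar> - 1)\<^sup>2 / (2 * \<sigma>\<^sup>2))"
      by (simp add: divide_right_mono)
    have "2 * \<sigma> \<le> sqrt (2 * pi * \<sigma>\<^sup>2)"
    proof (rule real_le_rsqrt)
      have "2 * \<sigma>\<^sup>2 \<le> pi * \<sigma>\<^sup>2" using pi_gt3 by (intro mult_right_mono) auto
      then show "(2 * \<sigma>)\<^sup>2 \<le> 2 * pi * \<sigma>\<^sup>2" by (simp add: power_mult_distrib)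
    qed
    then have "1 / sqrt (2 * pi * \<sigma>\<^sup>2) \<le> 1 / (2 * \<sigma>)" using \<sigma> by (intro divide_left_mono) auto
    then show ?thesis using e \<sigma> unfolding normal_density_def by (intro mult_mono) auto
  qed
  have "emeasure M {\<omega> \<in> space M. \<bar>X \<omega> + b\<bar> \<le> 1} = emeasure M (X -` {- 1 - b..1 - b} \<inter> space M)"
    by (rule arg_cong[where f="emeasure M"]) auto
  also have "\<dots> = (\<integral>\<^sup>+x. ennreal (normal_density 0 \<sigma> x) * indicator {- 1 - b..1 - b} x \<partial>lborel)"
    by (rule distributed_emeasure[OF X]) simp
  also have "\<dots> \<le> (\<integral>\<^sup>+x. ennreal ?B * indicator {- 1 - b..1 - b} x \<partial>lborel)"
    using bound by (intro nn_integral_mono) (auto simp: indicator_def intro!: ennreal_leI)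
  also have "\<dots> = ennreal ?B * ennreal 2" by (simp add: nn_integral_cmult)
  also have "\<dots> = ennreal (?B * 2)" using \<sigma> by (intro ennreal_mult[symmetric]) auto
  also have "?B * 2 = (1 / \<sigma>) * exp (- (\<bar>b\<bar> - 1)\<^sup>2 / (2 * \<sigma>\<^sup>2))" by simp
  finally show ?thesis using \<sigma> by (subst (asm) emeasure_eq_measure) (simp add: ennreal_le_iff)
qed

end

text \<open>Independent centred Gaussians with standard deviations \<open>\<sigma> j\<close>, indexed by a finite set \<open>J\<close>.  Positivity
  of \<open>\<sigma>\<close> is required outside \<open>J\<close> as well, so that every factor is a probability measure.\<close>
locale gaussian_product =
  fixes J :: "'j set" and \<sigma> :: "'j \<Rightarrow> real"
  assumes finite_J: "finite J" and \<sigma>_pos: "\<And>j. \<sigma> j > 0"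
begin

abbreviation "G j \<equiv> density lborel (\<lambda>x. ennreal (normal_density 0 (\<sigma> j) x))"
abbreviation "P \<equiv> PiM J G"

lemma prob_space_G: "prob_space (G j)"
  by (rule prob_space_normal_density[OF \<sigma>_pos])

sublocale product_prob_space G J
proof -
  interpret prob_space "G j" for j by (rule prob_space_G)
  show "product_prob_space G" by unfold_locales
qed

lemma indep_coordinates: "P.indep_vars G (\<lambda>j X. X j) J"
proof (cases "J = {}")
  case True
  then show ?thesis unfolding P.indep_vars_def P.indep_sets_def by simp
next
  case False
  have "distr P P (\<lambda>X. \<lambda>j\<in>J. X j) = distr P P (\<lambda>X. X)"
    by (rule distr_cong) (auto simp: space_PiM)
  also have "\<dots> = (\<Pi>\<^sub>M j\<in>J. distr P (G j) (\<lambda>X. X j))"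
    unfolding distr_id by (intro PiM_cong refl) (rule distr_PiM_component[OF prob_space_G, symmetric])
  finally show ?thesis
    by (subst P.indep_vars_iff_distr_eq_PiM'[OF False]) auto
qed

lemma coordinate_distributed:
  assumes "j \<in> J" shows "distributed P lborel (\<lambda>X. X j) (normal_density 0 (\<sigma> j))"
proof -
  have "distr P lborel (\<lambda>X. X j) = distr P (G j) (\<lambda>X. X j)"
    by (rule distr_cong) simp_all
  then show ?thesis
    using assms distr_PiM_component[OF prob_space_G, of j J] by (auto simp: distributed_def)
qed

lemma linear_form_distributed:
  assumes "\<exists>j\<in>J. a j \<noteq> 0"
  shows "distributed P lborel (\<lambda>X. \<Sum>j\<in>J. X j * a j) (normal_density 0 (sqrt (\<Sum>j\<in>J. (a j)\<^sup>2 * (\<sigma> j)\<^sup>2)))"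
proof -
  let ?J = "{j \<in> J. a j \<noteq> 0}"
  have "P.indep_vars (\<lambda>j. borel) (\<lambda>j X. a j * X j) ?J"
    using P.indep_vars_compose2[OF P.indep_vars_subset[OF indep_coordinates], of ?J "\<lambda>j x. a j * x" "\<lambda>j. borel"]
    by simp
  moreover have "distributed P lborel (\<lambda>X. a j * X j) (normal_density 0 (\<bar>a j\<bar> * \<sigma> j))" if "j \<in> ?J" for j
    using P.normal_density_affine[OF coordinate_distributed \<sigma>_pos, of j "a j" 0] that by simp
  ultimately have "distributed P lborel (\<lambda>X. \<Sum>j\<in>?J. a j * X j)
      (normal_density (\<Sum>j\<in>?J. 0) (sqrt (\<Sum>j\<in>?J. (\<bar>a j\<bar> * \<sigma> j)\<^sup>2)))"
    using assms finite_J \<sigma>_pos by (intro P.sum_indep_normal) auto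
  moreover have "(\<Sum>j\<in>?J. a j * X j) = (\<Sum>j\<in>J. X j * a j)" for X
    using finite_J by (intro sum.mono_neutral_cong_left) (auto simp: mult.commute)
  moreover have "(\<Sum>j\<in>?J. (\<bar>a j\<bar> * \<sigma> j)\<^sup>2) = (\<Sum>j\<in>J. (a j)\<^sup>2 * (\<sigma> j)\<^sup>2)"
    using finite_J by (intro sum.mono_neutral_cong_left) (auto simp: power_mult_distrib)
  ultimately show ?thesis by simp
qed

text \<open>The Cameron--Martin density: \<open>shift c\<close> maps the measure with this density with respect to \<open>P\<close> back to
  \<open>P\<close>.\<close>
definition shift_density :: "('j \<Rightarrow> real) \<Rightarrow> ('j \<Rightarrow> real) \<Rightarrow> real" where
  "shift_density c X = exp (- (\<Sum>j\<in>J. (2 * c j * X j + (c j)\<^sup>2) / (2 * (\<sigma> j)\<^sup>2)))"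

definition shift :: "('j \<Rightarrow> real) \<Rightarrow> ('j \<Rightarrow> real) \<Rightarrow> ('j \<Rightarrow> real)" where
  "shift c X = (\<lambda>j\<in>J. X j + c j)"

lemma measurable_shift [measurable]: "shift c \<in> measurable P P"
  unfolding shift_def by measurable

lemma measurable_shift_density [measurable]: "shift_density c \<in> borel_measurable P"
  unfolding shift_density_def by measurable

lemma distr_shift: "distr (density P (shift_density c)) P (shift c) = P"
proof (rule PiM_eqI[OF finite_J])
  fix A assume A: "\<And>j. j \<in> J \<Longrightarrow> A j \<in> sets (G j)"
  then have Ab[measurable]: "j \<in> J \<Longrightarrow> A j \<in> sets borel" for j by simp
  let ?r = "\<lambda>j x. exp (- (2 * c j * x + (c j)\<^sup>2) / (2 * (\<sigma> j)\<^sup>2))"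
  have AP: "Pi\<^sub>E J A \<in> sets P" using A finite_J by (intro sets_PiM_I_finite) auto
  have one: "(\<integral>\<^sup>+x. ennreal (?r j x) * indicator (A j) (x + c j) \<partial>G j) = emeasure (G j) (A j)" if j: "j \<in> J" for j
  proof -
    have [measurable]: "A j \<in> sets borel" by (rule Ab[OF j])
    have "(\<integral>\<^sup>+x. ennreal (?r j x) * indicator (A j) (x + c j) \<partial>G j)
        = (\<integral>\<^sup>+x. ennreal (normal_density 0 (\<sigma> j) x) * (ennreal (?r j x) * indicator (A j) (x + c j)) \<partial>lborel)"
      by (intro nn_integral_density) measurable
    also have "\<dots> = (\<integral>\<^sup>+x. ennreal (normal_density 0 (\<sigma> j) (c j + 1 * x)) * indicator (A j) (c j + 1 * x) \<partial>lborel)"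
      by (intro nn_integral_cong)
        (simp add: normal_density_shift[OF \<sigma>_pos] add.commute[of "c j"] ennreal_mult mult_ac)
    also have "\<dots> = (\<integral>\<^sup>+x. ennreal (normal_density 0 (\<sigma> j) x) * indicator (A j) x \<partial>lborel)"
      using Ab[OF j] by (subst (2) nn_integral_real_affine[where c=1 and t="c j"]) auto
    also have "\<dots> = emeasure (G j) (A j)" using Ab[OF j] by (simp add: emeasure_density)
    finally show ?thesis .
  qed
  have "emeasure (distr (density P (shift_density c)) P (shift c)) (Pi\<^sub>E J A)
      = emeasure (density P (shift_density c)) (shift c -` Pi\<^sub>E J A \<inter> space P)"
    using AP by (subst emeasure_distr) auto
  also have "\<dots> = (\<integral>\<^sup>+X. ennreal (shift_density c X) * indicator (shift c -` Pi\<^sub>E J A \<inter> space P) X \<partial>P)"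
    using measurable_sets[OF measurable_shift AP] by (intro emeasure_density) auto
  also have "\<dots> = (\<integral>\<^sup>+X. (\<Prod>j\<in>J. ennreal (?r j (X j)) * indicator (A j) (X j + c j)) \<partial>P)"
  proof (rule nn_integral_cong)
    fix X assume X: "X \<in> space P"
    have "shift_density c X = (\<Prod>j\<in>J. ?r j (X j))"
      using finite_J by (simp add: shift_density_def exp_sum sum_negf[symmetric] minus_divide_left)
    moreover have "indicator (shift c -` Pi\<^sub>E J A \<inter> space P) X = (\<Prod>j\<in>J. indicator (A j) (X j + c j) :: ennreal)"
      using X finite_J by (auto simp: indicator_def shift_def PiE_iff prod_zero_iff)
    ultimately show "ennreal (shift_density c X) * indicator (shift c -` Pi\<^sub>E J A \<inter> space P) X
        = (\<Prod>j\<in>J. ennreal (?r j (X j)) * indicator (A j) (X j + c j))"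
      by (simp add: prod.distrib prod_ennreal)
  qed
  also have "\<dots> = (\<Prod>j\<in>J. \<integral>\<^sup>+x. ennreal (?r j x) * indicator (A j) (x + c j) \<partial>G j)"
    using Ab by (intro product_nn_integral_prod finite_J) measurable
  also have "\<dots> = (\<Prod>j\<in>J. emeasure (G j) (A j))"
    using one by (rule prod.cong[OF refl])
  finally show "emeasure (distr (density P (shift_density c)) P (shift c)) (Pi\<^sub>E J A) = (\<Prod>j\<in>J. emeasure (G j) (A j))" .
qed simp

text \<open>The Gibbs variational bound for a translated Gaussian measure.  The expectation of \<open>exp (-g)\<close> is rewritten
  by the shift, and convexity of the exponential is applied; the linear part of the exponent has mean
  zero, so that only the quadratic cost of the shift remains.\<close>
lemma exp_integral_lower_bound:
  assumes g[measurable]: "g \<in> borel_measurable P" and g0: "\<And>X. g X \<ge> 0" and gB: "\<And>X. g X \<le> B"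
  shows "(\<integral>X. exp (- g X) \<partial>P) \<ge> exp (- (\<integral>X. g (shift c X) \<partial>P) - (\<Sum>j\<in>J. (c j)\<^sup>2 / (2 * (\<sigma> j)\<^sup>2)))"
proof -
  let ?q = "\<Sum>j\<in>J. (c j)\<^sup>2 / (2 * (\<sigma> j)\<^sup>2)"
  define lin where "lin X = (\<Sum>j\<in>J. X j * (c j / (\<sigma> j)\<^sup>2))" for X :: "'j \<Rightarrow> real"
  have dens: "shift_density c X = exp (- (lin X + ?q))" for X
    using \<sigma>_pos by (simp add: shift_density_def lin_def add_divide_distrib sum.distrib mult_ac less_imp_neq[OF \<sigma>_pos, symmetric])
  have coord: "integrable P (\<lambda>X. X j)" "(\<integral>X. X j \<partial>P) = 0" if "j \<in> J" for j
  proof -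
    show "integrable P (\<lambda>X. X j)"
      by (rule distributed_integrable_var[OF coordinate_distributed[OF that]])
        (use integrable_normal_moment_nz_1[OF \<sigma>_pos] in auto)
    show "(\<integral>X. X j \<partial>P) = 0"
      by (rule P.normal_distributed_expectation[OF \<sigma>_pos coordinate_distributed[OF that]])
  qed
  have linI: "integrable P lin" unfolding lin_def by (intro Bochner_Integration.integrable_sum integrable_mult_left coord)
  have lin0: "(\<integral>X. lin X \<partial>P) = 0" unfolding lin_def using coord by (simp add: Bochner_Integration.integral_sum)
  have gI: "integrable P (\<lambda>X. g (shift c X))"
    by (rule P.integrable_const_bound[of _ B]) (auto simp: g0 gB)
  define Y where "Y X = g (shift c X) + lin X + ?q" for X
  have YI: "integrable P Y" unfolding Y_def using gI linI by simp
  have EY: "(\<integral>X. Y X \<partial>P) = (\<integral>X. g (shift c X) \<partial>P) + ?q"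
    unfolding Y_def using gI linI lin0 by (simp add: P.prob_space)
  let ?m = "\<integral>X. Y X \<partial>P"
  have eq: "(\<integral>X. exp (- g X) \<partial>P) = (\<integral>X. exp (- Y X) \<partial>P)"
  proof -
    have "(\<integral>X. exp (- g X) \<partial>P) = (\<integral>X. exp (- g X) \<partial>distr (density P (shift_density c)) P (shift c))"
      by (simp only: distr_shift)
    also have "\<dots> = (\<integral>X. exp (- g (shift c X)) \<partial>density P (shift_density c))"
      by (rule integral_distr) measurable
    also have "\<dots> = (\<integral>X. shift_density c X * exp (- g (shift c X)) \<partial>P)"
      by (rule integral_real_density) (auto simp: shift_density_def)
    also have "\<dots> = (\<integral>X. exp (- Y X) \<partial>P)"
      by (simp add: dens Y_def exp_add[symmetric] algebra_simps)
    finally show ?thesis .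
  qed
  have eYI: "integrable P (\<lambda>X. exp (- Y X))"
  proof -
    have "integrable P (\<lambda>X. exp (- g X))"
      by (rule P.integrable_const_bound[of _ 1]) (auto simp: g0)
    then have "integrable (distr (density P (shift_density c)) P (shift c)) (\<lambda>X. exp (- g X))"
      by (simp only: distr_shift)
    then have "integrable (density P (shift_density c)) (\<lambda>X. exp (- g (shift c X)))"
      by (subst (asm) integrable_distr_eq) measurable
    then have "integrable P (\<lambda>X. shift_density c X * exp (- g (shift c X)))"
      by (subst (asm) integrable_real_density) (auto simp: shift_density_def)
    then show ?thesis by (simp add: dens Y_def exp_add[symmetric] algebra_simps)
  qed
  \<comment> \<open>Jensen's inequality in the form of the tangent \<open>exp (-Y) \<ge> exp (-m) (1 + m - Y)\<close> at the mean \<open>m\<close> of \<open>Y\<close>.\<close>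
  have "exp (- ?m) = (\<integral>X. exp (- ?m) * (1 + ?m - Y X) \<partial>P)"
    using YI by (simp add: P.prob_space)
  also have "\<dots> \<le> (\<integral>X. exp (- Y X) \<partial>P)"
  proof (rule integral_mono[OF _ eYI])
    show "integrable P (\<lambda>X. exp (- ?m) * (1 + ?m - Y X))" using YI by simp
    fix X
    have "exp (- ?m) * (1 + (?m - Y X)) \<le> exp (- ?m) * exp (?m - Y X)"
      by (intro mult_left_mono exp_ge_add_one_self) simp
    also have "\<dots> = exp (- Y X)" by (simp add: exp_add[symmetric])
    finally show "exp (- ?m) * (1 + ?m - Y X) \<le> exp (- Y X)" by (simp add: algebra_simps)
  qed
  finally show ?thesis unfolding eq[symmetric] EY by simp
qed

end

section \<open>Local times, self-overlap and the effective radius\<close>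

text \<open>The unit cube centred at \<open>a\<close>.  Since \<open>z \<in> cell a\<close> iff \<open>a \<in> cell z\<close>, the local time at \<open>z\<close> counts the
  cubes around the values of \<open>u\<close> that contain \<open>z\<close>.\<close>
definition cell :: "real ^ 'd::finite \<Rightarrow> (real ^ 'd) set" where
  "cell a = cbox (a - (\<chi> i. 1 / 2)) (a + (\<chi> i. 1 / 2))"

lemma mem_cell: "z \<in> cell a \<longleftrightarrow> (\<forall>i. \<bar>z $ i - a $ i\<bar> \<le> 1 / 2)"
proof -
  have "a $ i - 1 / 2 \<le> z $ i \<and> z $ i \<le> a $ i + 1 / 2 \<longleftrightarrow> \<bar>z $ i - a $ i\<bar> \<le> 1 / 2" for i
    by arith
  then show ?thesis by (simp add: cell_def mem_box_cart)
qed

lemma mem_cell_commute: "z \<in> cell a \<longleftrightarrow> a \<in> cell z"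
  by (simp add: mem_cell abs_minus_commute)

lemma cell_borel [measurable]: "cell a \<in> sets borel"
  by (simp add: cell_def)

lemma measure_cell: "measure lborel (cell a) = 1" and emeasure_cell: "emeasure lborel (cell a) < \<infinity>"
proof -
  have "a \<in> cell a" by (simp add: mem_cell)
  then have "cell a \<noteq> {}" by blast
  then show "measure lborel (cell a) = 1"
    unfolding cell_def by (simp add: content_cbox_cart)
  show "emeasure lborel (cell a) < \<infinity>"
    unfolding cell_def by (rule emeasure_lborel_cbox_finite)
qed

text \<open>The integrated squared local time, which is the energy of the self-avoidance interaction.\<close>
definition self_overlap :: "nat \<Rightarrow> (int ^ 'd::finite \<Rightarrow> real ^ 'd) \<Rightarrow> real" where
  "self_overlap N u = (LINT y|lborel. (real (local_time N y u))\<^sup>2)"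

lemma avoidance_weight_eq: "avoidance_weight \<gamma> N u = exp (- (\<gamma> * self_overlap N u))"
  by (simp add: avoidance_weight_def self_overlap_def)

lemma local_time_eq:
  fixes u :: "int ^ 'd::finite \<Rightarrow> real ^ 'd"
  shows "real (local_time N z u) = (\<Sum>x\<in>lattice_box N. indicator (cell (u x)) z)"
proof -
  have "local_time N z u = card {x \<in> lattice_box N. z \<in> cell (u x)}"
    unfolding local_time_def cell_def[symmetric] by (simp add: mem_cell_commute)
  also have "real \<dots> = (\<Sum>x\<in>lattice_box N. if z \<in> cell (u x) then 1 else 0)"
    by (simp add: finite_lattice_box sum.If_cases Int_def)
  finally show ?thesis by (simp add: indicator_def of_bool_def)
qed

lemma integrable_indicator_cells: "integrable lborel (indicator (cell a \<inter> cell b) :: _ \<Rightarrow> real)"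
proof (rule integrable_real_indicator)
  show "cell a \<inter> cell b \<in> sets lborel" by simp
  have "emeasure lborel (cell a \<inter> cell b) \<le> emeasure lborel (cell a)" by (rule emeasure_mono) auto
  then show "emeasure lborel (cell a \<inter> cell b) < \<infinity>" using emeasure_cell le_less_trans by blast
qed

lemma integrable_indicator_cell: "integrable lborel (indicator (cell a) :: _ \<Rightarrow> real)"
  using integrable_indicator_cells[of a a] by simp

lemma local_time_square:
  "(real (local_time N z u))\<^sup>2
    = (\<Sum>x\<in>lattice_box N. \<Sum>y\<in>lattice_box N. indicator (cell (u x) \<inter> cell (u y)) z)"
  by (simp add: local_time_eq power2_eq_square sum_product indicator_inter_arith)

lemma integrable_local_time: "integrable lborel (\<lambda>z. real (local_time N z u))"
  and integrable_local_time_square: "integrable lborel (\<lambda>z. (real (local_time N z u))\<^sup>2)"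
  unfolding local_time_square unfolding local_time_eq
  by (intro Bochner_Integration.integrable_sum integrable_indicator_cells integrable_indicator_cell)+

lemma self_overlap_eq:
  "self_overlap N u = (\<Sum>x\<in>lattice_box N. \<Sum>y\<in>lattice_box N. measure lborel (cell (u x) \<inter> cell (u y)))"
  unfolding self_overlap_def local_time_square
  by (simp add: Bochner_Integration.integral_sum integrable_indicator_cells)

lemma self_overlap_nonneg: "self_overlap N u \<ge> 0"
  unfolding self_overlap_def by (rule integral_nonneg_AE) simp

lemma measure_cell_inter_le:
  "measure lborel (cell a \<inter> cell b) \<le> (if \<forall>i. \<bar>a $ i - b $ i\<bar> \<le> 1 then 1 else 0)"
proof (cases "\<forall>i. \<bar>a $ i - b $ i\<bar> \<le> 1")
  case True
  have "measure lborel (cell a \<inter> cell b) \<le> measure lborel (cell a)"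
    using emeasure_cell[of a] by (intro measure_mono_fmeasurable) (auto simp: fmeasurable_def)
  then show ?thesis using True by (simp add: measure_cell)
next
  case False
  then obtain i where i: "\<bar>a $ i - b $ i\<bar> > 1" by (auto simp: not_le)
  have "False" if "z \<in> cell a" "z \<in> cell b" for z
  proof -
    have "\<bar>z $ i - a $ i\<bar> \<le> 1 / 2" "\<bar>z $ i - b $ i\<bar> \<le> 1 / 2" using that by (auto simp: mem_cell)
    then show False using i by linarith
  qed
  then have "cell a \<inter> cell b = {}" by blast
  then show ?thesis by simp
qed

lemma self_overlap_le:
  "self_overlap N u \<le> (\<Sum>x\<in>lattice_box N. \<Sum>y\<in>lattice_box N. if \<forall>i. \<bar>u x $ i - u y $ i\<bar> \<le> 1 then 1 else 0)"
  unfolding self_overlap_eq by (intro sum_mono measure_cell_inter_le)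

lemma self_overlap_bound: "self_overlap N u \<le> (real (card (lattice_box N :: (int ^ 'd::finite) set)))\<^sup>2"
  for u :: "int ^ 'd \<Rightarrow> real ^ 'd"
proof -
  have "self_overlap N u \<le> (\<Sum>x\<in>(lattice_box N :: (int ^ 'd) set). \<Sum>y\<in>(lattice_box N :: (int ^ 'd) set). 1)"
    by (rule order_trans[OF self_overlap_le]) (intro sum_mono, simp)
  then show ?thesis by (simp add: power2_eq_square)
qed

text \<open>If all values lie within distance \<open>r\<close> of \<open>p\<close>, the local time has integral \<open>n = card (lattice_box N)\<close>
  and is supported in a cube \<open>C\<close> of volume \<open>v = (2r+1)^d\<close>; Cauchy--Schwarz yields \<open>n^2 \<le> v * self_overlap N u\<close>.\<close>
lemma self_overlap_lower:
  fixes u :: "int ^ 'd::finite \<Rightarrow> real ^ 'd"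
  assumes r: "r \<ge> 0" and near: "\<And>x. x \<in> lattice_box N \<Longrightarrow> norm (u x - p) \<le> r"
  shows "(real (card (lattice_box N :: (int ^ 'd) set)))\<^sup>2 \<le> (2 * r + 1) ^ CARD('d) * self_overlap N u"
proof -
  let ?S = "lattice_box N :: (int ^ 'd) set"
  let ?n = "real (card ?S)"
  let ?lt = "\<lambda>z. real (local_time N z u)"
  define C where "C = cbox (p - (\<chi> i. r + 1 / 2)) (p + (\<chi> i. r + 1 / 2))"
  define v where "v = (2 * r + 1) ^ CARD('d)"
  have v: "v > 0" using r by (simp add: v_def)
  have mem_C: "z \<in> C \<longleftrightarrow> (\<forall>i. \<bar>z $ i - p $ i\<bar> \<le> r + 1 / 2)" for z
  proof -
    have "p $ i - (r + 1 / 2) \<le> z $ i \<and> z $ i \<le> p $ i + (r + 1 / 2) \<longleftrightarrow> \<bar>z $ i - p $ i\<bar> \<le> r + 1 / 2" for i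
      by arith
    then show ?thesis by (simp add: C_def mem_box_cart)
  qed
  have C_ne: "C \<noteq> {}" using mem_C[of p] r by auto
  have mC: "measure lborel C = v"
    using C_ne unfolding C_def by (simp add: content_cbox_cart v_def algebra_simps)
  have C_borel[measurable]: "C \<in> sets borel" by (simp add: C_def)
  have C_fin: "emeasure lborel C < \<infinity>" unfolding C_def by (rule emeasure_lborel_cbox_finite)
  have CI: "integrable lborel (indicator C :: _ \<Rightarrow> real)"
    using C_fin by (intro integrable_real_indicator) auto
  have sub: "cell (u x) \<subseteq> C" if "x \<in> ?S" for x
  proof
    fix z assume z: "z \<in> cell (u x)"
    have "\<bar>z $ i - p $ i\<bar> \<le> r + 1 / 2" for i
    proof -
      have "\<bar>u x $ i - p $ i\<bar> \<le> r"
        using component_le_norm_cart[of "u x - p" i] near[OF that] by simp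
      moreover have "\<bar>z $ i - u x $ i\<bar> \<le> 1 / 2" using z by (simp add: mem_cell)
      ultimately show ?thesis by linarith
    qed
    then show "z \<in> C" unfolding mem_C by blast
  qed
  have lt_C: "?lt z * indicator C z = ?lt z" for z
  proof (cases "z \<in> C")
    case False
    then have "z \<notin> cell (u x)" if "x \<in> ?S" for x using sub[OF that] by blast
    then show ?thesis by (simp add: local_time_eq)
  qed simp
  have lt_int: "(LINT z|lborel. ?lt z) = ?n"
    unfolding local_time_eq
    by (simp add: Bochner_Integration.integral_sum integrable_indicator_cell measure_cell)
  have comb: "(LINT z|lborel. f z - a * g z + b * h z) = (LINT z|lborel. f z) - a * (LINT z|lborel. g z) + b * (LINT z|lborel. h z)"
    if "integrable lborel f" "integrable lborel g" "integrable lborel h"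
    for f g h :: "real ^ 'd \<Rightarrow> real" and a b
    using that by simp
  \<comment> \<open>Cauchy--Schwarz in elementary form: the local time minus its mean value \<open>t\<close> on \<open>C\<close> has nonnegative square.\<close>
  define t where "t = ?n / v"
  have "0 \<le> (LINT z|lborel. (?lt z - t * indicator C z)\<^sup>2)"
    by (rule integral_nonneg_AE) simp
  also have "\<dots> = (LINT z|lborel. (?lt z)\<^sup>2 - 2 * t * ?lt z + t\<^sup>2 * indicator C z)"
  proof (rule Bochner_Integration.integral_cong[OF refl])
    fix z
    have "(?lt z - t * indicator C z)\<^sup>2 = (?lt z)\<^sup>2 - 2 * t * (?lt z * indicator C z) + t\<^sup>2 * (indicator C z)\<^sup>2"
      by (simp add: power2_diff power_mult_distrib)
    then show "(?lt z - t * indicator C z)\<^sup>2 = (?lt z)\<^sup>2 - 2 * t * ?lt z + t\<^sup>2 * indicator C z"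
      unfolding lt_C by (simp add: indicator_def)
  qed
  also have "\<dots> = self_overlap N u - 2 * t * ?n + t\<^sup>2 * v"
    unfolding comb[OF integrable_local_time_square integrable_local_time CI]
    by (simp add: self_overlap_def lt_int mC)
  also have "\<dots> = self_overlap N u - ?n\<^sup>2 / v"
    using v by (simp add: t_def power2_eq_square field_simps)
  finally have "?n\<^sup>2 / v \<le> self_overlap N u" by simp
  then show ?thesis using v by (simp add: divide_le_eq v_def mult.commute)
qed

abbreviation field_space :: "nat \<Rightarrow> (int ^ 'd::finite \<Rightarrow> real ^ 'd) measure" where
  "field_space N \<equiv> \<Pi>\<^sub>M x\<in>lattice_box N. borel"

lemma measurable_vec_nth [measurable (raw)]:
  "f \<in> borel_measurable M \<Longrightarrow> (\<lambda>x. (f x :: real ^ 'd::finite) $ i) \<in> borel_measurable M"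
  by (rule measurable_compose[OF _ borel_measurable_continuous_onI[OF continuous_on_component[OF continuous_on_id]]])

lemma measurable_vec_lambda:
  assumes "\<And>i. f i \<in> borel_measurable M"
  shows "(\<lambda>x. (\<chi> i. f i x) :: real ^ 'd::finite) \<in> borel_measurable M"
proof (rule borel_measurable_euclidean_space[THEN iffD2], rule ballI)
  fix b :: "real ^ 'd" assume "b \<in> Basis"
  then obtain i where "b = axis i 1" by (auto simp: Basis_vec_def)
  then show "(\<lambda>x. (\<chi> i. f i x) \<bullet> b) \<in> borel_measurable M"
    using assms by (simp add: inner_axis)
qed

lemma measurable_self_overlap [measurable]:
  "self_overlap N \<in> borel_measurable (field_space N :: (int ^ 'd::finite \<Rightarrow> real ^ 'd) measure)"
proof -
  let ?S = "lattice_box N :: (int ^ 'd) set"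
  have "(\<lambda>(u, z). \<Sum>x\<in>?S. if \<forall>i. \<bar>z $ i - u x $ i\<bar> \<le> 1 / 2 then 1 else 0 :: real)
      \<in> borel_measurable (field_space N \<Otimes>\<^sub>M lborel)"
  proof -
    have [measurable]: "(\<lambda>p. fst p x) \<in> borel_measurable (field_space N \<Otimes>\<^sub>M (lborel :: (real ^ 'd) measure))"
      if "x \<in> ?S" for x :: "int ^ 'd"
      using measurable_comp[OF measurable_fst measurable_component_singleton[OF that]]
      by (simp add: comp_def)
    show ?thesis unfolding split_beta by measurable
  qed
  then have "(\<lambda>(u, z). (real (local_time N z u))\<^sup>2) \<in> borel_measurable (field_space N \<Otimes>\<^sub>M lborel)"
    by (simp add: local_time_eq indicator_def of_bool_def mem_cell split_beta)
  then show ?thesis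
    unfolding self_overlap_def[abs_def] by (rule lborel.borel_measurable_lebesgue_integral)
qed

lemma effective_radius_eq:
  "effective_radius N u = Max ((\<lambda>(w, z). norm (u z - u w)) ` (lattice_box N \<times> lattice_box N))"
  unfolding effective_radius_def by (rule arg_cong[where f=Max]) auto

lemma measurable_effective_radius [measurable]:
  "effective_radius N \<in> borel_measurable (field_space N :: (int ^ 'd::finite \<Rightarrow> real ^ 'd) measure)"
  unfolding effective_radius_eq[abs_def]
proof (rule borel_measurable_Max)
  fix p :: "(int ^ 'd) \<times> (int ^ 'd)"
  assume "p \<in> lattice_box N \<times> lattice_box N"
  then have [measurable]: "(\<lambda>u. u (fst p)) \<in> borel_measurable (field_space N)"
    "(\<lambda>u. u (snd p)) \<in> borel_measurable (field_space N)" by auto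
  show "(\<lambda>u. (case p of (w, z) \<Rightarrow> norm (u z - u w))) \<in> borel_measurable (field_space N)"
    unfolding split_beta by measurable
qed (simp add: finite_lattice_box)

lemma norm_diff_le_effective_radius:
  assumes "x \<in> lattice_box N" "y \<in> lattice_box N"
  shows "norm (u x - u y) \<le> effective_radius N u"
  unfolding effective_radius_eq using assms by (intro Max_ge) (auto simp: finite_lattice_box)

lemma effective_radius_attained:
  obtains x y where "x \<in> lattice_box N" "y \<in> lattice_box N" "effective_radius N u = norm (u x - u y)"
proof -
  have "effective_radius N u \<in> (\<lambda>(w, z). norm (u z - u w)) ` (lattice_box N \<times> lattice_box N)"
    unfolding effective_radius_eq using zero_in_lattice_box[of N]
    by (intro Max_in) (auto simp: finite_lattice_box)
  then show ?thesis using that by auto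
qed

lemma sum_prod_lattice_box:
  fixes q :: "'d::finite \<Rightarrow> int \<Rightarrow> real"
  shows "(\<Sum>y\<in>lattice_box N. \<Prod>i\<in>UNIV. q i (y $ i)) = (\<Prod>i\<in>UNIV. \<Sum>w\<in>{- int N..int N}. q i w)"
proof -
  have bij: "bij_betw vec_lambda (PiE UNIV (\<lambda>i::'d. {- int N..int N})) (lattice_box N)"
    unfolding lattice_box_conv
    by (rule bij_betw_byWitness[of _ vec_nth]) (auto simp: PiE_UNIV_domain)
  show ?thesis
    by (subst sum.reindex_bij_betw[OF bij, symmetric]) (simp add: prod_sum_PiE)
qed

text \<open>A geometric series in \<open>exp (- 1 / \<tau>)\<close> over the integers on either side of \<open>c\<close>.\<close>
lemma sum_exp_le:
  fixes \<tau> :: real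
  assumes "\<tau> > 0" and "finite A"
  shows "(\<Sum>w\<in>A - {c}. exp (- (\<bar>real_of_int (c - w)\<bar> / \<tau>))) \<le> 2 * \<tau>"
proof -
  define e where "e = exp (- (1 / \<tau>))"
  have e: "0 < e" "e < 1" using assms by (auto simp: e_def)
  have ge: "(\<Sum>m\<in>M. e ^ m) \<le> \<tau>" if "finite M" "0 \<notin> M" for M
  proof -
    have "(\<Sum>m\<in>M. e ^ m) = e * (\<Sum>m\<in>(\<lambda>m. m - 1) ` M. e ^ m)"
    proof -
      have inj: "inj_on (\<lambda>m. m - 1) M" using that(2) by (intro inj_onI) (metis Suc_diff_1 gr0I)
      have "(\<Sum>m\<in>(\<lambda>m. m - 1) ` M. e ^ m) = (\<Sum>m\<in>M. e ^ (m - 1))"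
        using inj by (simp add: sum.reindex)
      then have "e * (\<Sum>m\<in>(\<lambda>m. m - 1) ` M. e ^ m) = (\<Sum>m\<in>M. e * e ^ (m - 1))"
        by (simp add: sum_distrib_left)
      also have "\<dots> = (\<Sum>m\<in>M. e ^ m)"
      proof (rule sum.cong[OF refl])
        fix m assume "m \<in> M"
        then have "m \<noteq> 0" using that(2) by (cases "m = 0") auto
        then show "e * e ^ (m - 1) = e ^ m" by (cases m) auto
      qed
      finally show ?thesis by simp
    qed
    also have "(\<Sum>m\<in>(\<lambda>m. m - 1) ` M. e ^ m) \<le> (\<Sum>m. e ^ m)"
      using e that by (intro sum_le_suminf summable_geometric) auto
    also have "\<dots> = 1 / (1 - e)" using e by (intro suminf_geometric) auto
    also have "e * (1 / (1 - e)) \<le> \<tau>"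
    proof -
      have "1 + 1 / \<tau> \<le> exp (1 / \<tau>)" by (rule exp_ge_add_one_self)
      then have "e * (1 + 1 / \<tau>) \<le> e * exp (1 / \<tau>)" using e by (intro mult_left_mono) auto
      also have "\<dots> = 1" by (simp add: e_def exp_add[symmetric])
      finally have "e \<le> \<tau> * (1 - e)" using assms by (simp add: field_simps)
      then show ?thesis using e by (simp add: divide_le_eq)
    qed
    finally show ?thesis using e by simp
  qed
  have pw: "exp (- (\<bar>real_of_int (c - w)\<bar> / \<tau>)) = e ^ nat \<bar>c - w\<bar>" for w
    by (simp add: e_def exp_of_nat_mult[symmetric])
  let ?A1 = "{w \<in> A. w < c}" and ?A2 = "{w \<in> A. w > c}"
  have one: "(\<Sum>w\<in>B. e ^ nat \<bar>c - w\<bar>) \<le> \<tau>" if "B = ?A1 \<or> B = ?A2" for B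
  proof -
    have "inj_on (\<lambda>w. nat \<bar>c - w\<bar>) B" using that by (intro inj_onI) auto
    then have "(\<Sum>w\<in>B. e ^ nat \<bar>c - w\<bar>) = (\<Sum>m\<in>(\<lambda>w. nat \<bar>c - w\<bar>) ` B. e ^ m)"
      by (simp add: sum.reindex)
    also have "\<dots> \<le> \<tau>" using that assms(2) by (intro ge) auto
    finally show ?thesis .
  qed
  have "A - {c} = ?A1 \<union> ?A2" by auto
  then have "(\<Sum>w\<in>A - {c}. e ^ nat \<bar>c - w\<bar>) = (\<Sum>w\<in>?A1. e ^ nat \<bar>c - w\<bar>) + (\<Sum>w\<in>?A2. e ^ nat \<bar>c - w\<bar>)"
    using assms(2) by (simp add: sum.union_disjoint disjoint_iff)
  also have "\<dots> \<le> 2 * \<tau>" using one[of ?A1] one[of ?A2] by simp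
  finally show ?thesis by (simp only: pw)
qed

section \<open>A lower bound for the partition function\<close>

text \<open>Lower and upper bounds, valid for all pairs of distinct points of the box, on the standard deviation of
  the increments of the field components.\<close>
definition sd_min :: "nat \<Rightarrow> real \<Rightarrow> real" where
  "sd_min d \<beta> = sqrt (1 / 3 ^ d / (2 * \<beta>))"

definition sd_max :: "nat \<Rightarrow> nat \<Rightarrow> real \<Rightarrow> real" where
  "sd_max d N \<beta> = sqrt (osc_const d * (log_factor d N)\<^sup>2 / (2 * \<beta>))"

text \<open>The slope of the linear profile \<open>x \<mapsto> slope * x\<close> by which the field is translated.  Taking it of order
  \<open>sqrt (log_factor d N)\<close> balances the cost of the translation against the expected self-overlap: both are
  of order \<open>log_factor d N\<close> per site.\<close>
definition slope :: "nat \<Rightarrow> nat \<Rightarrow> real" where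
  "slope d N = 2 * sqrt (log_factor d N)"

lemma slope_ge_2: "slope d N \<ge> 2"
  using log_factor_ge_1[of d N] by (simp add: slope_def)

lemma slope_pos: "slope d N > 0"
  using slope_ge_2[of d N] by linarith

text \<open>A bound, for lattice points with \<open>i\<close>-th coordinates at distance \<open>z\<close>, on the probability that the
  \<open>i\<close>-th components of the translated field are within distance \<open>1\<close>.\<close>
definition window_bound :: "nat \<Rightarrow> nat \<Rightarrow> real \<Rightarrow> int \<Rightarrow> real" where
  "window_bound d N \<beta> z = (if z = 0 then 1
     else 2 / sd_min d \<beta> * exp (- (\<bar>real_of_int z\<bar> / (sqrt 8 * sd_max d N \<beta> / slope d N))))"

text \<open>The expected self-overlap of the translated field is at most \<open>(1 + overlap_const d)^d * log_factor d N\<close> per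
  site; the constant does not involve \<open>\<beta>\<close>, which cancels in \<open>sd_max / sd_min\<close>.\<close>
definition overlap_const :: "nat \<Rightarrow> real" where
  "overlap_const d = 6 * sqrt (osc_const d * 3 ^ d)"

lemma overlap_const_nonneg: "overlap_const d \<ge> 0"
  by (simp add: overlap_const_def osc_const_def)

text \<open>The constant of the lower bound for the partition function.\<close>
definition cost_const :: "nat \<Rightarrow> real" where
  "cost_const d = (1 + overlap_const d) ^ d + 4 * real d * 3 ^ d"

text \<open>The field at inverse temperature \<open>\<beta>\<close> as a function of its Gaussian coefficients, which are indexed by
  \<open>K \<times> UNIV\<close>.\<close>
locale dgff = neumann_basis N I \<phi> lam
  for N :: nat and I :: "'k::zero set" and \<phi> :: "'k \<Rightarrow> int ^ 'd::finite \<Rightarrow> real" and lam :: "'k \<Rightarrow> real" +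
  fixes \<beta> :: real
  assumes \<beta>: "\<beta> > 0"
begin

text \<open>The standard deviations of the coefficients; the value \<open>1\<close> off the index set is irrelevant.\<close>
definition coeff_sd :: "'k \<times> 'd \<Rightarrow> real" where
  "coeff_sd j = (if fst j \<in> K then sqrt (1 / (2 * \<beta> * lam (fst j))) else 1)"

sublocale gp: gaussian_product "K \<times> (UNIV :: 'd set)" coeff_sd
proof
  show "finite (K \<times> (UNIV :: 'd set))" using finite_I by simp
  show "coeff_sd j > 0" for j using \<beta> lam_pos[of "fst j"] by (simp add: coeff_sd_def)
qed

lemma coeff_law_eq: "dgff_coeff_law \<beta> I lam = gp.P"
  unfolding dgff_coeff_law_def
  by (intro PiM_cong refl) (auto simp: coeff_sd_def)

abbreviation field :: "('k \<times> 'd \<Rightarrow> real) \<Rightarrow> int ^ 'd \<Rightarrow> real ^ 'd" where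
  "field \<equiv> dgff_field N I \<phi>"

lemma field_nth: "x \<in> S \<Longrightarrow> field X x $ i = (\<Sum>k\<in>K. X (k, i) * \<phi> k x)"
  by (simp add: dgff_field_def)

lemma measurable_field [measurable]: "field \<in> measurable gp.P (field_space N)"
  unfolding dgff_field_def[abs_def]
proof (rule measurable_restrict, rule measurable_vec_lambda)
  fix x :: "int ^ 'd" and i :: 'd
  have [measurable]: "(\<lambda>X. X (k, i)) \<in> borel_measurable gp.P" if "k \<in> K" for k
    using measurable_component_singleton[of "(k, i)" "K \<times> UNIV" gp.G] that by simp
  show "(\<lambda>X. \<Sum>k\<in>K. X (k, i) * \<phi> k x) \<in> borel_measurable gp.P" by measurable
qed

lemma law_eq: "dgff_law \<beta> N I \<phi> lam = distr gp.P (field_space N) field"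
  by (simp add: dgff_law_def coeff_law_eq)

lemma law_integral:
  assumes "h \<in> borel_measurable (field_space N)"
  shows "(LINT u|dgff_law \<beta> N I \<phi> lam. h u) = (LINT X|gp.P. (h (field X) :: real))"
  unfolding law_eq by (rule integral_distr) (use assms in measurable)

text \<open>The increment between \<open>y\<close> and \<open>x\<close> of the \<open>i\<close>-th component of the field.\<close>
definition increment :: "int ^ 'd \<Rightarrow> int ^ 'd \<Rightarrow> 'd \<Rightarrow> ('k \<times> 'd \<Rightarrow> real) \<Rightarrow> real" where
  "increment x y i X = (\<Sum>k\<in>K. X (k, i) * (\<phi> k x - \<phi> k y))"

lemma field_diff: "x \<in> S \<Longrightarrow> y \<in> S \<Longrightarrow> field X x $ i - field X y $ i = increment x y i X"
  by (simp add: field_nth increment_def sum_subtractf right_diff_distrib)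

text \<open>The standard deviation of an increment, the same for every component.\<close>
definition sd :: "int ^ 'd \<Rightarrow> int ^ 'd \<Rightarrow> real" where
  "sd x y = sqrt (green x y / (2 * \<beta>))"

lemma green_pos: "x \<in> S \<Longrightarrow> y \<in> S \<Longrightarrow> x \<noteq> y \<Longrightarrow> green x y > 0"
  using green_lower[of x y] by (rule less_le_trans[rotated]) auto

lemma increment_distributed:
  assumes xy: "x \<in> S" "y \<in> S" "x \<noteq> y"
  shows "distributed gp.P lborel (increment x y i) (normal_density 0 (sd x y))"
proof -
  define a where "a j = (if snd j = i then \<phi> (fst j) x - \<phi> (fst j) y else 0)" for j :: "'k \<times> 'd"
  have "\<exists>k\<in>K. \<phi> k x \<noteq> \<phi> k y"
  proof (rule ccontr)
    assume "\<not> ?thesis"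
    then have "green x y = 0" by (simp add: green_def)
    then show False using green_pos[OF xy] by simp
  qed
  then obtain k where k: "k \<in> K" "\<phi> k x \<noteq> \<phi> k y" by blast
  then have ex: "\<exists>j\<in>K \<times> UNIV. a j \<noteq> 0" by (intro bexI[of _ "(k, i)"]) (auto simp: a_def)
  have pick: "(\<Sum>j\<in>K \<times> UNIV. if snd j = i then h (fst j) else 0) = (\<Sum>k\<in>K. h k)" for h :: "'k \<Rightarrow> real"
  proof -
    have "(\<Sum>j\<in>K \<times> UNIV. if snd j = i then h (fst j) else 0) = (\<Sum>k\<in>K. \<Sum>l\<in>UNIV. if l = i then h k else 0)"
      unfolding sum.cartesian_product by (simp add: split_beta)
    then show ?thesis by simp
  qed
  have "(\<Sum>j\<in>K \<times> UNIV. X j * a j) = increment x y i X" for X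
  proof -
    have "(\<Sum>j\<in>K \<times> UNIV. X j * a j)
        = (\<Sum>j\<in>K \<times> UNIV. if snd j = i then X (fst j, i) * (\<phi> (fst j) x - \<phi> (fst j) y) else 0)"
      by (intro sum.cong refl) (auto simp: a_def)
    then show ?thesis using pick[of "\<lambda>k. X (k, i) * (\<phi> k x - \<phi> k y)"] by (simp add: increment_def)
  qed
  moreover have "(\<Sum>j\<in>K \<times> UNIV. (a j)\<^sup>2 * (coeff_sd j)\<^sup>2) = green x y / (2 * \<beta>)"
  proof -
    have "(\<Sum>j\<in>K \<times> UNIV. (a j)\<^sup>2 * (coeff_sd j)\<^sup>2)
        = (\<Sum>j\<in>K \<times> UNIV. if snd j = i then (\<phi> (fst j) x - \<phi> (fst j) y)\<^sup>2 / lam (fst j) / (2 * \<beta>) else 0)"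
    proof (rule sum.cong[OF refl])
      fix j :: "'k \<times> 'd" assume "j \<in> K \<times> UNIV"
      then have "fst j \<in> K" by auto
      then have "(coeff_sd j)\<^sup>2 = 1 / (2 * \<beta> * lam (fst j))"
        using lam_pos[of "fst j"] \<beta> by (simp add: coeff_sd_def)
      then show "(a j)\<^sup>2 * (coeff_sd j)\<^sup>2
          = (if snd j = i then (\<phi> (fst j) x - \<phi> (fst j) y)\<^sup>2 / lam (fst j) / (2 * \<beta>) else 0)"
        by (simp add: a_def)
    qed
    then show ?thesis
      using pick[of "\<lambda>k. (\<phi> k x - \<phi> k y)\<^sup>2 / lam k / (2 * \<beta>)"] by (simp add: green_def sum_divide_distrib)
  qed
  ultimately show ?thesis
    using gp.linear_form_distributed[OF ex] by (simp add: sd_def)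
qed

lemma increment_indep: "gp.P.indep_vars (\<lambda>_. borel) (increment x y) UNIV"
proof -
  have "gp.P.indep_vars (\<lambda>i. PiM (K \<times> {i}) gp.G) (\<lambda>i X. restrict (\<lambda>j. X j) (K \<times> {i})) UNIV"
    by (rule gp.P.indep_vars_restrict[OF gp.indep_coordinates]) (auto simp: disjoint_family_on_def)
  then have "gp.P.indep_vars (\<lambda>_. borel)
      (\<lambda>i X. (\<Sum>k\<in>K. restrict (\<lambda>j. X j) (K \<times> {i}) (k, i) * (\<phi> k x - \<phi> k y))) UNIV"
  proof (rule gp.P.indep_vars_compose2)
    fix i :: 'd
    have [measurable]: "(\<lambda>X. X (k, i)) \<in> borel_measurable (PiM (K \<times> {i}) gp.G)" if "k \<in> K" for k
      using measurable_component_singleton[of "(k, i)" "K \<times> {i}" gp.G] that by simp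
    show "(\<lambda>X. \<Sum>k\<in>K. X (k, i) * (\<phi> k x - \<phi> k y)) \<in> borel_measurable (PiM (K \<times> {i}) gp.G)"
      by measurable
  qed
  then show ?thesis by (simp add: increment_def[abs_def])
qed

lemma measurable_increment [measurable]: "increment x y i \<in> borel_measurable gp.P"
  using increment_indep by (auto simp: gp.P.indep_vars_def)

lemma prob_window_prod:
  "gp.P.prob {X \<in> space gp.P. \<forall>i. \<bar>increment x y i X + b i\<bar> \<le> 1}
    = (\<Prod>i\<in>UNIV. gp.P.prob {X \<in> space gp.P. \<bar>increment x y i X + b i\<bar> \<le> 1})"
proof -
  let ?A = "\<lambda>i. {t. \<bar>t + b i\<bar> \<le> 1}"
  have "closed (?A i)" for i by (intro closed_Collect_le continuous_intros)
  then have A: "?A i \<in> sets borel" for i by (rule borel_closed)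
  have "gp.P.prob (\<Inter>i\<in>UNIV. increment x y i -` ?A i \<inter> space gp.P)
      = (\<Prod>i\<in>UNIV. gp.P.prob (increment x y i -` ?A i \<inter> space gp.P))"
    by (rule gp.P.indep_varsD[OF increment_indep]) (use A in auto)
  moreover have "(\<Inter>i\<in>UNIV. increment x y i -` ?A i \<inter> space gp.P)
      = {X \<in> space gp.P. \<forall>i. \<bar>increment x y i X + b i\<bar> \<le> 1}" by auto
  moreover have "increment x y i -` ?A i \<inter> space gp.P = {X \<in> space gp.P. \<bar>increment x y i X + b i\<bar> \<le> 1}" for i
    by auto
  ultimately show ?thesis by simp
qed

lemma sd_min_pos: "(sd_min CARD('d) \<beta>) > 0" and sd_max_pos: "(sd_max CARD('d) N \<beta>) > 0"
  using \<beta> log_factor_ge_1[of "CARD('d)" N] osc_const_pos[of "CARD('d)"]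
  by (auto simp: sd_min_def sd_max_def)

lemma sd_bounds:
  assumes "x \<in> S" "y \<in> S" "x \<noteq> y" shows "(sd_min CARD('d) \<beta>) \<le> sd x y" "sd x y \<le> (sd_max CARD('d) N \<beta>)"
  unfolding sd_def sd_min_def sd_max_def
  using green_lower[OF assms] green_upper[OF assms(1,2)] \<beta>
  by (intro real_sqrt_le_mono divide_right_mono, simp_all)+

lemma window_bound_nonneg: "window_bound CARD('d) N \<beta> z \<ge> 0"
  using sd_min_pos by (simp add: window_bound_def)

text \<open>For \<open>z \<noteq> 0\<close> the centre \<open>b = slope * z\<close> of the window satisfies \<open>\<bar>b\<bar> \<ge> 2\<close>, so that
  \<open>\<bar>b\<bar> - 1 \<ge> \<bar>b\<bar> / 2\<close>; the Gaussian factor is then relaxed to an exponential, using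
  \<open>exp (- t^2) \<le> 2 exp (- t)\<close>.\<close>
lemma prob_window_le:
  assumes xy: "x \<in> S" "y \<in> S" "x \<noteq> y"
  shows "gp.P.prob {X \<in> space gp.P. \<bar>increment x y i X + (slope CARD('d) N) * real_of_int z\<bar> \<le> 1} \<le> window_bound CARD('d) N \<beta> z"
proof (cases "z = 0")
  case False
  define b where "b = (slope CARD('d) N) * real_of_int z"
  have z1: "\<bar>real_of_int z\<bar> \<ge> 1" using False by linarith
  have b: "\<bar>b\<bar> = (slope CARD('d) N) * \<bar>real_of_int z\<bar>" using slope_pos[of "CARD('d)" N] by (simp add: b_def abs_mult)
  have "(slope CARD('d) N) * \<bar>real_of_int z\<bar> \<ge> 2 * 1" using slope_ge_2 z1 less_imp_le[OF slope_pos] by (intro mult_mono) auto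
  then have b2: "\<bar>b\<bar> \<ge> 2" using b by simp
  note sd = sd_bounds[OF xy] sd_min_pos
  have sd0: "sd x y > 0" using sd by linarith
  let ?t = "\<bar>b\<bar> / (sqrt 8 * (sd_max CARD('d) N \<beta>))"
  have "gp.P.prob {X \<in> space gp.P. \<bar>increment x y i X + b\<bar> \<le> 1}
      \<le> (1 / sd x y) * exp (- (\<bar>b\<bar> - 1)\<^sup>2 / (2 * (sd x y)\<^sup>2))"
    by (rule gp.P.normal_unit_window[OF increment_distributed[OF xy] sd0]) (use b2 in auto)
  also have "\<dots> \<le> (1 / (sd_min CARD('d) \<beta>)) * (2 * exp (- ?t))"
  proof (rule mult_mono)
    show "1 / sd x y \<le> 1 / (sd_min CARD('d) \<beta>)" using sd sd0 by (intro divide_left_mono) auto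
    have "?t\<^sup>2 = (\<bar>b\<bar> / 2)\<^sup>2 / (2 * (sd_max CARD('d) N \<beta>)\<^sup>2)" by (simp add: power_divide power_mult_distrib)
    also have "\<dots> \<le> (\<bar>b\<bar> - 1)\<^sup>2 / (2 * (sd x y)\<^sup>2)"
      using sd sd0 b2 by (intro frac_le power_mono mult_left_mono) auto
    finally have "exp (- (\<bar>b\<bar> - 1)\<^sup>2 / (2 * (sd x y)\<^sup>2)) \<le> exp (- ?t\<^sup>2)" by simp
    also have "\<dots> \<le> exp (ln 2 - ?t)"
    proof -
      have "0 \<le> (?t - 1 / 2)\<^sup>2" by simp
      then have "?t - ?t\<^sup>2 \<le> 1 / 4" by (simp add: power2_diff power2_eq_square algebra_simps)
      moreover have "1 / 4 \<le> ln (2::real)" using ln2_ge_two_thirds by linarith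
      ultimately have "- ?t\<^sup>2 \<le> ln 2 - ?t" by linarith
      then show ?thesis by (simp only: exp_le_cancel_iff)
    qed
    also have "\<dots> = 2 * exp (- ?t)" by (simp add: exp_diff exp_minus divide_inverse)
    finally show "exp (- (\<bar>b\<bar> - 1)\<^sup>2 / (2 * (sd x y)\<^sup>2)) \<le> 2 * exp (- ?t)" .
  qed (use sd in auto)
  also have "\<dots> = window_bound CARD('d) N \<beta> z"
    using False slope_pos[of "CARD('d)" N] by (simp add: window_bound_def b mult.commute)
  finally show ?thesis by (simp add: b_def)
qed (simp add: window_bound_def gp.P.prob_le_1)

lemma prob_joint_window_le:
  assumes "x \<in> S" "y \<in> S"
  shows "gp.P.prob {X \<in> space gp.P. \<forall>i. \<bar>increment x y i X + (slope CARD('d) N) * real_of_int (x $ i - y $ i)\<bar> \<le> 1}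
    \<le> (\<Prod>i\<in>UNIV. window_bound CARD('d) N \<beta> (x $ i - y $ i))"
proof (cases "x = y")
  case True
  then show ?thesis by (simp add: window_bound_def gp.P.prob_le_1)
next
  case False
  show ?thesis
    unfolding prob_window_prod by (intro prod_mono conjI prob_window_le assms False) simp
qed

lemma sum_window_bound_le:
  "(\<Sum>w\<in>{- int N..int N}. window_bound CARD('d) N \<beta> (c - w)) \<le> 1 + (overlap_const CARD('d)) * sqrt (log_factor CARD('d) N)"
proof -
  let ?\<tau> = "sqrt 8 * (sd_max CARD('d) N \<beta>) / (slope CARD('d) N)" and ?W = "{- int N..int N}"
  have \<tau>: "?\<tau> > 0" using sd_max_pos slope_pos[of "CARD('d)" N] by simp
  have "(\<Sum>w\<in>?W. window_bound CARD('d) N \<beta> (c - w)) \<le> (\<Sum>w\<in>insert c ?W. window_bound CARD('d) N \<beta> (c - w))"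
    by (rule sum_mono2) (auto simp: window_bound_nonneg)
  also have "\<dots> = 1 + (\<Sum>w\<in>?W - {c}. window_bound CARD('d) N \<beta> (c - w))"
    by (simp add: sum.insert_remove window_bound_def)
  also have "(\<Sum>w\<in>?W - {c}. window_bound CARD('d) N \<beta> (c - w))
      = 2 / (sd_min CARD('d) \<beta>) * (\<Sum>w\<in>?W - {c}. exp (- (\<bar>real_of_int (c - w)\<bar> / ?\<tau>)))"
    unfolding sum_distrib_left by (intro sum.cong refl) (auto simp: window_bound_def)
  also have "\<dots> \<le> 2 / (sd_min CARD('d) \<beta>) * (2 * ?\<tau>)"
    using sd_min_pos \<tau> by (intro mult_left_mono sum_exp_le) auto
  also have "\<dots> \<le> (overlap_const CARD('d)) * sqrt (log_factor CARD('d) N)"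
  proof -
    have r: "(sd_max CARD('d) N \<beta>) / (sd_min CARD('d) \<beta>) = sqrt (osc_const CARD('d) * 3 ^ CARD('d)) * log_factor CARD('d) N"
    proof -
      have "(sd_max CARD('d) N \<beta>) / (sd_min CARD('d) \<beta>) = sqrt ((osc_const CARD('d) * (log_factor CARD('d) N)\<^sup>2 / (2 * \<beta>)) / (1 / 3 ^ CARD('d) / (2 * \<beta>)))"
        unfolding sd_max_def sd_min_def by (rule real_sqrt_divide[symmetric])
      also have "(osc_const CARD('d) * (log_factor CARD('d) N)\<^sup>2 / (2 * \<beta>)) / (1 / 3 ^ CARD('d) / (2 * \<beta>)) = (osc_const CARD('d) * 3 ^ CARD('d)) * (log_factor CARD('d) N)\<^sup>2"
        using \<beta> by simp
      also have "sqrt \<dots> = sqrt (osc_const CARD('d) * 3 ^ CARD('d)) * log_factor CARD('d) N"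
        using log_factor_ge_1[of "CARD('d)" N] by (simp only: real_sqrt_mult) simp
      finally show ?thesis .
    qed
    have sqL: "log_factor CARD('d) N = sqrt (log_factor CARD('d) N) * sqrt (log_factor CARD('d) N)" "sqrt (log_factor CARD('d) N) > 0" using log_factor_ge_1[of "CARD('d)" N] by auto
    have "2 / (sd_min CARD('d) \<beta>) * (2 * ?\<tau>) = 4 * sqrt 8 * ((sd_max CARD('d) N \<beta>) / (sd_min CARD('d) \<beta>)) / (slope CARD('d) N)" by simp
    also have "\<dots> = 2 * sqrt 8 * sqrt (osc_const CARD('d) * 3 ^ CARD('d)) * (log_factor CARD('d) N / sqrt (log_factor CARD('d) N))"
      unfolding r slope_def by simp
    also have "log_factor CARD('d) N / sqrt (log_factor CARD('d) N) = sqrt (log_factor CARD('d) N)" using sqL by (metis nonzero_mult_div_cancel_left order_less_irrefl)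
    also have "2 * sqrt 8 * sqrt (osc_const CARD('d) * 3 ^ CARD('d)) * sqrt (log_factor CARD('d) N) \<le> (overlap_const CARD('d)) * sqrt (log_factor CARD('d) N)"
    proof -
      have "sqrt 8 \<le> (3::real)" by (rule real_le_lsqrt) auto
      then show ?thesis unfolding overlap_const_def
        using log_factor_ge_1[of "CARD('d)" N] by (intro mult_right_mono) (auto simp: osc_const_def)
    qed
    finally show ?thesis .
  qed
  finally show ?thesis by simp
qed

lemma sum_joint_window_le:
  "(\<Sum>y\<in>S. \<Prod>i\<in>UNIV. window_bound CARD('d) N \<beta> (x $ i - y $ i)) \<le> (1 + (overlap_const CARD('d))) ^ CARD('d) * log_factor CARD('d) N"
proof -
  have "(\<Sum>y\<in>S. \<Prod>i\<in>UNIV. window_bound CARD('d) N \<beta> (x $ i - y $ i))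
      = (\<Prod>i\<in>UNIV. \<Sum>w\<in>{- int N..int N}. window_bound CARD('d) N \<beta> (x $ i - w))"
    by (rule sum_prod_lattice_box[of "\<lambda>i w. window_bound CARD('d) N \<beta> (x $ i - w)"])
  also have "\<dots> \<le> (\<Prod>i\<in>(UNIV::'d set). 1 + (overlap_const CARD('d)) * sqrt (log_factor CARD('d) N))"
    by (intro prod_mono conjI sum_window_bound_le sum_nonneg window_bound_nonneg)
  also have "\<dots> = (1 + (overlap_const CARD('d)) * sqrt (log_factor CARD('d) N)) ^ CARD('d)" by simp
  also have "\<dots> \<le> ((1 + (overlap_const CARD('d))) * sqrt (log_factor CARD('d) N)) ^ CARD('d)"
  proof (rule power_mono)
    have "sqrt (log_factor CARD('d) N) \<ge> 1" using log_factor_ge_1[of "CARD('d)" N] by simp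
    then show "1 + (overlap_const CARD('d)) * sqrt (log_factor CARD('d) N) \<le> (1 + (overlap_const CARD('d))) * sqrt (log_factor CARD('d) N)" by (simp add: algebra_simps)
    show "0 \<le> 1 + (overlap_const CARD('d)) * sqrt (log_factor CARD('d) N)"
      using overlap_const_nonneg log_factor_ge_1[of "CARD('d)" N] by simp
  qed
  also have "\<dots> = (1 + (overlap_const CARD('d))) ^ CARD('d) * sqrt (log_factor CARD('d) N) ^ CARD('d)" by (rule power_mult_distrib)
  \<comment> \<open>The exponent \<open>CARD('d)\<close> equals \<open>2\<close> unless the base is \<open>1\<close>.\<close>
  also have "sqrt (log_factor CARD('d) N) ^ CARD('d) = log_factor CARD('d) N"
    using log_factor_ge_1[of "CARD('d)" N]
    by (cases "CARD('d) = 2") (auto simp: log_factor_def)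
  finally show ?thesis .
qed

text \<open>The coefficients of the linear profile in the eigenbasis.  The constant mode is dropped by the shift, which
  is harmless since only increments of the field matter.\<close>
definition tilt :: "'k \<times> 'd \<Rightarrow> real" where
  "tilt j = box_inner N (\<lambda>x. (slope CARD('d) N) * real_of_int (x $ snd j)) (\<phi> (fst j))"

lemma expansion_coordinate:
  assumes "x \<in> S"
  shows "(slope CARD('d) N) * real_of_int (x $ i) = (\<Sum>k\<in>I. tilt (k, i) * \<phi> k x)"
proof -
  obtain c where c: "\<And>x. x \<in> S \<Longrightarrow> (slope CARD('d) N) * real_of_int (x $ i) = (\<Sum>k\<in>I. c k * \<phi> k x)"
    using expansion[of "\<lambda>x. (slope CARD('d) N) * real_of_int (x $ i)"] by blast
  have "tilt (k, i) = c k" if "k \<in> I" for k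
    unfolding tilt_def using box_inner_phi_sum[of "\<lambda>x. (slope CARD('d) N) * real_of_int (x $ i)" c k, OF c that] by simp
  then show ?thesis using c[OF assms] by simp
qed

lemma field_diff_shift:
  assumes "x \<in> S" "y \<in> S"
  shows "field (gp.shift tilt X) x $ i - field (gp.shift tilt X) y $ i
    = increment x y i X + (slope CARD('d) N) * real_of_int (x $ i - y $ i)"
proof -
  have "(slope CARD('d) N) * real_of_int (x $ i - y $ i) = (\<Sum>k\<in>K. tilt (k, i) * (\<phi> k x - \<phi> k y))"
    using expansion_diff[of "\<lambda>x. (slope CARD('d) N) * real_of_int (x $ i)" "\<lambda>k. tilt (k, i)", OF expansion_coordinate assms]
    by (simp add: right_diff_distrib)
  then show ?thesis
    unfolding field_diff[OF assms]
    by (simp add: increment_def gp.shift_def distrib_right sum.distrib)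
qed

lemma tilt_cost: "(\<Sum>j\<in>K \<times> UNIV. (tilt j)\<^sup>2 / (2 * (coeff_sd j)\<^sup>2))
    \<le> 4 * real CARD('d) * 3 ^ CARD('d) * (real (card S) * log_factor CARD('d) N * \<beta>)"
proof -
  have "(\<Sum>j\<in>K \<times> UNIV. (tilt j)\<^sup>2 / (2 * (coeff_sd j)\<^sup>2)) = (\<Sum>k\<in>K. \<Sum>i\<in>UNIV. (tilt (k, i))\<^sup>2 / (2 * (coeff_sd (k, i))\<^sup>2))"
    by (simp add: sum.cartesian_product split_beta)
  also have "\<dots> = (\<Sum>k\<in>K. \<Sum>i\<in>UNIV. \<beta> * (lam k * (tilt (k, i))\<^sup>2))"
  proof (intro sum.cong refl)
    fix k i assume "k \<in> K"
    then show "(tilt (k, i))\<^sup>2 / (2 * (coeff_sd (k, i))\<^sup>2) = \<beta> * (lam k * (tilt (k, i))\<^sup>2)"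
      using lam_pos[of k] \<beta> by (simp add: coeff_sd_def)
  qed
  also have "\<dots> = (\<Sum>i\<in>UNIV. \<Sum>k\<in>K. \<beta> * (lam k * (tilt (k, i))\<^sup>2))" by (rule sum.swap)
  also have "\<dots> = (\<Sum>i\<in>(UNIV::'d set). \<beta> * dirichlet_form N (\<lambda>x. (slope CARD('d) N) * real_of_int (x $ i)) (\<lambda>x. (slope CARD('d) N) * real_of_int (x $ i)))"
  proof (rule sum.cong[OF refl])
    fix i :: 'd
    have "dirichlet_form N (\<lambda>x. (slope CARD('d) N) * real_of_int (x $ i)) (\<lambda>x. (slope CARD('d) N) * real_of_int (x $ i))
        = (\<Sum>k\<in>K. lam k * (tilt (k, i))\<^sup>2)"
      by (rule dirichlet_form_sum) (rule expansion_coordinate)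
    then show "(\<Sum>k\<in>K. \<beta> * (lam k * (tilt (k, i))\<^sup>2))
        = \<beta> * dirichlet_form N (\<lambda>x. (slope CARD('d) N) * real_of_int (x $ i)) (\<lambda>x. (slope CARD('d) N) * real_of_int (x $ i))"
      by (simp add: sum_distrib_left)
  qed
  also have "\<dots> \<le> (\<Sum>i\<in>(UNIV::'d set). \<beta> * ((slope CARD('d) N)\<^sup>2 * (real (2 * N + 1) ^ CARD('d) * 3 ^ CARD('d))))"
    using \<beta> by (intro sum_mono mult_left_mono dirichlet_form_coordinate_le) auto
  also have "\<dots> = 4 * real CARD('d) * 3 ^ CARD('d) * (real (card S) * log_factor CARD('d) N * \<beta>)"
    using log_factor_ge_1[of "CARD('d)" N] by (simp add: slope_def power_mult_distrib card_lattice_box)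
  finally show ?thesis .
qed

lemma expected_overlap_le:
  "(\<integral>X. self_overlap N (field (gp.shift tilt X)) \<partial>gp.P) \<le> (1 + (overlap_const CARD('d))) ^ CARD('d) * (real (card S) * log_factor CARD('d) N)"
proof -
  let ?E = "\<lambda>x y. {X \<in> space gp.P. \<forall>i. \<bar>increment x y i X + (slope CARD('d) N) * real_of_int (x $ i - y $ i)\<bar> \<le> 1}"
  have E: "?E x y \<in> sets gp.P" for x y by measurable
  have EI: "integrable gp.P (indicator (?E x y) :: _ \<Rightarrow> real)" for x y
    using E[of x y] by (intro integrable_real_indicator) (auto simp: gp.P.emeasure_eq_measure)
  have "(\<integral>X. self_overlap N (field (gp.shift tilt X)) \<partial>gp.P)
      \<le> (\<integral>X. (\<Sum>x\<in>S. \<Sum>y\<in>S. indicator (?E x y) X) \<partial>gp.P)"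
  proof (rule integral_mono)
    show "integrable gp.P (\<lambda>X. self_overlap N (field (gp.shift tilt X)))"
      by (rule gp.P.integrable_const_bound[of _ "(real (card S))\<^sup>2"])
        (auto simp: self_overlap_nonneg self_overlap_bound)
    show "integrable gp.P (\<lambda>X. \<Sum>x\<in>S. \<Sum>y\<in>S. indicator (?E x y) X :: real)"
      by (intro Bochner_Integration.integrable_sum EI)
    fix X assume X: "X \<in> space gp.P"
    show "self_overlap N (field (gp.shift tilt X)) \<le> (\<Sum>x\<in>S. \<Sum>y\<in>S. indicator (?E x y) X)"
    proof (rule order_trans[OF self_overlap_le], intro sum_mono)
      fix x y assume "x \<in> S" "y \<in> S"
      then show "(if \<forall>i. \<bar>field (gp.shift tilt X) x $ i - field (gp.shift tilt X) y $ i\<bar> \<le> 1 then 1 else 0)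
          \<le> (indicator (?E x y) X :: real)"
        using X by (simp add: field_diff_shift indicator_def)
    qed
  qed
  also have "\<dots> = (\<Sum>x\<in>S. \<Sum>y\<in>S. gp.P.prob (?E x y))"
  proof -
    have "(\<integral>X. (\<Sum>x\<in>S. \<Sum>y\<in>S. indicator (?E x y) X :: real) \<partial>gp.P) = (\<Sum>x\<in>S. \<integral>X. (\<Sum>y\<in>S. indicator (?E x y) X :: real) \<partial>gp.P)"
      by (intro Bochner_Integration.integral_sum Bochner_Integration.integrable_sum EI)
    also have "\<dots> = (\<Sum>x\<in>S. \<Sum>y\<in>S. \<integral>X. (indicator (?E x y) X :: real) \<partial>gp.P)"
      by (intro sum.cong refl Bochner_Integration.integral_sum EI)
    also have "\<dots> = (\<Sum>x\<in>S. \<Sum>y\<in>S. gp.P.prob (?E x y))"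
      using E by (intro sum.cong refl) simp
    finally show ?thesis .
  qed
  also have "\<dots> \<le> (\<Sum>x\<in>S. \<Sum>y\<in>S. \<Prod>i\<in>UNIV. window_bound CARD('d) N \<beta> (x $ i - y $ i))"
    by (intro sum_mono prob_joint_window_le)
  also have "\<dots> \<le> (\<Sum>x\<in>S. (1 + (overlap_const CARD('d))) ^ CARD('d) * log_factor CARD('d) N)"
    by (intro sum_mono sum_joint_window_le)
  finally show ?thesis by (simp add: mult_ac)
qed

text \<open>The variational bound with the linear profile: the partition function is not smaller than
  \<open>exp (- C n (\<beta> + \<gamma>))\<close>, up to the logarithmic factor for \<open>d = 2\<close>, with \<open>n\<close> the number of sites.\<close>
theorem partition_fn_lower:
  assumes \<gamma>: "\<gamma> > 0"
  shows "partition_fn \<beta> \<gamma> N I \<phi> lam \<ge> exp (- ((cost_const CARD('d)) * (real (card S) * log_factor CARD('d) N * (\<beta> + \<gamma>))))"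
proof -
  have Z: "partition_fn \<beta> \<gamma> N I \<phi> lam = (\<integral>X. exp (- (\<gamma> * self_overlap N (field X))) \<partial>gp.P)"
    unfolding partition_fn_def avoidance_weight_eq by (rule law_integral) measurable
  have "exp (- (\<integral>X. \<gamma> * self_overlap N (field (gp.shift tilt X)) \<partial>gp.P)
      - (\<Sum>j\<in>K \<times> UNIV. (tilt j)\<^sup>2 / (2 * (coeff_sd j)\<^sup>2))) \<le> partition_fn \<beta> \<gamma> N I \<phi> lam"
    unfolding Z
    by (rule gp.exp_integral_lower_bound[where B="\<gamma> * (real (card S))\<^sup>2"])
      (use \<gamma> in \<open>auto simp: self_overlap_nonneg intro!: mult_left_mono self_overlap_bound\<close>)
  moreover have "(\<integral>X. \<gamma> * self_overlap N (field (gp.shift tilt X)) \<partial>gp.P)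
      \<le> \<gamma> * ((1 + (overlap_const CARD('d))) ^ CARD('d) * (real (card S) * log_factor CARD('d) N))"
    using expected_overlap_le \<gamma> by simp
  moreover have "\<gamma> * ((1 + (overlap_const CARD('d))) ^ CARD('d) * (real (card S) * log_factor CARD('d) N))
      + 4 * real CARD('d) * 3 ^ CARD('d) * (real (card S) * log_factor CARD('d) N * \<beta>)
      \<le> (cost_const CARD('d)) * (real (card S) * log_factor CARD('d) N * (\<beta> + \<gamma>))"
  proof -
    define A where "A = (1 + (overlap_const CARD('d))) ^ CARD('d)"
    define B where "B = 4 * real CARD('d) * 3 ^ CARD('d)"
    define n where "n = real (card S) * log_factor CARD('d) N"
    have "A \<ge> 0" "B \<ge> 0" "n \<ge> 0"
      using overlap_const_nonneg log_factor_ge_1[of "CARD('d)" N] by (auto simp: A_def B_def n_def)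
    then have "0 \<le> A * n * \<beta> + B * n * \<gamma>" using \<beta> \<gamma> by simp
    then have "\<gamma> * (A * n) + B * (n * \<beta>) \<le> (A + B) * (n * (\<beta> + \<gamma>))" by (simp add: algebra_simps)
    then show ?thesis by (simp add: A_def B_def n_def cost_const_def)
  qed
  ultimately show ?thesis using tilt_cost by (smt (verit) exp_le_cancel_iff)
qed

end

section \<open>Bounds on the effective radius\<close>

text \<open>The constants \<open>\<epsilon>\<^sub>0\<close> and \<open>K\<^sub>0\<close> of the final statement.  They are chosen such that in either tail the exponent
  is at least \<open>cost_const d + 1\<close> in units of \<open>n * log_factor d N * (\<beta> + \<gamma>)\<close>, whereas that of the
  partition function is at most \<open>cost_const d\<close> in these units.\<close>
definition lower_const :: "nat \<Rightarrow> real" where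
  "lower_const d = 1 / (2 * (cost_const d + 1))"

definition upper_const :: "nat \<Rightarrow> real" where
  "upper_const d = sqrt ((cost_const d + 1) * 3 ^ d * (real d)\<^sup>2 * osc_const d)"

lemma cost_const_nonneg: "cost_const d \<ge> 0"
  using overlap_const_nonneg[of d] by (simp add: cost_const_def)

lemma lower_const_pos: "lower_const d > 0"
  using cost_const_nonneg[of d] by (simp add: lower_const_def)

lemma upper_const_pos: "d > 0 \<Longrightarrow> upper_const d > 0"
  using cost_const_nonneg[of d] osc_const_pos[of d] by (simp add: upper_const_def)

context dgff
begin

text \<open>A field of small radius has a large self-overlap, hence a small weight.\<close>
lemma weight_le:
  fixes u :: "int ^ 'd \<Rightarrow> real ^ 'd"
  assumes \<gamma>: "\<gamma> > 0" and a: "a \<ge> 0" and R: "effective_radius N u < a"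
  shows "avoidance_weight \<gamma> N u \<le> exp (- (\<gamma> * ((real (card S))\<^sup>2 / (2 * a + 1) ^ CARD('d))))"
proof -
  have "(real (card S))\<^sup>2 \<le> (2 * a + 1) ^ CARD('d) * self_overlap N u"
  proof (rule self_overlap_lower[OF a, where p="u 0"])
    fix x :: "int ^ 'd" assume "x \<in> S"
    from norm_diff_le_effective_radius[OF this zero_in_lattice_box, of u] R
    show "norm (u x - u 0) \<le> a" by linarith
  qed
  then have "(real (card S))\<^sup>2 / (2 * a + 1) ^ CARD('d) \<le> self_overlap N u"
    using a by (simp add: divide_le_eq mult.commute)
  then have "\<gamma> * ((real (card S))\<^sup>2 / (2 * a + 1) ^ CARD('d)) \<le> \<gamma> * self_overlap N u"
    using \<gamma> by (intro mult_left_mono) auto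
  then show ?thesis unfolding avoidance_weight_eq by (simp only: exp_le_cancel_iff neg_le_iff_le)
qed

text \<open>A union bound over pairs of points and components; a vector of norm more than \<open>b\<close> has a component of size
  at least \<open>b / d\<close>.\<close>
lemma radius_tail:
  assumes b: "b \<ge> 0"
  shows "gp.P.prob {X \<in> space gp.P. effective_radius N (field X) > b}
    \<le> 2 * real CARD('d) * (real (card S))\<^sup>2 * exp (- (b / real CARD('d))\<^sup>2 / (2 * (sd_max CARD('d) N \<beta>)\<^sup>2))"
proof -
  let ?r = "b / real CARD('d)"
  let ?e = "2 * exp (- ?r\<^sup>2 / (2 * (sd_max CARD('d) N \<beta>)\<^sup>2))"
  let ?T = "{(x, y, i). x \<in> S \<and> y \<in> S \<and> x \<noteq> y} :: ((int ^ 'd) \<times> (int ^ 'd) \<times> 'd) set"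
  let ?E = "\<lambda>(x, y, i). {X \<in> space gp.P. \<bar>increment x y i X\<bar> \<ge> ?r}"
  have sub: "?T \<subseteq> S \<times> S \<times> UNIV" by auto
  have finT: "finite ?T" by (rule finite_subset[OF sub]) (simp add: finite_lattice_box)
  have E: "?E t \<in> sets gp.P" for t by (cases t) (auto, measurable)
  have "{X \<in> space gp.P. effective_radius N (field X) > b} \<subseteq> (\<Union>t\<in>?T. ?E t)"
  proof
    fix X assume "X \<in> {X \<in> space gp.P. effective_radius N (field X) > b}"
    then have X: "X \<in> space gp.P" "effective_radius N (field X) > b" by auto
    obtain x y where xy: "x \<in> S" "y \<in> S" "effective_radius N (field X) = norm (field X x - field X y)"
      by (rule effective_radius_attained)
    have "x \<noteq> y" using xy X b by auto
    moreover have "\<exists>i. \<bar>increment x y i X\<bar> \<ge> ?r"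
    proof (rule ccontr)
      assume "\<not> ?thesis"
      then have small: "\<bar>increment x y i X\<bar> \<le> ?r" for i by (auto simp: not_le intro: less_imp_le)
      have "norm (field X x - field X y) \<le> (\<Sum>i\<in>UNIV. \<bar>(field X x - field X y) $ i\<bar>)"
        by (rule norm_le_l1_cart)
      also have "\<dots> = (\<Sum>i\<in>UNIV. \<bar>increment x y i X\<bar>)" using field_diff[OF xy(1,2)] by simp
      also have "\<dots> \<le> (\<Sum>i\<in>(UNIV::'d set). ?r)" by (intro sum_mono small)
      also have "\<dots> = b" by simp
      finally show False using X xy by simp
    qed
    ultimately show "X \<in> (\<Union>t\<in>?T. ?E t)" using X(1) xy(1,2) by auto
  qed
  then have "gp.P.prob {X \<in> space gp.P. effective_radius N (field X) > b} \<le> gp.P.prob (\<Union>t\<in>?T. ?E t)"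
    using E finT by (intro gp.P.finite_measure_mono) auto
  also have "\<dots> \<le> (\<Sum>t\<in>?T. gp.P.prob (?E t))"
    using E by (intro gp.P.finite_measure_subadditive_finite finT) auto
  also have "\<dots> \<le> (\<Sum>t\<in>?T. ?e)"
  proof (rule sum_mono)
    fix t assume "t \<in> ?T"
    then obtain x y i where t: "t = (x, y, i)" "x \<in> S" "y \<in> S" "x \<noteq> y" by auto
    note sd = sd_bounds[OF t(2-4)]
    have sd0: "sd x y > 0" using sd sd_min_pos by linarith
    have "gp.P.prob {X \<in> space gp.P. \<bar>increment x y i X\<bar> \<ge> ?r} \<le> 2 * exp (- ?r\<^sup>2 / (2 * (sd x y)\<^sup>2))"
      by (rule gp.P.normal_abs_tail[OF increment_distributed[OF t(2-4)] sd0]) (use b in simp)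
    also have "\<dots> \<le> ?e"
    proof -
      have "?r\<^sup>2 / (2 * (sd_max CARD('d) N \<beta>)\<^sup>2) \<le> ?r\<^sup>2 / (2 * (sd x y)\<^sup>2)"
        using sd sd0 by (intro divide_left_mono mult_left_mono power_mono) auto
      then show ?thesis by simp
    qed
    finally show "gp.P.prob (?E t) \<le> ?e" using t(1) by simp
  qed
  also have "\<dots> = real (card ?T) * ?e" by simp
  also have "\<dots> \<le> real (card S * (card S * CARD('d))) * ?e"
    using card_mono[OF _ sub] by (intro mult_right_mono) (simp_all add: finite_lattice_box card_cartesian_product flip: of_nat_mult)
  finally show ?thesis by (simp add: power2_eq_square mult_ac)
qed

text \<open>Fields of radius below \<open>a\<close> are controlled by their weight, those of radius above \<open>b\<close> by their probability
  under the Gaussian law.\<close>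
lemma wsa_prob_bounds:
  assumes \<gamma>: "\<gamma> > 0"
    and small: "\<And>u :: int ^ 'd \<Rightarrow> real ^ 'd. effective_radius N u < a \<Longrightarrow> avoidance_weight \<gamma> N u \<le> \<delta>" and \<delta>: "\<delta> \<ge> 0"
    and large: "gp.P.prob {X \<in> space gp.P. effective_radius N (field X) > b} \<le> \<eta>"
  shows "1 - (\<delta> + \<eta>) / partition_fn \<beta> \<gamma> N I \<phi> lam
      \<le> wsa_prob \<beta> \<gamma> N I \<phi> lam {u. a \<le> effective_radius N u \<and> effective_radius N u \<le> b}"
    and "wsa_prob \<beta> \<gamma> N I \<phi> lam {u. a \<le> effective_radius N u \<and> effective_radius N u \<le> b} \<le> 1"
proof -
  let ?Z = "partition_fn \<beta> \<gamma> N I \<phi> lam"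
  let ?A = "{u. a \<le> effective_radius N u \<and> effective_radius N u \<le> b}"
  let ?w = "avoidance_weight \<gamma> N :: (int ^ 'd \<Rightarrow> real ^ 'd) \<Rightarrow> real"
  let ?B = "{X \<in> space gp.P. effective_radius N (field X) > b}"
  have Z0: "?Z > 0" using partition_fn_lower[OF \<gamma>] by (rule less_le_trans[rotated]) simp
  have wm[measurable]: "?w \<in> borel_measurable (field_space N)"
    unfolding avoidance_weight_eq[abs_def] by measurable
  have w01: "0 \<le> ?w u" "?w u \<le> 1" for u
    using \<gamma> by (simp_all add: avoidance_weight_eq self_overlap_nonneg)
  have Am[measurable]: "(indicator ?A :: _ \<Rightarrow> real) \<in> borel_measurable (field_space N)"
    unfolding indicator_def[abs_def] by measurable
  have B: "?B \<in> sets gp.P" by measurable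
  have Z: "?Z = (\<integral>X. ?w (field X) \<partial>gp.P)"
    unfolding partition_fn_def by (rule law_integral) measurable
  have num: "(LINT u|dgff_law \<beta> N I \<phi> lam. ?w u * indicator ?A u) = (\<integral>X. ?w (field X) * indicator ?A (field X) \<partial>gp.P)"
    by (rule law_integral) measurable
  have Q: "wsa_prob \<beta> \<gamma> N I \<phi> lam ?A = (\<integral>X. ?w (field X) * indicator ?A (field X) \<partial>gp.P) / ?Z"
    unfolding wsa_prob_def num by (simp add: divide_inverse mult.commute)
  have wI: "integrable gp.P (\<lambda>X. ?w (field X))"
    by (rule gp.P.integrable_const_bound[of _ 1]) (auto simp: w01)
  have wAI: "integrable gp.P (\<lambda>X. ?w (field X) * indicator ?A (field X))"
    by (rule gp.P.integrable_const_bound[of _ 1]) (auto simp: w01 indicator_def)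
  have BI: "integrable gp.P (indicator ?B :: _ \<Rightarrow> real)"
    using B by (intro integrable_real_indicator) (auto simp: gp.P.emeasure_eq_measure)
  have "?Z - \<delta> - \<eta> \<le> ?Z - \<delta> - gp.P.prob ?B" using large by simp
  also have "\<dots> = (\<integral>X. ?w (field X) - \<delta> - indicator ?B X \<partial>gp.P)"
    using wI BI B by (simp add: Z gp.P.prob_space)
  also have "\<dots> \<le> (\<integral>X. ?w (field X) * indicator ?A (field X) \<partial>gp.P)"
  proof (rule integral_mono[OF _ wAI])
    show "integrable gp.P (\<lambda>X. ?w (field X) - \<delta> - indicator ?B X)" using wI BI by simp
    fix X assume X: "X \<in> space gp.P"
    consider "effective_radius N (field X) < a" | "effective_radius N (field X) > b" | "field X \<in> ?A"
      by force
    then show "?w (field X) - \<delta> - indicator ?B X \<le> ?w (field X) * indicator ?A (field X)"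
    proof cases
      case 1
      have "?w (field X) - \<delta> \<le> 0" using small[OF 1] by simp
      moreover have "0 \<le> (indicator ?B X :: real)" by simp
      moreover have "0 \<le> ?w (field X) * indicator ?A (field X)" by (simp add: w01)
      ultimately show ?thesis by linarith
    next
      case 2
      have "(indicator ?B X :: real) = 1" using 2 X by simp
      moreover have "0 \<le> ?w (field X) * indicator ?A (field X)" by (simp add: w01)
      ultimately show ?thesis using \<delta> w01(2)[of "field X"] by linarith
    next
      case 3
      then have "?w (field X) * indicator ?A (field X) = ?w (field X)" by simp
      moreover have "0 \<le> (indicator ?B X :: real)" by simp
      ultimately show ?thesis using \<delta> by linarith
    qed
  qed
  finally have "(?Z - \<delta> - \<eta>) / ?Z \<le> wsa_prob \<beta> \<gamma> N I \<phi> lam ?A"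
    unfolding Q using Z0 by (intro divide_right_mono) auto
  moreover have "(?Z - \<delta> - \<eta>) / ?Z = 1 - (\<delta> + \<eta>) / ?Z" using Z0 by (simp add: field_simps)
  ultimately show "1 - (\<delta> + \<eta>) / ?Z \<le> wsa_prob \<beta> \<gamma> N I \<phi> lam ?A" by simp
  have "(\<integral>X. ?w (field X) * indicator ?A (field X) \<partial>gp.P) \<le> ?Z"
    unfolding Z by (rule integral_mono[OF wAI wI]) (auto simp: w01 indicator_def)
  then show "wsa_prob \<beta> \<gamma> N I \<phi> lam ?A \<le> 1" unfolding Q using Z0 by simp
qed

text \<open>The estimate for a single box and arbitrary thresholds.  The hypotheses on \<open>a\<close> and \<open>b\<close> hold for the
  two growth rates of the final statement in each dimension; \<open>a \<ge> 1/2\<close> serves to absorb the unit side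
  length of the cells, \<open>2a + 1 \<le> 4a\<close>.\<close>
theorem wsa_prob_radius:
  assumes \<gamma>: "\<gamma> > 0" and a: "a \<ge> 1 / 2" and b: "b \<ge> 0"
    and lower: "a ^ CARD('d) * (log_factor CARD('d) N * (\<beta> + \<gamma>)) \<le> lower_const CARD('d) ^ CARD('d) * \<gamma> * real N ^ CARD('d)"
    and upper: "(upper_const CARD('d))\<^sup>2 * (\<beta> + \<gamma>) * real N ^ CARD('d) * (log_factor CARD('d) N) ^ 3 \<le> b\<^sup>2 * \<beta>"
  shows "1 - (1 + 2 * real CARD('d) * (real (card S))\<^sup>2) * exp (- ((\<beta> + \<gamma>) * real (card S)))
      \<le> wsa_prob \<beta> \<gamma> N I \<phi> lam {u. a \<le> effective_radius N u \<and> effective_radius N u \<le> b}"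
    and "wsa_prob \<beta> \<gamma> N I \<phi> lam {u. a \<le> effective_radius N u \<and> effective_radius N u \<le> b} \<le> 1"
proof -
  define d where "d = CARD('d)"
  define \<Lambda> where "\<Lambda> = log_factor d N"
  define D where "D = cost_const d"
  define n where "n = real (card S)"
  define E where "E = n * \<Lambda> * (\<beta> + \<gamma>)"
  let ?Z = "partition_fn \<beta> \<gamma> N I \<phi> lam"
  note defs = d_def \<Lambda>_def D_def n_def
  have d2: "d \<ge> 2" using dim by (simp add: d_def)
  have \<Lambda>1: "\<Lambda> \<ge> 1" by (simp add: \<Lambda>_def log_factor_ge_1)
  have D0: "D \<ge> 0" by (simp add: D_def cost_const_nonneg)
  have n_eq: "n = real (2 * N + 1) ^ d" by (simp add: n_def d_def card_lattice_box)
  have n1: "n \<ge> 1" unfolding n_eq by (rule one_le_power) simp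
  have E0: "E \<ge> 0" using n1 \<Lambda>1 \<beta> \<gamma> by (simp add: E_def)
  have Z: "exp (- (D * E)) \<le> ?Z"
    using partition_fn_lower[OF \<gamma>] by (simp add: defs E_def mult_ac)
  have small: "(D + 1) * E \<le> \<gamma> * (n\<^sup>2 / (2 * a + 1) ^ d)"
  proof -
    have low: "a ^ d * (\<Lambda> * (\<beta> + \<gamma>)) \<le> lower_const d ^ d * \<gamma> * real N ^ d" using lower by (simp add: defs)
    have "(2 * a + 1) ^ d * (\<Lambda> * (\<beta> + \<gamma>)) \<le> (4 * a) ^ d * (\<Lambda> * (\<beta> + \<gamma>))"
      using a \<Lambda>1 \<beta> \<gamma> by (intro mult_right_mono power_mono) auto
    also have "\<dots> = 4 ^ d * (a ^ d * (\<Lambda> * (\<beta> + \<gamma>)))" by (simp add: power_mult_distrib)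
    also have "\<dots> \<le> 4 ^ d * (lower_const d ^ d * \<gamma> * real N ^ d)"
      using low by (rule mult_left_mono) simp
    also have "\<dots> = \<gamma> * (2 * lower_const d) ^ d * (2 * real N) ^ d"
      by (simp add: power_mult_distrib mult_ac flip: power_mult_distrib[of 2 2])
    also have "\<dots> \<le> \<gamma> * (2 * lower_const d) ^ d * n"
      unfolding n_eq using \<gamma> lower_const_pos[of d] by (intro mult_left_mono power_mono) auto
    finally have 1: "(2 * a + 1) ^ d * (\<Lambda> * (\<beta> + \<gamma>)) \<le> \<gamma> * (2 * lower_const d) ^ d * n" .
    have "(D + 1) ^ 1 \<le> (D + 1) ^ d" using D0 d2 by (intro power_increasing) auto
    moreover have "2 * lower_const d = 1 / (D + 1)" using D0 by (simp add: lower_const_def D_def field_simps)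
    ultimately have "(D + 1) * (2 * lower_const d) ^ d \<le> 1"
      using D0 by (simp add: power_one_over divide_le_eq flip: power_divide)
    then have 2: "(D + 1) * (2 * lower_const d) ^ d * (\<gamma> * n) \<le> 1 * (\<gamma> * n)"
      using \<gamma> n1 by (intro mult_right_mono) auto
    have "(D + 1) * ((2 * a + 1) ^ d * (\<Lambda> * (\<beta> + \<gamma>))) \<le> (D + 1) * (\<gamma> * (2 * lower_const d) ^ d * n)"
      using 1 D0 by (intro mult_left_mono) auto
    also have "\<dots> \<le> \<gamma> * n" using 2 by (simp add: mult_ac)
    finally have "n * ((D + 1) * ((2 * a + 1) ^ d * (\<Lambda> * (\<beta> + \<gamma>)))) \<le> n * (\<gamma> * n)"
      using n1 by (intro mult_left_mono) auto
    then have "(D + 1) * E * (2 * a + 1) ^ d \<le> \<gamma> * n\<^sup>2"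
      by (simp add: E_def power2_eq_square mult_ac)
    then show ?thesis using a by (simp add: pos_le_divide_eq)
  qed
  have w: "avoidance_weight \<gamma> N u \<le> exp (- ((D + 1) * E))" if "effective_radius N u < a"
    for u :: "int ^ 'd \<Rightarrow> real ^ 'd"
  proof -
    have "avoidance_weight \<gamma> N u \<le> exp (- (\<gamma> * (n\<^sup>2 / (2 * a + 1) ^ d)))"
      using weight_le[OF \<gamma> _ that] a by (simp add: defs)
    also have "\<dots> \<le> exp (- ((D + 1) * E))" using small by simp
    finally show ?thesis .
  qed
  have large: "(D + 1) * E \<le> (b / real d)\<^sup>2 / (2 * (sd_max d N \<beta>)\<^sup>2)"
  proof -
    have C: "osc_const d > 0" using d2 by (simp add: osc_const_pos)
    have sd: "2 * (sd_max d N \<beta>)\<^sup>2 = osc_const d * \<Lambda>\<^sup>2 / \<beta>"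
      using \<beta> C by (simp add: sd_max_def \<Lambda>_def)
    have K: "(upper_const d)\<^sup>2 = (D + 1) * 3 ^ d * (real d)\<^sup>2 * osc_const d"
      using D0 C by (simp add: upper_const_def D_def)
    have "n \<le> (3 * real N) ^ d" unfolding n_eq using N by (intro power_mono) auto
    then have n3: "n \<le> 3 ^ d * real N ^ d" by (simp add: power_mult_distrib)
    have up: "(upper_const d)\<^sup>2 * (\<beta> + \<gamma>) * real N ^ d * \<Lambda> ^ 3 \<le> b\<^sup>2 * \<beta>" using upper by (simp add: defs)
    have "(D + 1) * E * ((real d)\<^sup>2 * (osc_const d * \<Lambda>\<^sup>2))
        = n * ((D + 1) * (real d)\<^sup>2 * osc_const d * (\<beta> + \<gamma>) * \<Lambda> ^ 3)"
      by (simp add: E_def power2_eq_square power3_eq_cube mult_ac)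
    also have "\<dots> \<le> (3 ^ d * real N ^ d) * ((D + 1) * (real d)\<^sup>2 * osc_const d * (\<beta> + \<gamma>) * \<Lambda> ^ 3)"
      using n3 D0 C \<beta> \<gamma> \<Lambda>1 by (intro mult_right_mono) auto
    also have "\<dots> = (upper_const d)\<^sup>2 * (\<beta> + \<gamma>) * real N ^ d * \<Lambda> ^ 3"
      unfolding K by (simp add: mult_ac)
    finally have "(D + 1) * E * ((real d)\<^sup>2 * (osc_const d * \<Lambda>\<^sup>2)) \<le> b\<^sup>2 * \<beta>" using up by linarith
    moreover have "(real d)\<^sup>2 * (osc_const d * \<Lambda>\<^sup>2) > 0" using C \<Lambda>1 d2 by simp
    ultimately have "(D + 1) * E \<le> b\<^sup>2 * \<beta> / ((real d)\<^sup>2 * (osc_const d * \<Lambda>\<^sup>2))"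
      by (simp add: pos_le_divide_eq)
    also have "\<dots> = (b / real d)\<^sup>2 / (2 * (sd_max d N \<beta>)\<^sup>2)"
      unfolding sd by (simp add: power_divide)
    finally show ?thesis .
  qed
  have tail: "gp.P.prob {X \<in> space gp.P. effective_radius N (field X) > b} \<le> 2 * real d * n\<^sup>2 * exp (- ((D + 1) * E))"
  proof (rule order_trans[OF radius_tail[OF b]])
    have "exp (- (b / real d)\<^sup>2 / (2 * (sd_max d N \<beta>)\<^sup>2)) \<le> exp (- ((D + 1) * E))" using large by simp
    then show "2 * real CARD('d) * (real (card S))\<^sup>2 * exp (- (b / real CARD('d))\<^sup>2 / (2 * (sd_max CARD('d) N \<beta>)\<^sup>2))
        \<le> 2 * real d * n\<^sup>2 * exp (- ((D + 1) * E))"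
      unfolding d_def n_def by (intro mult_left_mono) auto
  qed
  note bounds = wsa_prob_bounds[where a=a, OF \<gamma> w exp_ge_zero tail]
  let ?c = "1 + 2 * real d * n\<^sup>2"
  have "(exp (- ((D + 1) * E)) + 2 * real d * n\<^sup>2 * exp (- ((D + 1) * E))) / ?Z \<le> ?c * exp (- ((D + 1) * E)) / exp (- (D * E))"
    using Z by (intro frac_le) (auto simp: algebra_simps)
  also have "\<dots> = ?c * exp (- E)"
  proof -
    have "exp (- ((D + 1) * E)) / exp (- (D * E)) = exp (- E)"
      by (simp add: exp_diff[symmetric] algebra_simps)
    then show ?thesis by (metis times_divide_eq_right)
  qed
  also have "\<dots> \<le> ?c * exp (- ((\<beta> + \<gamma>) * n))"
  proof (rule mult_left_mono)
    have "1 * ((\<beta> + \<gamma>) * n) \<le> \<Lambda> * ((\<beta> + \<gamma>) * n)" using \<Lambda>1 \<beta> \<gamma> n1 by (intro mult_right_mono) auto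
    then show "exp (- E) \<le> exp (- ((\<beta> + \<gamma>) * n))" by (simp add: E_def mult_ac)
  qed simp
  finally have error: "(exp (- ((D + 1) * E)) + 2 * real d * n\<^sup>2 * exp (- ((D + 1) * E))) / ?Z
      \<le> ?c * exp (- ((\<beta> + \<gamma>) * n))" .
  show "1 - (1 + 2 * real CARD('d) * (real (card S))\<^sup>2) * exp (- ((\<beta> + \<gamma>) * real (card S)))
      \<le> wsa_prob \<beta> \<gamma> N I \<phi> lam {u. a \<le> effective_radius N u \<and> effective_radius N u \<le> b}"
    using bounds(1) error unfolding d_def n_def by linarith
  show "wsa_prob \<beta> \<gamma> N I \<phi> lam {u. a \<le> effective_radius N u \<and> effective_radius N u \<le> b} \<le> 1"
    by (rule bounds(2))
qed

end

lemma error_term_tendsto_0: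
  assumes c: "c > 0"
  shows "(\<lambda>N. (1 + A * (real (card (lattice_box N :: (int ^ 'd::finite) set)))\<^sup>2)
      * exp (- (c * real (card (lattice_box N :: (int ^ 'd) set))))) \<longlonglongrightarrow> 0"
proof -
  have lim: "((\<lambda>t::real. (1 + A * t\<^sup>2) * exp (- (c * t))) \<longlongrightarrow> 0) at_top"
    using c by real_asymp
  have "filterlim (\<lambda>N. real (card (lattice_box N :: (int ^ 'd) set))) at_top sequentially"
  proof (rule filterlim_at_top_mono[OF filterlim_real_sequentially], rule always_eventually, rule allI)
    fix N :: nat
    have "2 * N + 1 \<le> (2 * N + 1) ^ CARD('d)" by (rule self_le_power) auto
    then have "N \<le> card (lattice_box N :: (int ^ 'd) set)" unfolding card_lattice_box by linarith
    then show "real N \<le> real (card (lattice_box N :: (int ^ 'd) set))" by simp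
  qed
  from filterlim_compose[OF lim this] show ?thesis .
qed

lemma wsa_prob_tendsto_1:
  fixes I :: "nat \<Rightarrow> (int ^ 'd::finite) set" and \<phi> :: "nat \<Rightarrow> int ^ 'd \<Rightarrow> int ^ 'd \<Rightarrow> real"
  assumes dim: "CARD('d) \<ge> 2" and \<beta>: "\<beta> > 0" and \<gamma>: "\<gamma> > 0"
    and basis: "\<And>N. N \<ge> 1 \<Longrightarrow> neumann_eigenbasis N (I N) (\<phi> N) (lam N)"
    and a: "\<forall>\<^sub>F N in sequentially. a N \<ge> 1 / 2" and b: "\<forall>\<^sub>F N in sequentially. b N \<ge> 0"
    and lower: "\<forall>\<^sub>F N in sequentially. a N ^ CARD('d) * (log_factor CARD('d) N * (\<beta> + \<gamma>))
        \<le> lower_const CARD('d) ^ CARD('d) * \<gamma> * real N ^ CARD('d)"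
    and upper: "\<forall>\<^sub>F N in sequentially. (upper_const CARD('d))\<^sup>2 * (\<beta> + \<gamma>) * real N ^ CARD('d) * (log_factor CARD('d) N) ^ 3
        \<le> (b N)\<^sup>2 * \<beta>"
  shows "(\<lambda>N. wsa_prob \<beta> \<gamma> N (I N) (\<phi> N) (lam N) {u. a N \<le> effective_radius N u \<and> effective_radius N u \<le> b N}) \<longlonglongrightarrow> 1"
proof (rule tendsto_sandwich[OF _ _ _ tendsto_const])
  let ?n = "\<lambda>N. real (card (lattice_box N :: (int ^ 'd) set))"
  let ?Q = "\<lambda>N. wsa_prob \<beta> \<gamma> N (I N) (\<phi> N) (lam N) {u. a N \<le> effective_radius N u \<and> effective_radius N u \<le> b N}"
  let ?f = "\<lambda>N. 1 - (1 + 2 * real CARD('d) * (?n N)\<^sup>2) * exp (- ((\<beta> + \<gamma>) * ?n N))"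
  have both: "\<forall>\<^sub>F N in sequentially. ?f N \<le> ?Q N \<and> ?Q N \<le> 1"
    using a b lower upper eventually_ge_at_top[of 1]
  proof eventually_elim
    case (elim N)
    interpret dgff N "I N" "\<phi> N" "lam N" \<beta>
      by unfold_locales (use elim dim \<beta> basis in auto)
    show ?case using wsa_prob_radius[OF \<gamma>] elim by blast
  qed
  show "\<forall>\<^sub>F N in sequentially. ?f N \<le> ?Q N" using both by (rule eventually_mono) simp
  show "\<forall>\<^sub>F N in sequentially. ?Q N \<le> 1" using both by (rule eventually_mono) simp
  have "\<beta> + \<gamma> > 0" using \<beta> \<gamma> by simp
  from tendsto_diff[OF tendsto_const[of 1] error_term_tendsto_0[OF this, of "2 * real CARD('d)", where 'd='d]]
  show "?f \<longlonglongrightarrow> 1" by simp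
qed

lemma powr_inverse_power:
  assumes "x > 0" "n > 0" shows "(x powr (1 / real n)) ^ n = (x::real)"
  using assms by (simp flip: powr_realpow add: powr_powr)

lemma powr_half_square: "(x powr (s / 2))\<^sup>2 = (x::real) powr s"
  by (simp add: power2_eq_square flip: powr_add)

theorem theorem1p1:
  assumes "CARD('d::finite) \<ge> 2"
  shows "\<exists>\<epsilon>\<^sub>0 > (0::real). \<exists>K\<^sub>0 > (0::real). \<forall>\<beta> > (0::real). \<forall>\<gamma> > (0::real).
    \<forall>(I :: nat \<Rightarrow> (int ^ 'd) set) (\<phi> :: nat \<Rightarrow> int ^ 'd \<Rightarrow> int ^ 'd \<Rightarrow> real) (lam :: nat \<Rightarrow> int ^ 'd \<Rightarrow> real).
    (\<forall>N\<ge>1. neumann_eigenbasis N (I N) (\<phi> N) (lam N)) \<longrightarrow>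
      (CARD('d) = 2 \<longrightarrow>
        (\<lambda>N. wsa_prob \<beta> \<gamma> N (I N) (\<phi> N) (lam N)
          {u. \<epsilon>\<^sub>0 * (\<gamma> / (\<beta> + \<gamma>)) powr (1 / 2) * real N * ln (real N) powr (- 1 / 2)
                \<le> effective_radius N u \<and>
              effective_radius N u
                \<le> K\<^sub>0 * ((\<beta> + \<gamma>) / \<beta>) powr (1 / 2) * real N * ln (real N) powr (3 / 2)})
        \<longlonglongrightarrow> 1) \<and>
      (CARD('d) \<ge> 3 \<longrightarrow>
        (\<lambda>N. wsa_prob \<beta> \<gamma> N (I N) (\<phi> N) (lam N)
          {u. \<epsilon>\<^sub>0 * (\<gamma> / (\<beta> + \<gamma>)) powr (1 / real CARD('d)) * real N
                \<le> effective_radius N u \<and>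
              effective_radius N u
                \<le> K\<^sub>0 * ((\<beta> + \<gamma>) / \<beta>) powr (1 / 2) * real N powr (real CARD('d) / 2)})
        \<longlonglongrightarrow> 1)"
proof (intro exI conjI allI impI)
  let ?e = "lower_const CARD('d)" and ?K = "upper_const CARD('d)"
  show "?e > 0" by (rule lower_const_pos)
  show "?K > 0" by (rule upper_const_pos) simp
  fix \<beta> \<gamma> :: real
  fix I :: "nat \<Rightarrow> (int ^ 'd) set" and \<phi> :: "nat \<Rightarrow> int ^ 'd \<Rightarrow> int ^ 'd \<Rightarrow> real" and lam :: "nat \<Rightarrow> int ^ 'd \<Rightarrow> real"
  assume \<beta>: "\<beta> > 0" and \<gamma>: "\<gamma> > 0" and basis: "\<forall>N\<ge>1. neumann_eigenbasis N (I N) (\<phi> N) (lam N)"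
  define p where "p = (\<gamma> / (\<beta> + \<gamma>)) powr (1 / real CARD('d))"
  define q where "q = ((\<beta> + \<gamma>) / \<beta>) powr (1 / 2)"
  have p: "p > 0" "p ^ CARD('d) = \<gamma> / (\<beta> + \<gamma>)"
    using \<beta> \<gamma> powr_inverse_power[of "\<gamma> / (\<beta> + \<gamma>)" "CARD('d)"] by (simp_all add: p_def)
  have q: "q > 0" "q\<^sup>2 = (\<beta> + \<gamma>) / \<beta>"
    using \<beta> \<gamma> powr_inverse_power[of "(\<beta> + \<gamma>) / \<beta>" 2] by (simp_all add: q_def)
  have ep: "?e * p > 0" using lower_const_pos p by simp
  show "(\<lambda>N. wsa_prob \<beta> \<gamma> N (I N) (\<phi> N) (lam N)
      {u. ?e * (\<gamma> / (\<beta> + \<gamma>)) powr (1 / 2) * real N * ln (real N) powr (- 1 / 2) \<le> effective_radius N u \<and>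
        effective_radius N u \<le> ?K * ((\<beta> + \<gamma>) / \<beta>) powr (1 / 2) * real N * ln (real N) powr (3 / 2)}) \<longlonglongrightarrow> 1"
    if d: "CARD('d) = 2"
  proof (rule wsa_prob_tendsto_1[OF assms \<beta> \<gamma>])
    have log: "\<forall>\<^sub>F N in sequentially. log_factor CARD('d) N = ln (real N) \<and> ln (real N) \<ge> 1"
    proof -
      have "\<forall>\<^sub>F N in sequentially. ln (real N) \<ge> 1" by real_asymp
      then show ?thesis by eventually_elim (simp add: log_factor_def d)
    qed
    have p': "(\<gamma> / (\<beta> + \<gamma>)) powr (1 / 2) = p" by (simp add: p_def d)
    show "\<forall>\<^sub>F N in sequentially. 1 / 2 \<le> ?e * (\<gamma> / (\<beta> + \<gamma>)) powr (1 / 2) * real N * ln (real N) powr (- 1 / 2)"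
    proof -
      have "\<forall>\<^sub>F N in sequentially. 1 / 2 \<le> c * (real N * ln (real N) powr (- 1 / 2))" if "c > 0" for c :: real
        using that by real_asymp
      from this[OF ep] show ?thesis unfolding p' by (simp only: mult.assoc)
    qed
    show "\<forall>\<^sub>F N in sequentially. 0 \<le> ?K * ((\<beta> + \<gamma>) / \<beta>) powr (1 / 2) * real N * ln (real N) powr (3 / 2)"
      using upper_const_pos[of "CARD('d)"] by (intro always_eventually allI mult_nonneg_nonneg) auto
    show "\<forall>\<^sub>F N in sequentially. (?e * (\<gamma> / (\<beta> + \<gamma>)) powr (1 / 2) * real N * ln (real N) powr (- 1 / 2)) ^ CARD('d)
        * (log_factor CARD('d) N * (\<beta> + \<gamma>)) \<le> ?e ^ CARD('d) * \<gamma> * real N ^ CARD('d)"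
      using log
    proof eventually_elim
      case (elim N)
      have l: "(ln (real N) powr (- 1 / 2)) ^ 2 = 1 / ln (real N)"
        using powr_half_square[of "ln (real N)" "- 1"] elim by (simp add: powr_minus_divide)
      have "(?e * p * real N * ln (real N) powr (- 1 / 2)) ^ CARD('d) * (ln (real N) * (\<beta> + \<gamma>))
          = ?e ^ CARD('d) * (p ^ CARD('d) * (\<beta> + \<gamma>)) * real N ^ CARD('d) * (1 / ln (real N) * ln (real N))"
        unfolding power_mult_distrib using l d by (simp add: mult_ac)
      also have "\<dots> = ?e ^ CARD('d) * \<gamma> * real N ^ CARD('d)"
        using elim \<beta> \<gamma> by (simp add: p)
      finally show ?case unfolding p' using elim by simp
    qed
    show "\<forall>\<^sub>F N in sequentially. ?K\<^sup>2 * (\<beta> + \<gamma>) * real N ^ CARD('d) * log_factor CARD('d) N ^ 3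
        \<le> (?K * ((\<beta> + \<gamma>) / \<beta>) powr (1 / 2) * real N * ln (real N) powr (3 / 2))\<^sup>2 * \<beta>"
      using log
    proof eventually_elim
      case (elim N)
      have l: "(ln (real N) powr (3 / 2)) ^ 2 = ln (real N) ^ 3"
        using powr_half_square[of "ln (real N)" 3] powr_realpow[of "ln (real N)" 3] elim by simp
      have "(?K * q * real N * ln (real N) powr (3 / 2))\<^sup>2 * \<beta> = ?K\<^sup>2 * (q\<^sup>2 * \<beta>) * (real N)\<^sup>2 * ln (real N) ^ 3"
        unfolding power_mult_distrib l by (simp add: mult_ac)
      also have "\<dots> = ?K\<^sup>2 * (\<beta> + \<gamma>) * real N ^ CARD('d) * log_factor CARD('d) N ^ 3"
        using elim \<beta> by (simp add: q d)
      finally show ?case by (simp add: q_def)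
    qed
  qed (use basis in blast)
  show "(\<lambda>N. wsa_prob \<beta> \<gamma> N (I N) (\<phi> N) (lam N)
      {u. ?e * (\<gamma> / (\<beta> + \<gamma>)) powr (1 / real CARD('d)) * real N \<le> effective_radius N u \<and>
        effective_radius N u \<le> ?K * ((\<beta> + \<gamma>) / \<beta>) powr (1 / 2) * real N powr (real CARD('d) / 2)}) \<longlonglongrightarrow> 1"
    if d: "CARD('d) \<ge> 3"
  proof (rule wsa_prob_tendsto_1[OF assms \<beta> \<gamma>])
    have log: "log_factor CARD('d) N = 1" for N using d by (simp add: log_factor_def)
    show "\<forall>\<^sub>F N in sequentially. 1 / 2 \<le> ?e * (\<gamma> / (\<beta> + \<gamma>)) powr (1 / real CARD('d)) * real N"
    proof -
      have "\<forall>\<^sub>F N in sequentially. 1 / 2 \<le> c * real N" if "c > 0" for c :: real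
        using that by real_asymp
      from this[OF ep] show ?thesis unfolding p_def .
    qed
    show "\<forall>\<^sub>F N in sequentially. 0 \<le> ?K * ((\<beta> + \<gamma>) / \<beta>) powr (1 / 2) * real N powr (real CARD('d) / 2)"
      using upper_const_pos[of "CARD('d)"] by (intro always_eventually allI mult_nonneg_nonneg) auto
    show "\<forall>\<^sub>F N in sequentially. (?e * (\<gamma> / (\<beta> + \<gamma>)) powr (1 / real CARD('d)) * real N) ^ CARD('d)
        * (log_factor CARD('d) N * (\<beta> + \<gamma>)) \<le> ?e ^ CARD('d) * \<gamma> * real N ^ CARD('d)"
      unfolding p_def[symmetric] power_mult_distrib p log using \<beta> \<gamma> by simp
    show "\<forall>\<^sub>F N in sequentially. ?K\<^sup>2 * (\<beta> + \<gamma>) * real N ^ CARD('d) * log_factor CARD('d) N ^ 3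
        \<le> (?K * ((\<beta> + \<gamma>) / \<beta>) powr (1 / 2) * real N powr (real CARD('d) / 2))\<^sup>2 * \<beta>"
      using eventually_gt_at_top[of 0]
    proof eventually_elim
      case (elim N)
      have l: "(real N powr (real CARD('d) / 2)) ^ 2 = real N ^ CARD('d)"
        using elim by (simp only: powr_half_square) (simp add: powr_realpow)
      show ?case
        unfolding q_def[symmetric] power_mult_distrib l log q using \<beta> by simp
    qed
  qed (use basis in blast)
qed

end
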